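(* Let $\omega\in\mathbb{C}$, let $\lambda$ be a partition of $n$, let $\mathcal{U}$ be a standard tableau of shape $\lambda$ with $\sigma_k=j-i$ if $k$ occupies the box $(i,j)$ of $\mathcal{U}$, and let $L_{\mathcal{U}}=E_{\mathcal{U}}(\mathbb{C}^N)^{\otimes n}$. The subspace $L_{\mathcal{U}}$ of $(\mathbb{C}^N)^{\otimes n}$ is invariant under the action of the reflection algebra $\mathrm{B}(\mathfrak{gl}_N)$ given by $$S(u)\mapsto\frac{u-\omega/4}{u+\omega/4}\,R_{0n}(-u-\sigma_n-\omega/4)^{-1}\cdots R_{01}(-u-\sigma_1-\omega/4)^{-1}\,R_{01}(u-\sigma_1-\omega/4)\cdots R_{0n}(u-\sigma_n-\omega/4).$$ Moreover, the representation of $\mathrm{B}(\mathfrak{gl}_N)$ on $L_{\mathcal{U}}$ is isomorphic to the evaluation module $L_{\mathcal{U}}$ obtained from the $\mathfrak{gl}_N$-module $L_{\mathcal{U}}$ via the homomorphism $\mathrm{B}(\mathfrak{gl}_N)\to\mathrm{U}(\mathfrak{gl}_N)$, $$S(u)\mapsto\frac{u+\omega/4}{u-\omega/4}\cdot\frac{u-E^t-\omega/4}{u+E^t+\omega/4}.$$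
   Context: Let $e_{ij}$ be the matrix units of $\mathrm{End}\,\mathbb{C}^N$, $P=\sum_{i,j}e_{ij}\otimes e_{ji}$, and let $R(u)=1-\frac{P}{u}$ be the Yang $R$-matrix. The Yangian $\mathrm{Y}(\mathfrak{gl}_N)$ is the associative algebra with generators $t_{ij}^{(r)}$, $1\leqslant i,j\leqslant N$, $r\geqslant1$, and relations $R(u-v)T_1(u)T_2(v)=T_2(v)T_1(u)R(u-v)$, where $t_{ij}(u)=\delta_{ij}+\sum_{r\geqslant1}t_{ij}^{(r)}u^{-r}$, $T(u)=\sum e_{ij}\otimes t_{ij}(u)$, $T_1(u)=\sum e_{ij}\otimes1\otimes t_{ij}(u)$, $T_2(u)=\sum1\otimes e_{ij}\otimes t_{ij}(u)$. The reflection algebra $\mathrm{B}(\mathfrak{gl}_N)$ is (isomorphic to) the subalgebra of $\mathrm{Y}(\mathfrak{gl}_N)$ generated by the coefficients of the entries $s_{ij}(u)$ of $S(u)=T(-u)^{-1}T(u)$. $E=[E_{ij}]$ is the $N\times N$ matrix whose $(i,j)$ entry is the standard generator $E_{ij}$ of $\mathrm{U}(\mathfrak{gl}_N)$ and $E^t$ is its transpose. The evaluation homomorphism $\mathrm{Y}(\mathfrak{gl}_N)\to\mathrm{U}(\mathfrak{gl}_N)$, $T(u)\mapsto\frac{u-E^t-\omega/4}{u-\omega/4}$, restricts to $\mathrm{B}(\mathfrak{gl}_N)$ as the homomorphism displayed in the claim. In $\mathrm{End}\,\mathbb{C}^N\otimes\mathrm{End}(\mathbb{C}^N)^{\otimes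 n}$ the tensor factors are labelled $0,1,\dots,n$, and $R_{0i}(u)$ acts as $R(u)$ on copies $0$ and $i$ and as the identity elsewhere. The image of $S(u)$ is a formal series in $u^{-1}$ with coefficients in this algebra: the image of $s_{ij}(u)$ is the coefficient (in $\mathrm{End}(\mathbb{C}^N)^{\otimes n}[[u^{-1}]]$) of $e_{ij}$ in the $0$-th factor. $\mathfrak{gl}_N$ acts on $\mathbb{C}^N$ by $E_{ij}\mapsto e_{ij}$ and on $(\mathbb{C}^N)^{\otimes n}$ as on a tensor product of Lie algebra modules; the symmetric group $\mathfrak{S}_n$ acts by permuting tensor factors, and the two actions commute. The primitive idempotent $E_{\mathcal{U}}\in\mathbb{C}[\mathfrak{S}_n]$ is defined, with $x_r=\sum_{i=1}^{r-1}(i,r)$ the Jucys--Murphy elements, by $E_{\mathcal{U}}=1$ for $n=1$ and, for $n\geqslant2$, $$E_{\mathcal{U}}=E_{\mathcal{V}}\,\frac{(x_n-a_1)\cdots(x_n-a_k)}{(\sigma_n-a_1)\cdots(\sigma_n-a_k)},$$ where $\mathcal{V}$ is obtained from $\mathcal{U}$ by removing the box $\alpha$ occupied by $n$, and $a_1,\dots,a_k$ are the values $j-i$ for all boxes $(i,j)$, excluding $\alpha$, which can be added to the shape of $\mathcal{V}$ to get a diagram. The subspace $L_{\mathcal{U}}$ is nonzero if the number of boxes in the first column of $\lambda$ does not exceed $N$, and is then an irreducible representation of $\mathfrak{gl}_N$ with highest weight $\lambda$.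
   Formalization: As printed the isomorphism fails for ω≠0 (N=n=1: scalars differ). Proved instead: first display as printed ≅ pullback via (u−E^t−ω/4)/(u+E^t+ω/4), and first display without its prefactor ≅ pullback via the second display. Invariance is as printed. *)

theory Defs
  imports
    "HOL-Analysis.Analysis"
    "HOL-Library.Poly_Mapping"
    "HOL-Combinatorics.Perm"
    "HOL-Computational_Algebra.Formal_Laurent_Series"
begin

unbundle no Formal_Power_Series.fps_syntax

section \<open>Unital complex algebras\<close>

class complex_algebra_1 = ring_1 +
  fixes cscale :: "complex \<Rightarrow> 'a \<Rightarrow> 'a"  (infixr \<open>*\<^sub>C\<close> 75)
  assumes cscale_add_right: "c *\<^sub>C (x + y) = c *\<^sub>C x + c *\<^sub>C y"
    and cscale_add_left: "(c + d) *\<^sub>C x = c *\<^sub>C x + d *\<^sub>C x"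
    and cscale_cscale: "c *\<^sub>C d *\<^sub>C x = (c * d) *\<^sub>C x"
    and cscale_one: "1 *\<^sub>C x = x"
    and cscale_mult_left: "(c *\<^sub>C x) * y = c *\<^sub>C (x * y)"
    and cscale_mult_right: "x * (c *\<^sub>C y) = c *\<^sub>C (x * y)"

inductive_set gen_subalgebra :: "'a::complex_algebra_1 set \<Rightarrow> 'a set" for G where
  gen: "g \<in> G \<Longrightarrow> g \<in> gen_subalgebra G"
| one: "1 \<in> gen_subalgebra G"
| add: "x \<in> gen_subalgebra G \<Longrightarrow> y \<in> gen_subalgebra G \<Longrightarrow> x + y \<in> gen_subalgebra G"
| mult: "x \<in> gen_subalgebra G \<Longrightarrow> y \<in> gen_subalgebra G \<Longrightarrow> x * y \<in> gen_subalgebra G"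
| scale: "x \<in> gen_subalgebra G \<Longrightarrow> c *\<^sub>C x \<in> gen_subalgebra G"

definition algebra_hom_on ::
    "'a::complex_algebra_1 set \<Rightarrow> ('a \<Rightarrow> 'b::complex_algebra_1) \<Rightarrow> bool" where
  "algebra_hom_on A f \<longleftrightarrow> f 1 = 1 \<and>
     (\<forall>x\<in>A. \<forall>y\<in>A. f (x + y) = f x + f y \<and> f (x * y) = f x * f y) \<and>
     (\<forall>c. \<forall>x\<in>A. f (c *\<^sub>C x) = c *\<^sub>C f x)"

text \<open>Endomorphism algebras are algebras of square matrices under \<open>**\<close>; the operation \<open>*\<close> on
  the type of matrices is the componentwise product, so they are not instances of the class.\<close>

definition scalar_mat :: "'a::times \<Rightarrow> 'a^'i^'j \<Rightarrow> 'a^'i^'j"  (infixr \<open>*\<^sub>M\<close> 75) where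
  "c *\<^sub>M A = (\<chi> i j. c * A $ i $ j)"

definition matrix_rep_on ::
    "'a::complex_algebra_1 set \<Rightarrow> ('a \<Rightarrow> complex^'i::finite^'i) \<Rightarrow> bool" where
  "matrix_rep_on A f \<longleftrightarrow> f 1 = mat 1 \<and>
     (\<forall>x\<in>A. \<forall>y\<in>A. f (x + y) = f x + f y \<and> f (x * y) = f x ** f y) \<and>
     (\<forall>c. \<forall>x\<in>A. f (c *\<^sub>C x) = c *\<^sub>M f x)"

definition invariant_under ::
    "'a set \<Rightarrow> ('a \<Rightarrow> complex^'i::finite^'i) \<Rightarrow> (complex^'i) set \<Rightarrow> bool" where
  "invariant_under A f L \<longleftrightarrow> (\<forall>a\<in>A. \<forall>v\<in>L. f a *v v \<in> L)"

definition isomorphic_reps ::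
    "'a set \<Rightarrow> ('a \<Rightarrow> complex^'i::finite^'i) \<Rightarrow> (complex^'i) set
            \<Rightarrow> ('a \<Rightarrow> complex^'j::finite^'j) \<Rightarrow> (complex^'j) set \<Rightarrow> bool" where
  "isomorphic_reps A f L g M \<longleftrightarrow> invariant_under A f L \<and> invariant_under A g M \<and>
     (\<exists>\<phi>. bij_betw \<phi> L M \<and>
        (\<forall>v\<in>L. \<forall>w\<in>L. \<phi> (v + w) = \<phi> v + \<phi> w) \<and>
        (\<forall>c. \<forall>v\<in>L. \<phi> (c *s v) = c *s \<phi> v) \<and>
        (\<forall>a\<in>A. \<forall>v\<in>L. \<phi> (f a *v v) = g a *v \<phi> v))"


section \<open>Free algebras and two-sided ideals\<close>

text \<open>The free complex algebra on a set of letters is the monoid algebra of the free monoid of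
  words. The product of \<^typ>\<open>'m \<Rightarrow>\<^sub>0 complex\<close> is convolution for an additively written monoid,
  so concatenation is written as addition of words.\<close>

instantiation list :: (type) monoid_add
begin
definition zero_list :: "'a list" where "zero_list = []"
definition plus_list :: "'a list \<Rightarrow> 'a list \<Rightarrow> 'a list" where "plus_list = (@)"
instance by standard (simp_all add: zero_list_def plus_list_def)
end

type_synonym 'x free_algebra = "'x list \<Rightarrow>\<^sub>0 complex"

definition letter :: "'x \<Rightarrow> 'x free_algebra" where
  "letter x = Poly_Mapping.single [x] 1"

lemma lookup_letter: "Poly_Mapping.lookup (letter x) 0 = 0"
  by (simp add: letter_def lookup_single when_def zero_list_def)

inductive_set gen_ideal :: "'a::ring_1 set \<Rightarrow> 'a set" for G where
  zero: "0 \<in> gen_ideal G"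
| step: "x \<in> gen_ideal G \<Longrightarrow> g \<in> G \<Longrightarrow> x + a * g * b \<in> gen_ideal G"

lemma gen_ideal_add: "y \<in> gen_ideal G \<Longrightarrow> x \<in> gen_ideal G \<Longrightarrow> x + y \<in> gen_ideal G"
proof (induction rule: gen_ideal.induct)
  case zero
  then show ?case by simp
next
  case (step y g a b)
  then have "(x + y) + a * g * b \<in> gen_ideal G" by (intro gen_ideal.step) auto
  then show ?case by (simp add: add.assoc)
qed

lemma gen_ideal_mult: "x \<in> gen_ideal G \<Longrightarrow> c * x * d \<in> gen_ideal G"
proof (induction rule: gen_ideal.induct)
  case zero
  then show ?case by (simp add: gen_ideal.zero)
next
  case (step x g a b)
  then have "c * x * d + (c * a) * g * (b * d) \<in> gen_ideal G" by (intro gen_ideal.step) auto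
  then show ?case by (simp add: algebra_simps)
qed

lemma gen_ideal_mult_left: "x \<in> gen_ideal G \<Longrightarrow> c * x \<in> gen_ideal G"
  using gen_ideal_mult[of x G c 1] by simp

lemma gen_ideal_mult_right: "x \<in> gen_ideal G \<Longrightarrow> x * c \<in> gen_ideal G"
  using gen_ideal_mult[of x G 1 c] by simp

lemma gen_ideal_uminus: "x \<in> gen_ideal G \<Longrightarrow> - x \<in> gen_ideal G"
  using gen_ideal_mult_left[of x G "- 1"] by simp

definition ideal_cong :: "'a::ring_1 set \<Rightarrow> 'a \<Rightarrow> 'a \<Rightarrow> bool" where
  "ideal_cong G x y \<longleftrightarrow> x - y \<in> gen_ideal G"

lemma equivp_ideal_cong: "equivp (ideal_cong G)"
proof (rule equivpI)
  show "reflp (ideal_cong G)"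
    by (simp add: reflp_def ideal_cong_def gen_ideal.zero)
  show "symp (ideal_cong G)"
    unfolding symp_def ideal_cong_def using gen_ideal_uminus by fastforce
  show "transp (ideal_cong G)"
  proof (rule transpI, unfold ideal_cong_def)
    fix x y z assume "x - y \<in> gen_ideal G" "y - z \<in> gen_ideal G"
    then have "(x - y) + (y - z) \<in> gen_ideal G" by (intro gen_ideal_add)
    then show "x - z \<in> gen_ideal G" by simp
  qed
qed

lemma ideal_cong_add:
  assumes "ideal_cong G x x'" "ideal_cong G y y'"
  shows "ideal_cong G (x + y) (x' + y')"
  using gen_ideal_add[of "x - x'" G "y - y'"] assms
  by (simp add: ideal_cong_def algebra_simps)

lemma ideal_cong_uminus: "ideal_cong G x x' \<Longrightarrow> ideal_cong G (- x) (- x')"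
  using gen_ideal_uminus[of "x - x'" G] by (simp add: ideal_cong_def)

lemma ideal_cong_diff:
  assumes "ideal_cong G x x'" "ideal_cong G y y'"
  shows "ideal_cong G (x - y) (x' - y')"
  using ideal_cong_add[OF assms(1) ideal_cong_uminus[OF assms(2)]] by simp

lemma ideal_cong_mult:
  assumes "ideal_cong G x x'" "ideal_cong G y y'"
  shows "ideal_cong G (x * y) (x' * y')"
proof -
  have "(x - x') * y + x' * (y - y') \<in> gen_ideal G"
    using assms unfolding ideal_cong_def
    by (intro gen_ideal_add gen_ideal_mult_left gen_ideal_mult_right)
  then show ?thesis by (simp add: ideal_cong_def algebra_simps)
qed

lemma poly_mapping_single_induct:
  assumes "P 0" "\<And>x k c. P x \<Longrightarrow> P (x + Poly_Mapping.single k c)"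
  shows "P (x :: 'k \<Rightarrow>\<^sub>0 'c::comm_monoid_add)"
proof (induction x rule: update_induct)
  case const
  then show ?case using assms(1) by simp
next
  case (update f a b)
  have "Poly_Mapping.update a b f = f + Poly_Mapping.single a b"
    using update by (intro poly_mapping_eqI)
      (auto simp: lookup_update lookup_add lookup_single when_def in_keys_iff)
  then show ?case using assms(2) update by simp
qed

lemma single_zero_commute:
  fixes x :: "'x free_algebra"
  shows "x * Poly_Mapping.single 0 c = Poly_Mapping.single 0 c * x"
  by (induction x rule: poly_mapping_single_induct)
     (simp_all add: mult_single algebra_simps)

lemma lookup_mult_empty:
  fixes x y :: "'x free_algebra"
  shows "Poly_Mapping.lookup (x * y) 0 = Poly_Mapping.lookup x 0 * Poly_Mapping.lookup y 0"
proof -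
  have 1: "Poly_Mapping.lookup (x * Poly_Mapping.single l d) 0 = Poly_Mapping.lookup x 0 * (d when l = 0)" for l d
    by (induction x rule: poly_mapping_single_induct)
      (auto simp: mult_single algebra_simps lookup_add lookup_single when_def zero_list_def plus_list_def)
  show ?thesis
    by (induction y rule: poly_mapping_single_induct)
      (auto simp: algebra_simps lookup_add 1 lookup_single when_def)
qed

definition proper_ideal :: "'a::ring_1 set \<Rightarrow> bool" where
  "proper_ideal I \<longleftrightarrow> 0 \<in> I \<and> 1 \<notin> I \<and> (\<forall>x\<in>I. \<forall>y\<in>I. x + y \<in> I) \<and> (\<forall>a. \<forall>x\<in>I. a * x \<in> I \<and> x * a \<in> I)"

lemma proper_ideal_sum: "proper_ideal I \<Longrightarrow> (\<And>i. i \<in> A \<Longrightarrow> f i \<in> I) \<Longrightarrow> sum f A \<in> I"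
  by (induction A rule: infinite_finite_induct) (auto simp: proper_ideal_def)

lemma proper_ideal_augmentation: "proper_ideal {x :: 'x free_algebra. Poly_Mapping.lookup x 0 = 0}"
  by (auto simp: proper_ideal_def lookup_mult_empty lookup_add)

lemma proper_ideal_fls:
  assumes I: "proper_ideal I"
  shows "proper_ideal {F. \<forall>k. fls_nth F k \<in> I}"
proof -
  have "0 \<in> I" "1 \<notin> I" using I by (auto simp: proper_ideal_def)
  then have "fls_nth 1 0 \<notin> I" by simp
  then show ?thesis using I unfolding proper_ideal_def
    by (auto simp: fls_times_nth(1) intro!: proper_ideal_sum[OF I] \<open>0 \<in> I\<close>)
qed

lemma commutator_in_ideal:
  fixes A B R :: "'a::ring_1^'i::finite^'i"
  assumes I: "proper_ideal I" and "\<And>i j. (A - mat 1) $ i $ j \<in> I" "\<And>i j. (B - mat 1) $ i $ j \<in> I"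
  shows "(R ** A ** B - B ** A ** R) $ i $ j \<in> I"
proof -
  have radd: "(X + Y) ** Z = X ** Z + Y ** Z" for X Y Z :: "'a^'i^'i"
    by (simp add: matrix_matrix_mult_def vec_eq_iff distrib_right sum.distrib)
  define J :: "('a^'i^'i) set" where "J = {M. \<forall>i j. M $ i $ j \<in> I}"
  have l: "X ** M \<in> J" and r: "M ** X \<in> J" if "M \<in> J" for M X
    using that I unfolding J_def matrix_matrix_mult_def
    by (auto intro!: proper_ideal_sum[OF I] simp: proper_ideal_def)
  have add: "M + X \<in> J" if "M \<in> J" "X \<in> J" for M X
    using that I unfolding J_def by (auto simp: proper_ideal_def)
  have um: "- M \<in> J" if "M \<in> J" for M
  proof -
    have "- x \<in> I" if "x \<in> I" for x
      using I that unfolding proper_ideal_def by (metis mult_minus1)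
    then show ?thesis using that by (auto simp: J_def)
  qed
  have diff: "M - X \<in> J" if "M \<in> J" "X \<in> J" for M X
    using add[OF that(1) um[OF that(2)]] by simp
  define a b where "a = A - mat 1" and "b = B - mat 1"
  have ab: "a \<in> J" "b \<in> J" using assms by (auto simp: a_def b_def J_def)
  have "A = mat 1 + a" "B = mat 1 + b" by (auto simp: a_def b_def)
  then have "R ** A ** B - B ** A ** R =
     (R ** a + R ** b + R ** a ** b) - (a ** R + b ** R + b ** a ** R)"
    by (simp add: matrix_add_ldistrib radd matrix_mul_assoc algebra_simps)
  moreover have "\<dots> \<in> J" using ab by (intro diff add l r) 
  ultimately show ?thesis by (auto simp: J_def)
qed

lemma gen_ideal_subset:
  assumes "proper_ideal I" "G \<subseteq> I"
  shows "gen_ideal G \<subseteq> I"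
proof
  fix x assume "x \<in> gen_ideal G"
  then show "x \<in> I"
    by induction (use assms in \<open>auto simp: proper_ideal_def\<close>)
qed

lemma ideal_cong_zero_one:
  fixes G :: "'x free_algebra set"
  assumes "\<And>g. g \<in> G \<Longrightarrow> Poly_Mapping.lookup g 0 = 0"
  shows "\<not> ideal_cong G 0 1"
proof
  assume "ideal_cong G 0 1"
  then have "- 1 \<in> gen_ideal G" by (simp add: ideal_cong_def)
  then have "Poly_Mapping.lookup (- 1 :: 'x free_algebra) 0 = 0"
    using gen_ideal_subset[OF proper_ideal_augmentation, of G] assms by blast
  then show False by simp
qed

lemma ideal_cong_eqI: "x = y \<Longrightarrow> ideal_cong G x y"
  by (simp add: ideal_cong_def gen_ideal.zero)


section \<open>Matrices and Laurent series\<close>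

text \<open>All formal series in \<open>u\<inverse>\<close> are Laurent series with \<^term>\<open>fls_X\<close> standing for \<open>u\<inverse>\<close>, so that
  \<^term>\<open>fls_X_inv\<close> is \<open>u\<close>; rational functions of \<open>u\<close> are expanded at \<open>u = \<infinity>\<close>.\<close>

definition map_fls :: "('a::zero \<Rightarrow> 'b::zero) \<Rightarrow> 'a fls \<Rightarrow> 'b fls" where
  "map_fls f F = Abs_fls (\<lambda>k. f (fls_nth F k))"

text \<open>\<open>F(u) \<mapsto> F(-u)\<close>\<close>
definition fls_flip :: "'a::ring_1 fls \<Rightarrow> 'a fls" where
  "fls_flip F = Abs_fls (\<lambda>k. (if even k then 1 else - 1) * fls_nth F k)"

definition fls_scalar :: "complex fls \<Rightarrow> 'a::complex_algebra_1 fls" where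
  "fls_scalar = map_fls (\<lambda>c. c *\<^sub>C 1)"

definition kron :: "'a::times^'i^'i \<Rightarrow> 'a^'j^'j \<Rightarrow> 'a^('i \<times> 'j)^('i \<times> 'j)"  (infixr \<open>\<otimes>\<^sub>M\<close> 72) where
  "A \<otimes>\<^sub>M B = (\<chi> p q. A $ fst p $ fst q * B $ snd p $ snd q)"

definition matrix_unit :: "'i \<Rightarrow> 'i \<Rightarrow> 'a::zero_neq_one^'i^'i" where
  "matrix_unit i j = (\<chi> k l. if k = i \<and> l = j then 1 else 0)"

definition Pmat :: "'a::ring_1^('N::finite \<times> 'N)^('N \<times> 'N)" where
  "Pmat = (\<Sum>i\<in>UNIV. \<Sum>j\<in>UNIV. matrix_unit i j \<otimes>\<^sub>M matrix_unit j i)"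

definition Rmat :: "'a::field \<Rightarrow> 'a^('N::finite \<times> 'N)^('N \<times> 'N)" where
  "Rmat u = mat 1 - (1 / u) *\<^sub>M Pmat"


section \<open>The Yangian\<close>

text \<open>The letter \<open>(i, j, r)\<close> stands for the generator \<open>t\<^sub>i\<^sub>j\<^sup>(\<^sup>r\<^sup>+\<^sup>1\<^sup>)\<close>; the index \<open>r = 0\<close>
  of \<open>free_t\<close> is the constant term \<open>\<delta>\<^sub>i\<^sub>j\<close>.\<close>
fun free_t :: "'N \<Rightarrow> 'N \<Rightarrow> nat \<Rightarrow> ('N \<times> 'N \<times> nat) free_algebra" where
  "free_t i j 0 = (if i = j then 1 else 0)"
| "free_t i j (Suc r) = letter (i, j, r)"

text \<open>The relations are the coefficients in \<open>u\<close>, \<open>v\<close> of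
  \<open>(u - v) R(u - v) T\<^sub>1(u) T\<^sub>2(v) = T\<^sub>2(v) T\<^sub>1(u) (u - v) R(u - v)\<close>, where
  \<open>(u - v) R(u - v) = u - v - P\<close>. These are iterated Laurent series, \<open>u\<inverse>\<close> being the variable of
  the coefficients and \<open>v\<inverse>\<close> the outer variable.\<close>
definition rtt_difference ::
    "(('N::finite \<times> 'N \<times> nat) free_algebra fls fls)^('N \<times> 'N)^('N \<times> 'N)" where
  "rtt_difference =
    (let u = fls_const fls_X_inv; v = fls_X_inv;
         T1 = (\<chi> i j. fls_const (fps_to_fls (Abs_fps (free_t i j)))) \<otimes>\<^sub>M mat 1;
         T2 = mat 1 \<otimes>\<^sub>M (\<chi> i j. fps_to_fls (Abs_fps (\<lambda>s. fls_const (free_t i j s))));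
         R = mat (u - v) - Pmat
     in R ** T1 ** T2 - T2 ** T1 ** R)"

definition yangian_relators :: "('N::finite \<times> 'N \<times> nat) free_algebra set" where
  "yangian_relators = {fls_nth (fls_nth (rtt_difference $ p $ q) s) r | p q s r. True}"

lemma proper_ideal_coeff:
  "proper_ideal {F :: 'x free_algebra fls fls. \<forall>s r. Poly_Mapping.lookup (fls_nth (fls_nth F s) r) 0 = 0}"
  using proper_ideal_fls[OF proper_ideal_fls[OF proper_ideal_augmentation]] by simp

lemma lookup_free_t: "Poly_Mapping.lookup (free_t i j r) 0 = (if r = 0 \<and> i = j then 1 else 0)"
  by (cases r) (auto simp: lookup_letter)

lemma augmentation_yangian_relators:
  assumes "g \<in> yangian_relators"
  shows "Poly_Mapping.lookup g 0 = 0"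
proof -
  define I :: "('a \<times> 'a \<times> nat) free_algebra fls fls set"
    where "I = {F. \<forall>s r. Poly_Mapping.lookup (fls_nth (fls_nth F s) r) 0 = 0}"
  define A :: "(('a \<times> 'a \<times> nat) free_algebra fls fls)^'a^'a"
    where "A = (\<chi> i j. fls_const (fps_to_fls (Abs_fps (free_t i j))))"
  define B :: "(('a \<times> 'a \<times> nat) free_algebra fls fls)^'a^'a"
    where "B = (\<chi> i j. fps_to_fls (Abs_fps (\<lambda>s. fls_const (free_t i j s))))"
  have A: "A $ i $ j - (if i = j then 1 else 0) \<in> I" for i j
    by (auto simp: I_def A_def lookup_minus lookup_free_t)
  have B: "B $ i $ j - (if i = j then 1 else 0) \<in> I" for i j
    by (auto simp: I_def B_def lookup_minus lookup_free_t)
  have 0: "0 \<in> I" by (simp add: I_def)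
  have "(A \<otimes>\<^sub>M mat 1 - mat 1) $ p $ q =
      (if snd p = snd q then A $ fst p $ fst q - (if fst p = fst q then 1 else 0) else 0)" for p q
    by (auto simp: kron_def mat_def prod_eq_iff)
  then have "(A \<otimes>\<^sub>M mat 1 - mat 1) $ p $ q \<in> I" for p q
    by (metis A 0)
  moreover have "(mat 1 \<otimes>\<^sub>M B - mat 1) $ p $ q =
      (if fst p = fst q then B $ snd p $ snd q - (if snd p = snd q then 1 else 0) else 0)" for p q
    by (auto simp: kron_def mat_def prod_eq_iff)
  then have "(mat 1 \<otimes>\<^sub>M B - mat 1) $ p $ q \<in> I" for p q
    by (metis B 0)
  ultimately have "rtt_difference $ p $ q \<in> I" for p q
    unfolding rtt_difference_def Let_def A_def[symmetric] B_def[symmetric]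
    by (intro commutator_in_ideal) (simp_all add: I_def proper_ideal_coeff)
  then show ?thesis using assms by (auto simp: yangian_relators_def I_def)
qed

quotient_type 'N yangian = "('N::finite \<times> 'N \<times> nat) free_algebra" / "ideal_cong yangian_relators"
  by (rule equivp_ideal_cong)

instantiation yangian :: (finite) complex_algebra_1
begin
lift_definition zero_yangian :: "'a yangian" is 0 .
lift_definition one_yangian :: "'a yangian" is 1 .
lift_definition plus_yangian :: "'a yangian \<Rightarrow> 'a yangian \<Rightarrow> 'a yangian" is "(+)"
  by (rule ideal_cong_add)
lift_definition minus_yangian :: "'a yangian \<Rightarrow> 'a yangian \<Rightarrow> 'a yangian" is "(-)"
  by (rule ideal_cong_diff)
lift_definition uminus_yangian :: "'a yangian \<Rightarrow> 'a yangian" is uminus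
  by (rule ideal_cong_uminus)
lift_definition times_yangian :: "'a yangian \<Rightarrow> 'a yangian \<Rightarrow> 'a yangian" is "(*)"
  by (rule ideal_cong_mult)
lift_definition cscale_yangian :: "complex \<Rightarrow> 'a yangian \<Rightarrow> 'a yangian"
  is "\<lambda>c x. Poly_Mapping.single 0 c * x"
  by (rule ideal_cong_mult[OF equivp_reflp[OF equivp_ideal_cong]])
instance
proof
  show "(0 :: 'a yangian) \<noteq> 1"
    by transfer (rule ideal_cong_zero_one[OF augmentation_yangian_relators])
  show "1 *\<^sub>C x = x" for x :: "'a yangian"
    by transfer (rule ideal_cong_eqI, simp)
  show "c *\<^sub>C d *\<^sub>C x = (c * d) *\<^sub>C x" for c d and x :: "'a yangian"
    by transfer (rule ideal_cong_eqI, simp add: mult_single flip: mult.assoc)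
  show "x * (c *\<^sub>C y) = c *\<^sub>C (x * y)" for c and x y :: "'a yangian"
    by transfer (rule ideal_cong_eqI, simp add: mult.assoc[symmetric] single_zero_commute)
qed (transfer; rule ideal_cong_eqI;
     simp add: algebra_simps single_add mult_single)+
end

lift_definition yangian_t :: "'N::finite \<Rightarrow> 'N \<Rightarrow> nat \<Rightarrow> 'N yangian" is free_t .

definition Tmat :: "('N::finite yangian fls)^'N^'N" where
  "Tmat = (\<chi> i j. fps_to_fls (Abs_fps (yangian_t i j)))"

text \<open>\<open>S(u) = T(-u)\<inverse> T(u)\<close>\<close>
definition Smat :: "('N::finite yangian fls)^'N^'N" where
  "Smat = matrix_inv (map_matrix fls_flip Tmat) ** Tmat"

definition reflection_algebra :: "'N::finite yangian set" where
  "reflection_algebra = gen_subalgebra {fls_nth (Smat $ i $ j) k | i j k. True}"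


section \<open>The universal enveloping algebra of \<open>gl\<^sub>N\<close>\<close>

definition gl_relators :: "('N \<times> 'N) free_algebra set" where
  "gl_relators = {letter (i, j) * letter (k, l) - letter (k, l) * letter (i, j)
      - ((if k = j then letter (i, l) else 0) - (if i = l then letter (k, j) else 0)) | i j k l. True}"

lemma augmentation_gl_relators: "g \<in> gl_relators \<Longrightarrow> Poly_Mapping.lookup g 0 = 0"
  by (auto simp: gl_relators_def lookup_minus lookup_mult_empty lookup_letter)

quotient_type 'N gl_envelope = "('N::finite \<times> 'N) free_algebra" / "ideal_cong gl_relators"
  by (rule equivp_ideal_cong)

instantiation gl_envelope :: (finite) complex_algebra_1
begin
lift_definition zero_gl_envelope :: "'a gl_envelope" is 0 .
lift_definition one_gl_envelope :: "'a gl_envelope" is 1 .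
lift_definition plus_gl_envelope :: "'a gl_envelope \<Rightarrow> 'a gl_envelope \<Rightarrow> 'a gl_envelope" is "(+)"
  by (rule ideal_cong_add)
lift_definition minus_gl_envelope :: "'a gl_envelope \<Rightarrow> 'a gl_envelope \<Rightarrow> 'a gl_envelope" is "(-)"
  by (rule ideal_cong_diff)
lift_definition uminus_gl_envelope :: "'a gl_envelope \<Rightarrow> 'a gl_envelope" is uminus
  by (rule ideal_cong_uminus)
lift_definition times_gl_envelope :: "'a gl_envelope \<Rightarrow> 'a gl_envelope \<Rightarrow> 'a gl_envelope" is "(*)"
  by (rule ideal_cong_mult)
lift_definition cscale_gl_envelope :: "complex \<Rightarrow> 'a gl_envelope \<Rightarrow> 'a gl_envelope"
  is "\<lambda>c x. Poly_Mapping.single 0 c * x"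
  by (rule ideal_cong_mult[OF equivp_reflp[OF equivp_ideal_cong]])
instance
proof
  show "(0 :: 'a gl_envelope) \<noteq> 1"
    by transfer (rule ideal_cong_zero_one[OF augmentation_gl_relators])
  show "1 *\<^sub>C x = x" for x :: "'a gl_envelope"
    by transfer (rule ideal_cong_eqI, simp)
  show "c *\<^sub>C d *\<^sub>C x = (c * d) *\<^sub>C x" for c d and x :: "'a gl_envelope"
    by transfer (rule ideal_cong_eqI, simp add: mult_single flip: mult.assoc)
  show "x * (c *\<^sub>C y) = c *\<^sub>C (x * y)" for c and x y :: "'a gl_envelope"
    by transfer (rule ideal_cong_eqI, simp add: mult.assoc[symmetric] single_zero_commute)
qed (transfer; rule ideal_cong_eqI;
     simp add: algebra_simps single_add mult_single)+
end

lift_definition gl_E :: "'N::finite \<Rightarrow> 'N \<Rightarrow> 'N gl_envelope" is "\<lambda>i j. letter (i, j)" .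

definition Emat :: "('N::finite gl_envelope)^'N^'N" where
  "Emat = (\<chi> i j. gl_E i j)"

text \<open>With \<open>w = \<omega>/4\<close>, this is \<open>(u + w)/(u - w) \<sqdot> (u - E\<^sup>t - w)/(u + E\<^sup>t + w)\<close>; the two matrices in
  the fraction commute, so the order of the factors is immaterial.\<close>
definition evaluation_Smat :: "complex \<Rightarrow> ('N::finite gl_envelope fls)^'N^'N" where
  "evaluation_Smat \<omega> =
    (let u = fls_X_inv; w = fls_const (\<omega> / 4); Et = map_matrix fls_const (transpose Emat)
     in fls_scalar ((u + w) / (u - w)) *\<^sub>M
          ((mat (fls_scalar (u - w)) - Et) ** matrix_inv (mat (fls_scalar (u + w)) + Et)))"


section \<open>Standard tableaux and primitive idempotents\<close>

definition partition_of :: "nat \<Rightarrow> nat list \<Rightarrow> bool" where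
  "partition_of n lam \<longleftrightarrow> sorted_wrt (\<ge>) lam \<and> 0 \<notin> set lam \<and> sum_list lam = n"

definition diagram :: "nat list \<Rightarrow> (nat \<times> nat) set" where
  "diagram lam = {(i, j). 1 \<le> i \<and> i \<le> length lam \<and> 1 \<le> j \<and> j \<le> lam ! (i - 1)}"

definition is_diagram :: "(nat \<times> nat) set \<Rightarrow> bool" where
  "is_diagram D \<longleftrightarrow> (\<exists>n lam. partition_of n lam \<and> D = diagram lam)"

text \<open>A tableau is given by the function sending \<open>k\<close> to the box it occupies; its values outside
  \<open>{1..n}\<close> are irrelevant.\<close>
definition standard_tableau :: "nat list \<Rightarrow> (nat \<Rightarrow> nat \<times> nat) \<Rightarrow> bool" where
  "standard_tableau lam U \<longleftrightarrow> bij_betw U {1..sum_list lam} (diagram lam) \<and>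
     (\<forall>k\<in>{1..sum_list lam}. \<forall>l\<in>{1..sum_list lam}.
        (fst (U k) = fst (U l) \<and> snd (U k) < snd (U l)) \<or>
        (snd (U k) = snd (U l) \<and> fst (U k) < fst (U l)) \<longrightarrow> k < l)"

definition box_content :: "nat \<times> nat \<Rightarrow> int" where
  "box_content b = int (snd b) - int (fst b)"

text \<open>The group algebra of \<open>S\<^sub>n\<close> is taken inside that of the finitary permutations of
  \<^typ>\<open>nat\<close>; as for words, the composition of permutations is written additively.\<close>

instantiation perm :: (type) monoid_add
begin
definition zero_perm :: "'a perm" where "zero_perm = 1"
definition plus_perm :: "'a perm \<Rightarrow> 'a perm \<Rightarrow> 'a perm" where "plus_perm = (*)"
instance by standard (simp_all add: zero_perm_def plus_perm_def mult.assoc)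
end

type_synonym sym_algebra = "nat perm \<Rightarrow>\<^sub>0 complex"

definition sym_const :: "complex \<Rightarrow> sym_algebra" where
  "sym_const c = Poly_Mapping.single 0 c"

definition jucys_murphy :: "nat \<Rightarrow> sym_algebra" where
  "jucys_murphy r = (\<Sum>i\<in>{1..<r}. Poly_Mapping.single (Perm.swap i r) 1)"

definition other_contents :: "(nat \<Rightarrow> nat \<times> nat) \<Rightarrow> nat \<Rightarrow> int set" where
  "other_contents U n =
    {box_content b | b. b \<notin> U ` {1..<n} \<and> b \<noteq> U n \<and> is_diagram (insert b (U ` {1..<n}))}"

fun primitive_idempotent :: "(nat \<Rightarrow> nat \<times> nat) \<Rightarrow> nat \<Rightarrow> sym_algebra" where
  "primitive_idempotent U 0 = 1"
| "primitive_idempotent U (Suc 0) = 1"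
| "primitive_idempotent U (Suc (Suc m)) =
    (let n = Suc (Suc m); A = other_contents U n
     in primitive_idempotent U (Suc m)
        * (\<Prod>a\<leftarrow>sorted_list_of_set A. jucys_murphy n - sym_const (of_int a))
        * sym_const (inverse (\<Prod>a\<in>A. of_int (box_content (U n) - a))))"


section \<open>Tensor powers of \<open>\<complex>\<^sup>N\<close>\<close>

text \<open>The tensor power \<open>(\<complex>\<^sup>N)\<^sup>\<otimes>\<^sup>n\<close> is \<^typ>\<open>complex^('N^'n)\<close>, the coordinates being those in the basis
  \<open>e\<^sub>v\<close> indexed by multi-indices \<open>v\<close>. The factors are labelled by \<^typ>\<open>'n\<close>; a bijection \<open>pos\<close>
  from \<open>{1..n}\<close> puts them in order, \<open>pos k\<close> being the \<open>k\<close>-th factor. A factor \<open>0\<close> is added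
  by the index type \<^typ>\<open>'N \<times> ('N^'n)\<close>.\<close>

definition in_factor :: "'n::finite \<Rightarrow> 'a::zero^'N::finite^'N \<Rightarrow> 'a^('N^'n)^('N^'n)" where
  "in_factor m A = (\<chi> w v. if \<forall>l. l \<noteq> m \<longrightarrow> w $ l = v $ l then A $ (w $ m) $ (v $ m) else 0)"

definition in_factors_0 ::
    "'n::finite \<Rightarrow> 'a::zero^('N::finite \<times> 'N)^('N \<times> 'N) \<Rightarrow> 'a^('N \<times> ('N^'n))^('N \<times> ('N^'n))" where
  "in_factors_0 m X = (\<chi> p q. if \<forall>l. l \<noteq> m \<longrightarrow> snd p $ l = snd q $ l
     then X $ (fst p, snd p $ m) $ (fst q, snd q $ m) else 0)"

text \<open>The permutation \<open>s\<close> moves the vector in factor \<open>k\<close> to factor \<open>s k\<close>.\<close>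
definition perm_mat :: "(nat \<Rightarrow> 'n::finite) \<Rightarrow> nat perm \<Rightarrow> complex^('N::finite^'n)^('N^'n)" where
  "perm_mat pos s = (\<chi> w v.
     if \<forall>k\<in>{1..CARD('n)}. w $ pos (Perm.apply s k) = v $ pos k then 1 else 0)"

definition sym_algebra_mat ::
    "(nat \<Rightarrow> 'n::finite) \<Rightarrow> sym_algebra \<Rightarrow> complex^('N::finite^'n)^('N^'n)" where
  "sym_algebra_mat pos x =
    (\<Sum>s\<in>Poly_Mapping.keys x. Poly_Mapping.lookup x s *\<^sub>M perm_mat pos s)"

definition L_space ::
    "(nat \<Rightarrow> 'n::finite) \<Rightarrow> (nat \<Rightarrow> nat \<times> nat) \<Rightarrow> (complex^('N::finite^'n)) set" where
  "L_space pos U = range ((*v) (sym_algebra_mat pos (primitive_idempotent U CARD('n))))"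

definition gl_tensor_rep ::
    "('N::finite gl_envelope \<Rightarrow> complex^('N^'n::finite)^('N^'n)) \<Rightarrow> bool" where
  "gl_tensor_rep \<pi> \<longleftrightarrow> matrix_rep_on UNIV \<pi> \<and>
     (\<forall>i j. \<pi> (gl_E i j) = (\<Sum>m\<in>UNIV. in_factor m (matrix_unit i j)))"

definition mat_prod :: "('a::semiring_1^'i::finite^'i) list \<Rightarrow> 'a^'i^'i" where
  "mat_prod Ms = foldr (**) Ms (mat 1)"

text \<open>With \<open>w = \<omega>/4\<close>, this is
  \<open>R\<^sub>0\<^sub>n(-u-\<sigma>\<^sub>n-w)\<inverse> \<dots> R\<^sub>0\<^sub>1(-u-\<sigma>\<^sub>1-w)\<inverse> R\<^sub>0\<^sub>1(u-\<sigma>\<^sub>1-w) \<dots> R\<^sub>0\<^sub>n(u-\<sigma>\<^sub>n-w)\<close>.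

  On \<open>L\<^sub>U\<close> it agrees with the image of \<^term>\<open>evaluation_Smat\<close>. A prefactor
  \<open>(u - w)/(u + w)\<close> still gives a representation of the reflection algebra, but one that must be
  compared with the equally rescaled homomorphism \<open>S(u) \<mapsto> (u - E\<^sup>t - w)/(u + E\<^sup>t + w)\<close>:
  already for \<open>N = n = 1\<close> the two normalizations give different scalars unless \<open>w = 0\<close>.\<close>
definition R_product :: "(nat \<Rightarrow> 'n::finite) \<Rightarrow> (nat \<Rightarrow> nat \<times> nat) \<Rightarrow> complex
    \<Rightarrow> (complex fls)^('N::finite \<times> ('N^'n))^('N \<times> ('N^'n))" where
  "R_product pos U \<omega> =
    (let u = fls_X_inv; w = fls_const (\<omega> / 4);
         \<sigma> = (\<lambda>k. of_int (box_content (U k)));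
         R0 = (\<lambda>k z. in_factors_0 (pos k) (Rmat z))
     in mat_prod (map (\<lambda>k. matrix_inv (R0 k (- u - \<sigma> k - w))) (rev [1..<Suc CARD('n)]))
        ** mat_prod (map (\<lambda>k. R0 k (u - \<sigma> k - w)) [1..<Suc CARD('n)]))"


section \<open>Representations and homomorphisms given by the image of \<open>S(u)\<close>\<close>

definition reflection_rep :: "('N::finite yangian \<Rightarrow> complex^('N^'n::finite)^('N^'n))
    \<Rightarrow> (complex fls)^('N \<times> ('N^'n))^('N \<times> ('N^'n)) \<Rightarrow> bool" where
  "reflection_rep \<rho> M \<longleftrightarrow> matrix_rep_on reflection_algebra \<rho> \<and>
     (\<forall>i j w v. map_fls (\<lambda>b. \<rho> b $ w $ v) (Smat $ i $ j) = M $ (i, w) $ (j, v))"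

definition reflection_hom :: "('N::finite yangian \<Rightarrow> 'N gl_envelope)
    \<Rightarrow> ('N gl_envelope fls)^'N^'N \<Rightarrow> bool" where
  "reflection_hom \<eta> Q \<longleftrightarrow> algebra_hom_on reflection_algebra \<eta> \<and> map_matrix (map_fls \<eta>) Smat = Q"

end

theory Submission
  imports Defs
begin

text \<open>
  Both homomorphisms of the statement are restrictions of homomorphisms defined on the whole Yangian,
  and it is there that they are compared. For a family \<open>E\<^sub>i\<^sub>j\<close> satisfying the relations of \<open>gl\<^sub>N\<close> the
  matrix \<open>1 - E\<^sup>t/(u - c)\<close> solves the RTT relation (\<open>lax_rtt\<close>). Two solutions may be
  multiplied if the entries of one commute with those of the other, and a solution may be multiplied by a
  scalar series \<open>h(u)\<close>. A solution \<open>T(u)\<close> with constant term \<open>1\<close> defines a homomorphism from the Yangian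
  (\<open>yangian_hom_exists\<close>) that sends \<open>S(u)\<close> to \<open>T(-u)\<inverse>T(u)\<close> (\<open>map_Smat\<close>). Write \<open>w = \<omega>/4\<close>. With
  \<open>E\<^sub>i\<^sub>j\<close> the generators of the enveloping algebra and \<open>c = w\<close> this gives the evaluation
  homomorphism; with \<open>E\<^sub>i\<^sub>j\<close> the matrix units in the \<open>k\<close>-th tensor factor and \<open>c = \<sigma>\<^sub>k + w\<close> it gives
  \<open>R\<^sub>0\<^sub>k(u - \<sigma>\<^sub>k - w)\<close>, and the product over \<open>k\<close> yields the action by \<open>R\<close>-matrices. The factor
  \<open>h\<close> multiplies \<open>S(u)\<close> by \<open>h(u)/h(-u)\<close>; the two normalizations are \<open>h = 1\<close> and \<open>h = 1 - w/u\<close>,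
  for which this ratio is \<open>(u - w)/(u + w)\<close>.

  Let \<open>F\<close> be the image of \<open>E\<^sub>U\<close> on tensor space. The fusion identity (\<open>fusion\<close>)
  \<open>R\<^sub>0\<^sub>1(u - \<sigma>\<^sub>1 - w) \<dots> R\<^sub>0\<^sub>n(u - \<sigma>\<^sub>n - w) F = (1 - (P\<^sub>0\<^sub>1 + \<dots> + P\<^sub>0\<^sub>n)/(u - w)) F\<close>
  says that the two images of \<open>T(u)\<close>, the second one followed by the action of \<open>gl\<^sub>N\<close>, agree after
  multiplication by \<open>F\<close>. As \<open>F\<close> commutes with \<open>gl\<^sub>N\<close>, the agreement
  extends from the generators to all of the Yangian (\<open>representations_agree\<close>). Hence both
  algebras preserve the range of \<open>F\<close>, and the identity map is the required isomorphism.

  The fusion identity follows by induction on \<open>n\<close>, using \<open>P\<^sub>0\<^sub>iP\<^sub>0\<^sub>n = P\<^sub>0\<^sub>nP\<^sub>i\<^sub>n\<close>, from the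
  eigenvalue property \<open>x\<^sub>r E\<^sub>U = \<sigma>\<^sub>r E\<^sub>U\<close> of the Jucys--Murphy elements (\<open>idem_eigen\<close>). By the
  recursive definition of \<open>E\<^sub>U\<close> this property amounts to the vanishing of
  \<open>\<Prod>(x\<^sub>n - a) E\<^sub>V\<close>, the product running over the contents \<open>a\<close> of all boxes that can be added to the
  shape of \<open>V\<close>. Here the method of Okounkov and Vershik applies: \<open>x\<^sub>n\<close> is diagonalizable with integer
  eigenvalues, and if \<open>a\<close> is an eigenvalue of \<open>x\<^sub>n\<close> on a vector with eigenvalues
  \<open>\<sigma>\<^sub>1, \<dots>, \<sigma>\<^sub>n\<^sub>-\<^sub>1\<close>, then the sequence \<open>(\<sigma>\<^sub>1, \<dots>, \<sigma>\<^sub>n\<^sub>-\<^sub>1, a)\<close> obeys the local rules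
  \<open>weight_new_neighbour\<close> and \<open>weight_repeat\<close>, which force \<open>a\<close> to be the content of an addable box
  (\<open>addable_box\<close>).
\<close>

section \<open>Ring homomorphisms, series and matrices\<close>

locale unital_hom =
  fixes h :: "'a::ring_1 \<Rightarrow> 'b::ring_1"
  assumes hom_one: "h 1 = 1"
    and hom_add: "h (x + y) = h x + h y"
    and hom_mult: "h (x * y) = h x * h y"

text \<open>The product formula with summation bounds that need not be the subdegrees, so that it can be
  compared before and after a coefficientwise map, which may change subdegrees.\<close>
lemma fls_times_nth_bounds:
  fixes F G :: "'a::ring_1 fls"
  assumes "\<And>k. k < a \<Longrightarrow> fls_nth F k = 0" "\<And>k. k < b \<Longrightarrow> fls_nth G k = 0"
  shows "fls_nth (F * G) n = (\<Sum>i=a..n-b. fls_nth F i * fls_nth G (n - i))"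
proof (cases "F = 0 \<or> G = 0")
  case False
  have "a \<le> fls_subdegree F" "b \<le> fls_subdegree G"
    using assms False by (meson fls_subdegree_geI not_less)+
  then have "(\<Sum>i=fls_subdegree F..n - fls_subdegree G. fls_nth F i * fls_nth G (n - i))
      = (\<Sum>i=a..n-b. fls_nth F i * fls_nth G (n - i))"
    by (intro sum.mono_neutral_left) auto
  then show ?thesis by (simp add: fls_times_nth(2))
qed auto

lemma fls_nth_sum: "fls_nth (sum f A) k = (\<Sum>a\<in>A. fls_nth (f a) k)"
  by (induction A rule: infinite_finite_induct) simp_all

lemma Pmat_nth:
  "Pmat $ p $ q = (if fst p = snd q \<and> snd p = fst q then 1 else (0::'a::ring_1))"
proof -
  have "Pmat $ p $ q = (\<Sum>i\<in>UNIV. \<Sum>j\<in>UNIV. if i = fst p then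
      if j = snd p then if fst p = snd q \<and> snd p = fst q then 1 else 0 else 0 else (0::'a))"
    unfolding Pmat_def by (auto simp: kron_def matrix_unit_def intro!: sum.cong)
  also have "\<dots> = (\<Sum>i\<in>UNIV. if i = fst p then (\<Sum>j\<in>UNIV.
      if j = snd p then if fst p = snd q \<and> snd p = fst q then 1 else 0 else 0) else (0::'a))"
    by (intro sum.cong) auto
  finally show ?thesis by simp
qed

lemma fls_nth_map: "h 0 = 0 \<Longrightarrow> fls_nth (map_fls h F) k = h (fls_nth F k)"
  using fls_nth_vanishes_belowE[of F] unfolding map_fls_def
  by (metis (mono_tags, lifting) nth_Abs_fls_ex_lower_bound)

context unital_hom
begin

lemma hom_zero: "h 0 = 0"
  using hom_add[of 0 0] by simp

lemma hom_uminus: "h (- x) = - h x"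
  using hom_add[of "- x" x] hom_zero by (simp add: eq_neg_iff_add_eq_0)

lemma hom_diff: "h (x - y) = h x - h y"
  using hom_add[of x "- y"] hom_uminus by simp

lemma hom_sum: "h (sum f A) = (\<Sum>x\<in>A. h (f x))"
  by (induction A rule: infinite_finite_induct) (simp_all add: hom_zero hom_add)

lemma fls_nth_map_fls: "fls_nth (map_fls h F) k = h (fls_nth F k)"
  by (rule fls_nth_map) (rule hom_zero)

lemma unital_hom_map_fls: "unital_hom (map_fls h)"
proof
  show "map_fls h 1 = 1"
    by (rule fls_eqI) (simp add: fls_nth_map_fls hom_one hom_zero)
  show "map_fls h (F + G) = map_fls h F + map_fls h G" for F G
    by (rule fls_eqI) (simp add: fls_nth_map_fls hom_add)
  show "map_fls h (F * G) = map_fls h F * map_fls h G" for F G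
  proof (rule fls_eqI)
    fix n
    obtain a b where ab: "\<forall>k<a. fls_nth F k = 0" "\<forall>k<b. fls_nth G k = 0"
      using fls_nth_vanishes_belowE[of F] fls_nth_vanishes_belowE[of G] by metis
    show "fls_nth (map_fls h (F * G)) n = fls_nth (map_fls h F * map_fls h G) n"
      using ab by (subst fls_times_nth_bounds[of a _ b])
        (simp_all add: fls_nth_map_fls hom_zero fls_times_nth_bounds[of a _ b] hom_sum hom_mult)
  qed
qed

lemma map_fls_const: "map_fls h (fls_const x) = fls_const (h x)"
  by (rule fls_eqI) (simp add: fls_nth_map_fls hom_zero)

lemma map_fls_X_inv: "map_fls h fls_X_inv = fls_X_inv"
  by (rule fls_eqI) (simp add: fls_nth_map_fls hom_zero hom_one)

lemma map_matrix_mult: "map_matrix h (A ** B) = map_matrix h A ** map_matrix h B"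
  by (simp add: vec_eq_iff matrix_matrix_mult_def hom_sum hom_mult)

lemma map_matrix_mat: "map_matrix h (mat x) = mat (h x)"
  by (simp add: vec_eq_iff mat_def hom_zero)

lemma map_matrix_diff: "map_matrix h (A - B) = map_matrix h A - map_matrix h B"
  by (simp add: vec_eq_iff hom_diff)

lemma map_matrix_scalar: "map_matrix h (c *\<^sub>M A) = h c *\<^sub>M map_matrix h A"
  by (simp add: vec_eq_iff scalar_mat_def hom_mult)

lemma map_matrix_kron: "map_matrix h (A \<otimes>\<^sub>M B) = map_matrix h A \<otimes>\<^sub>M map_matrix h B"
  by (simp add: vec_eq_iff kron_def hom_mult)

lemma map_matrix_Pmat: "map_matrix h Pmat = Pmat"
  by (simp add: vec_eq_iff Pmat_nth hom_one hom_zero)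

end

lemma unital_hom_fls_const: "unital_hom (fls_const :: 'a::ring_1 \<Rightarrow> 'a fls)"
  by standard (simp_all add: fls_plus_const)

lemma fls_nth_flip: "fls_nth (fls_flip F) k = (if even k then fls_nth F k else - fls_nth F k)"
proof -
  obtain N where "\<forall>n<N. fls_nth F n = 0" by (rule fls_nth_vanishes_belowE)
  then show ?thesis unfolding fls_flip_def by (subst nth_Abs_fls_lower_bound[of N]) auto
qed

lemma unital_hom_fls_flip: "unital_hom (fls_flip :: 'a::ring_1 fls \<Rightarrow> 'a fls)"
proof
  show "fls_flip 1 = (1 :: 'a fls)" by (rule fls_eqI) (simp add: fls_nth_flip)
  show "fls_flip (F + G) = fls_flip F + fls_flip G" for F G :: "'a fls"
    by (rule fls_eqI) (simp add: fls_nth_flip)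
  show "fls_flip (F * G) = fls_flip F * fls_flip G" for F G :: "'a fls"
  proof (rule fls_eqI)
    fix n
    obtain a b where ab: "\<forall>k<a. fls_nth F k = 0" "\<forall>k<b. fls_nth G k = 0"
      using fls_nth_vanishes_belowE[of F] fls_nth_vanishes_belowE[of G] by metis
    show "fls_nth (fls_flip (F * G)) n = fls_nth (fls_flip F * fls_flip G) n"
      using ab by (subst fls_times_nth_bounds[of a _ b])
        (auto simp: fls_nth_flip fls_times_nth_bounds[of a _ b] simp flip: sum_negf intro!: sum.cong)
  qed
qed

lemma unital_hom_cscale_one: "unital_hom (\<lambda>c. c *\<^sub>C (1::'a::complex_algebra_1))"
  by standard (simp_all add: cscale_one cscale_add_left cscale_mult_left cscale_cscale)

lemma unital_hom_fls_scalar: "unital_hom (fls_scalar :: complex fls \<Rightarrow> 'a::complex_algebra_1 fls)"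
  unfolding fls_scalar_def by (rule unital_hom.unital_hom_map_fls[OF unital_hom_cscale_one])

lemma fls_nth_scalar: "fls_nth (fls_scalar f :: 'a::complex_algebra_1 fls) k = fls_nth f k *\<^sub>C 1"
  unfolding fls_scalar_def by (rule unital_hom.fls_nth_map_fls[OF unital_hom_cscale_one])

lemma cscale_central: "c *\<^sub>C 1 * x = x * (c *\<^sub>C (1::'a::complex_algebra_1))"
  by (simp add: cscale_mult_left cscale_mult_right)

lemma fls_commute:
  fixes F G :: "'a::ring_1 fls"
  assumes "\<And>k l. fls_nth F k * fls_nth G l = fls_nth G l * fls_nth F k"
  shows "F * G = G * F"
proof (rule fls_eqI)
  fix n
  obtain a b where ab: "\<And>k. k<a \<Longrightarrow> fls_nth F k = 0" "\<And>k. k<b \<Longrightarrow> fls_nth G k = 0"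
    using fls_nth_vanishes_belowE[of F] fls_nth_vanishes_belowE[of G] by metis
  have "(\<Sum>i=a..n-b. fls_nth F i * fls_nth G (n - i)) = (\<Sum>i=b..n-a. fls_nth G i * fls_nth F (n - i))"
    by (rule sum.reindex_bij_witness[of _ "\<lambda>i. n - i" "\<lambda>i. n - i"]) (auto simp: assms)
  then show "fls_nth (F * G) n = fls_nth (G * F) n"
    using fls_times_nth_bounds[OF ab] fls_times_nth_bounds[OF ab(2,1)] by metis
qed

lemma fls_scalar_central: "fls_scalar f * F = F * (fls_scalar f :: 'a::complex_algebra_1 fls)"
  by (rule fls_commute) (simp add: fls_nth_scalar cscale_central)

lemma fls_flip_scalar: "fls_flip (fls_scalar f) = (fls_scalar (fls_flip f) :: 'a::complex_algebra_1 fls)"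
  by (intro fls_eqI)
    (simp add: fls_nth_flip fls_nth_scalar unital_hom.hom_uminus[OF unital_hom_cscale_one])

lemma fls_flip_const: "fls_flip (fls_const x) = fls_const (x::'a::ring_1)"
  by (rule fls_eqI) (simp add: fls_nth_flip)

lemma fls_flip_X_inv: "fls_flip fls_X_inv = - (fls_X_inv :: 'a::ring_1 fls)"
  by (rule fls_eqI) (simp add: fls_nth_flip)

lemma matrix_inv_eqI:
  fixes A B :: "'a::semiring_1^'i::finite^'i"
  assumes "A ** B = mat 1" "B ** A = mat 1"
  shows "matrix_inv A = B"
proof -
  have "A ** matrix_inv A = mat 1 \<and> matrix_inv A ** A = mat 1"
    unfolding matrix_inv_def using someI_ex[of "\<lambda>B. A ** B = mat 1 \<and> B ** A = mat 1"] assms by blast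
  then show ?thesis using assms by (metis matrix_mul_assoc matrix_mul_lid matrix_mul_rid)
qed


section \<open>Matrix rings\<close>

text \<open>On the type of matrices \<open>*\<close> is the componentwise product. A copy of the type on which \<open>*\<close> is the
  matrix product belongs to the ring classes, so that series and matrices with matrix entries
  can be formed and ring normalization applies to them.\<close>
typedef ('a, 'i) endo = "UNIV :: ('a^'i^'i) set" morphisms mat_of Endo ..

setup_lifting type_definition_endo

instantiation endo :: (ring_1, finite) ring_1
begin
lift_definition zero_endo :: "('a, 'b) endo" is 0 .
lift_definition one_endo :: "('a, 'b) endo" is "mat 1" .
lift_definition plus_endo :: "('a, 'b) endo \<Rightarrow> ('a, 'b) endo \<Rightarrow> ('a, 'b) endo" is "(+)" .
lift_definition minus_endo :: "('a, 'b) endo \<Rightarrow> ('a, 'b) endo \<Rightarrow> ('a, 'b) endo" is "(-)" .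
lift_definition uminus_endo :: "('a, 'b) endo \<Rightarrow> ('a, 'b) endo" is uminus .
lift_definition times_endo :: "('a, 'b) endo \<Rightarrow> ('a, 'b) endo \<Rightarrow> ('a, 'b) endo" is "(**)" .
instance
proof
  show "(0 :: ('a, 'b) endo) \<noteq> 1"
    by transfer (simp add: vec_eq_iff mat_def)
  show "(a + b) * c = a * c + b * c" for a b c :: "('a, 'b) endo"
    by transfer (simp add: matrix_matrix_mult_def vec_eq_iff distrib_right sum.distrib)
qed (transfer; simp add: matrix_mul_assoc matrix_add_ldistrib)+
end

lemma cscale_zero [simp]: "0 *\<^sub>C x = (0::'a::complex_algebra_1)" "c *\<^sub>C 0 = (0::'a)"
  using cscale_add_left[of 0 0 x] cscale_add_right[of c 0 "0::'a"] by simp_all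

lemma cscale_sum: "c *\<^sub>C sum f A = (\<Sum>a\<in>A. c *\<^sub>C (f a :: 'a::complex_algebra_1))"
  by (induction A rule: infinite_finite_induct) (simp_all add: cscale_add_right)

instantiation endo :: (complex_algebra_1, finite) complex_algebra_1
begin
lift_definition cscale_endo :: "complex \<Rightarrow> ('a, 'b) endo \<Rightarrow> ('a, 'b) endo"
  is "\<lambda>c A. \<chi> i j. c *\<^sub>C A $ i $ j" .
instance
proof
  fix c d :: complex and x y :: "('a, 'b) endo"
  show "(c *\<^sub>C x) * y = c *\<^sub>C (x * y)" "x * (c *\<^sub>C y) = c *\<^sub>C (x * y)"
    unfolding mat_of_inject[symmetric] times_endo.rep_eq cscale_endo.rep_eq
    by (simp_all add: matrix_matrix_mult_def vec_eq_iff cscale_sum cscale_mult_left cscale_mult_right)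
qed (transfer; simp add: vec_eq_iff cscale_add_right cscale_add_left cscale_cscale cscale_one)+
end

instantiation complex :: complex_algebra_1
begin
definition cscale_complex :: "complex \<Rightarrow> complex \<Rightarrow> complex" where "cscale_complex = (*)"
instance by standard (simp_all add: cscale_complex_def algebra_simps)
end

lemma mat_of_sum: "mat_of (sum f A) = (\<Sum>a\<in>A. mat_of (f a))"
  by (induction A rule: infinite_finite_induct) (simp_all add: zero_endo.rep_eq plus_endo.rep_eq)

lemma Endo_mult: "Endo (A ** B) = Endo A * Endo B"
  by (simp add: times_endo.abs_eq)

definition unipotent_series :: "('b::ring_1 fls)^'N::finite^'N \<Rightarrow> bool" where
  "unipotent_series T \<longleftrightarrow> (\<forall>i j. (\<forall>k<0. fls_nth (T $ i $ j) k = 0) \<and>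
     fls_nth (T $ i $ j) 0 = (if i = j then 1 else 0))"

text \<open>The algebra of \<open>N \<times> N\<close> matrices over power series is the algebra of power series
  with matrix coefficients, and there a series with constant term \<open>1\<close> has an inverse.\<close>
lemma unipotent_series_invertible:
  fixes T :: "('a::ring_1 fls)^'N::finite^'N"
  assumes "unipotent_series T"
  shows "\<exists>V. T ** V = mat 1 \<and> V ** T = mat 1"
proof -
  have neg: "k < 0 \<Longrightarrow> fls_nth (T $ i $ j) k = 0"
    and const: "fls_nth (T $ i $ j) 0 = (if i = j then 1 else 0)" for i j k
    using assms by (auto simp: unipotent_series_def)
  have to_fls_sum: "fps_to_fls (sum f A) = (\<Sum>a\<in>A. fps_to_fls (f a))" for f :: "'N \<Rightarrow> 'a fps" and A
    by (induction A rule: infinite_finite_induct) simp_all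
  \<comment> \<open>the isomorphism between power series of matrices and matrices of power series\<close>
  define \<psi> :: "('a, 'N) endo fps \<Rightarrow> ('a fls)^'N^'N"
    where "\<psi> F = (\<chi> i j. fps_to_fls (Abs_fps (\<lambda>r. mat_of (fps_nth F r) $ i $ j)))" for F
  have mult: "\<psi> (F * G) = \<psi> F ** \<psi> G" for F G
  proof -
    have "fps_nth (\<Sum>k\<in>UNIV. Abs_fps (\<lambda>r. mat_of (fps_nth F r) $ i $ k) *
        Abs_fps (\<lambda>r. mat_of (fps_nth G r) $ k $ j)) n = mat_of (fps_nth (F * G) n) $ i $ j" for i j n
      by (simp add: fps_mult_nth fps_sum_nth mat_of_sum times_endo.rep_eq matrix_matrix_mult_def)
         (rule sum.swap)
    then have "Abs_fps (\<lambda>n. mat_of (fps_nth (F * G) n) $ i $ j) = (\<Sum>k\<in>UNIV. Abs_fps (\<lambda>r. mat_of (fps_nth F r) $ i $ k) *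
        Abs_fps (\<lambda>r. mat_of (fps_nth G r) $ k $ j))" for i j
      by (intro fps_ext) simp
    then show ?thesis
      by (simp add: \<psi>_def vec_eq_iff matrix_matrix_mult_def to_fls_sum fls_times_fps_to_fls)
  qed
  have one: "\<psi> 1 = mat 1"
  proof -
    have "fls_nth (\<psi> 1 $ i $ j) k = fls_nth (mat 1 $ i $ j) k" for i j k
      by (simp add: \<psi>_def mat_def one_endo.rep_eq zero_endo.rep_eq)
    then show ?thesis by (simp add: vec_eq_iff fls_eq_iff)
  qed
  define F where "F = Abs_fps (\<lambda>r. Endo (\<chi> i j. fls_nth (T $ i $ j) (int r)))"
  have T: "\<psi> F = T"
    by (auto simp: \<psi>_def F_def vec_eq_iff Endo_inverse neg intro!: fls_eqI)
  have "fps_nth F 0 = 1"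
    by (simp add: F_def const one_endo_def mat_def)
  then have "F * fps_right_inverse F 1 = 1" "fps_right_inverse F 1 * F = 1"
    by (simp_all add: fps_right_inverse fps_left_inverse'[of 1])
  then show ?thesis using mult one T by metis
qed

section \<open>Algebra maps out of the Yangian and the enveloping algebra\<close>

text \<open>The linear extension of a map on a monoid to its monoid algebra; it serves both the free algebra
  on words and the group algebra of permutations.\<close>
definition lin :: "('m \<Rightarrow> 'b::complex_algebra_1) \<Rightarrow> ('m \<Rightarrow>\<^sub>0 complex) \<Rightarrow> 'b" where
  "lin h x = (\<Sum>k\<in>Poly_Mapping.keys x. Poly_Mapping.lookup x k *\<^sub>C h k)"

lemma lin_superset:
  assumes "finite A" "Poly_Mapping.keys x \<subseteq> A"
  shows "lin h x = (\<Sum>k\<in>A. Poly_Mapping.lookup x k *\<^sub>C h k)"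
  unfolding lin_def by (rule sum.mono_neutral_left) (use assms in \<open>auto simp: in_keys_iff\<close>)

lemma lin_add: "lin h (x + y) = lin h x + lin h y"
proof -
  let ?A = "Poly_Mapping.keys x \<union> Poly_Mapping.keys y"
  have "Poly_Mapping.keys (x + y) \<subseteq> ?A" by (rule keys_add)
  then show ?thesis
    by (simp add: lin_superset[of ?A] lookup_add cscale_add_left sum.distrib)
qed

lemma lin_zero [simp]: "lin h 0 = 0"
  by (simp add: lin_def)

lemma lin_single [simp]: "lin h (Poly_Mapping.single k c) = c *\<^sub>C h k"
  by (cases "c = 0") (simp_all add: lin_def)

lemma lin_sum: "lin h (sum f A) = (\<Sum>a\<in>A. lin h (f a))"
  by (induction A rule: infinite_finite_induct) (simp_all add: lin_add)

text \<open>Multiplicativity on a subset \<open>M\<close> suffices, which matters for the symmetric groups: permutations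
  that move points beyond \<open>n\<close> do not act on \<open>n\<close> tensor factors.\<close>
lemma lin_mult:
  assumes "Poly_Mapping.keys x \<subseteq> M" "Poly_Mapping.keys y \<subseteq> M"
    and "\<And>k l. k \<in> M \<Longrightarrow> l \<in> M \<Longrightarrow> h (k + l) = h k * h l"
  shows "lin h (x * y) = lin h x * lin h y"
proof -
  let ?s = "\<lambda>x. \<Sum>k\<in>Poly_Mapping.keys x. Poly_Mapping.single k (Poly_Mapping.lookup x k)"
  have s: "?s x = x" for x :: "'a \<Rightarrow>\<^sub>0 complex"
    by (rule poly_mapping_eqI) (simp add: lookup_sum lookup_single when_def in_keys_iff)
  have "lin h (x * y) = lin h (?s x * ?s y)"
    by (simp only: s)
  also have "\<dots> = (\<Sum>k\<in>Poly_Mapping.keys x. \<Sum>l\<in>Poly_Mapping.keys y.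
      (Poly_Mapping.lookup x k * Poly_Mapping.lookup y l) *\<^sub>C (h k * h l))"
    by (simp add: sum_product lin_sum mult_single)
      (intro sum.cong refl, simp add: assms(3) subsetD[OF assms(1)] subsetD[OF assms(2)])
  also have "\<dots> = lin h x * lin h y"
    by (simp add: lin_def sum_product cscale_mult_left cscale_mult_right cscale_cscale mult.commute)
  finally show ?thesis by simp
qed

definition free_eval :: "('x \<Rightarrow> 'b::complex_algebra_1) \<Rightarrow> 'x free_algebra \<Rightarrow> 'b" where
  "free_eval f = lin (\<lambda>w. prod_list (map f w))"

lemma free_eval_single: "free_eval f (Poly_Mapping.single w c) = c *\<^sub>C prod_list (map f w)"
  by (simp add: free_eval_def)

lemma free_eval_letter: "free_eval f (letter x) = f x"
  by (simp add: letter_def free_eval_single cscale_one)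

lemma free_eval_mult: "free_eval f (x * y) = free_eval f x * free_eval f y"
  unfolding free_eval_def by (rule lin_mult[of _ UNIV]) (auto simp: plus_list_def)

lemma unital_hom_free_eval: "unital_hom (free_eval f)"
proof
  show "free_eval f 1 = 1"
    unfolding single_one[symmetric] by (simp add: free_eval_single zero_list_def cscale_one)
qed (simp_all add: free_eval_mult, simp add: free_eval_def lin_add)

lemma free_eval_cscale: "free_eval f (Poly_Mapping.single 0 c * x) = c *\<^sub>C free_eval f x"
  by (simp add: free_eval_mult free_eval_single zero_list_def cscale_mult_left)

lemma unital_hom_ideal_cong:
  assumes "unital_hom h" "\<And>g. g \<in> G \<Longrightarrow> h g = 0" "ideal_cong G x y"
  shows "h x = h y"
proof -
  interpret unital_hom h by fact
  have "h x = 0" if "x \<in> gen_ideal G" for x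
    using that by induction (simp_all add: hom_zero hom_add hom_mult assms(2))
  then show ?thesis using assms(3) unfolding ideal_cong_def by (metis hom_diff eq_iff_diff_eq_0)
qed

lemma algebra_homD:
  assumes "algebra_hom_on UNIV h"
  shows "unital_hom h" "h (c *\<^sub>C x) = c *\<^sub>C h x"
  using assms by (auto simp: algebra_hom_on_def unital_hom_def)

lemma yangian_lift:
  fixes f :: "'N::finite \<times> 'N \<times> nat \<Rightarrow> 'b::complex_algebra_1"
  assumes "\<And>g. g \<in> yangian_relators \<Longrightarrow> free_eval f g = 0"
  obtains h where "algebra_hom_on UNIV h" "\<And>x. h (abs_yangian x) = free_eval f x"
proof
  interpret unital_hom "free_eval f" by (rule unital_hom_free_eval)
  define h where "h = (\<lambda>y. free_eval f (rep_yangian y))"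
  show *: "h (abs_yangian x) = free_eval f x" for x
    unfolding h_def using unital_hom_ideal_cong[OF unital_hom_free_eval assms]
      Quotient3_rep_abs[OF Quotient3_yangian] by (metis equivp_ideal_cong equivp_reflp)
  show "algebra_hom_on UNIV h"
    unfolding algebra_hom_on_def
  proof (intro conjI ballI allI)
    show "h 1 = 1" by (simp add: one_yangian_def * hom_one)
    fix x y :: "'N yangian" and c
    obtain x' y' where xy: "x = abs_yangian x'" "y = abs_yangian y'"
      by (metis Quotient3_abs_rep Quotient3_yangian)
    show "h (x + y) = h x + h y" "h (x * y) = h x * h y" "h (c *\<^sub>C x) = c *\<^sub>C h x"
      by (simp_all add: xy plus_yangian.abs_eq times_yangian.abs_eq cscale_yangian.abs_eq * hom_add hom_mult
          free_eval_cscale)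
  qed
qed

definition gl_family :: "('N \<Rightarrow> 'N \<Rightarrow> 'b::ring_1) \<Rightarrow> bool" where
  "gl_family E \<longleftrightarrow> (\<forall>i j k l. E i j * E k l - E k l * E i j =
      (if k = j then E i l else 0) - (if i = l then E k j else 0))"

lemma gl_family_hom:
  assumes "unital_hom h" "gl_family E"
  shows "gl_family (\<lambda>i j. h (E i j))"
  unfolding gl_family_def
proof (intro allI)
  interpret unital_hom h by fact
  fix i j k l
  show "h (E i j) * h (E k l) - h (E k l) * h (E i j) =
      (if k = j then h (E i l) else 0) - (if i = l then h (E k j) else 0)"
    using assms(2)[unfolded gl_family_def, rule_format, of i j k l, THEN arg_cong[of _ _ h]]
    by (cases "k = j"; cases "i = l") (simp_all add: hom_diff hom_mult hom_zero hom_uminus)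
qed

lemma gl_envelope_lift:
  fixes E :: "'N::finite \<Rightarrow> 'N \<Rightarrow> 'b::complex_algebra_1"
  assumes E: "gl_family E"
  obtains h where "algebra_hom_on UNIV h" "\<And>i j. h (gl_E i j) = E i j"
proof
  define f where "f = (\<lambda>(i, j). E i j)"
  have f: "f (i, j) = E i j" for i j by (simp add: f_def)
  interpret unital_hom "free_eval f" by (rule unital_hom_free_eval)
  have rel: "free_eval f g = 0" if g: "g \<in> gl_relators" for g
  proof -
    obtain i j k l where "g = letter (i, j) * letter (k, l) - letter (k, l) * letter (i, j)
      - ((if k = j then letter (i, l) else 0) - (if i = l then letter (k, j) else 0))"
      using g unfolding gl_relators_def by blast
    then show ?thesis using E[unfolded gl_family_def, rule_format, of i j k l]
      by (cases "k = j"; cases "i = l") (simp_all add: hom_diff hom_add hom_mult hom_zero free_eval_letter f)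
  qed
  define h where "h = (\<lambda>y. free_eval f (rep_gl_envelope y))"
  have *: "h (abs_gl_envelope x) = free_eval f x" for x
    unfolding h_def using unital_hom_ideal_cong[OF unital_hom_free_eval rel]
      Quotient3_rep_abs[OF Quotient3_gl_envelope] by (metis equivp_ideal_cong equivp_reflp)
  show "h (gl_E i j) = E i j" for i j
    by (simp add: gl_E.abs_eq * free_eval_letter f)
  show "algebra_hom_on UNIV h"
    unfolding algebra_hom_on_def
  proof (intro conjI ballI allI)
    show "h 1 = 1" by (simp add: one_gl_envelope_def * hom_one)
    fix x y :: "'N gl_envelope" and c
    obtain x' y' where xy: "x = abs_gl_envelope x'" "y = abs_gl_envelope y'"
      by (metis Quotient3_abs_rep Quotient3_gl_envelope)
    show "h (x + y) = h x + h y" "h (x * y) = h x * h y" "h (c *\<^sub>C x) = c *\<^sub>C h x"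
      by (simp_all add: xy plus_gl_envelope.abs_eq times_gl_envelope.abs_eq cscale_gl_envelope.abs_eq * hom_add hom_mult
          free_eval_cscale)
  qed
qed

lemma gl_family_gl_E: "gl_family gl_E"
  unfolding gl_family_def
proof (intro allI)
  fix i j k l :: 'a
  have "g \<in> gen_ideal gl_relators" if "g \<in> gl_relators" for g :: "('a \<times> 'a) free_algebra"
    using gen_ideal.step[OF gen_ideal.zero that, of 1 1] by simp
  then have rel: "ideal_cong gl_relators
     (letter (i, j) * letter (k, l) - letter (k, l) * letter (i, j))
     ((if k = j then letter (i, l) else 0) - (if i = l then letter (k, j) else 0))"
    unfolding ideal_cong_def gl_relators_def by blast
  show "gl_E i j * gl_E k l - gl_E k l * gl_E i j =
      (if k = j then gl_E i l else 0) - (if i = l then gl_E k j else 0)"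
    using rel[folded gl_envelope.abs_eq_iff]
    by (cases "k = j"; cases "i = l")
      (simp_all add: gl_E.abs_eq times_gl_envelope.abs_eq minus_gl_envelope.abs_eq zero_gl_envelope_def
        uminus_gl_envelope.abs_eq)
qed

section \<open>The RTT relation\<close>

definition rtt :: "'c::ring_1 \<Rightarrow> 'c^'N::finite^'N \<Rightarrow> 'c^'N^'N \<Rightarrow> bool" where
  "rtt z A B \<longleftrightarrow> (mat z - Pmat) ** (A \<otimes>\<^sub>M mat 1) ** (mat 1 \<otimes>\<^sub>M B)
      = (mat 1 \<otimes>\<^sub>M B) ** (A \<otimes>\<^sub>M mat 1) ** (mat z - Pmat)"

lemma matrix_diff_distrib:
  fixes A B C :: "'a::ring_1^'i::finite^'i"
  shows "A ** (B - C) = A ** B - A ** C" "(B - C) ** A = B ** A - C ** A"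
  by (simp_all add: matrix_matrix_mult_def vec_eq_iff sum_subtractf algebra_simps)

lemma mat_mult_nth:
  fixes A :: "'a::ring_1^'i::finite^'i"
  shows "(mat z ** A) $ i $ j = z * A $ i $ j" (is ?A)
    and "(A ** mat z) $ i $ j = A $ i $ j * z" (is ?B)
proof -
  have "(mat z ** A) $ i $ j = (\<Sum>k\<in>UNIV. if k = i then z * A $ k $ j else 0)"
    by (simp only: matrix_matrix_mult_def vec_lambda_beta) (rule sum.cong, auto simp: mat_def)
  moreover have "(A ** mat z) $ i $ j = (\<Sum>k\<in>UNIV. if k = j then A $ i $ k * z else 0)"
    by (simp only: matrix_matrix_mult_def vec_lambda_beta) (rule sum.cong, auto simp: mat_def)
  ultimately show ?A ?B by simp_all
qed

lemma Pmat_mult_nth: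
  fixes A :: "'a::ring_1^('N::finite \<times> 'N)^('N \<times> 'N)"
  shows "(Pmat ** A) $ p $ q = A $ (snd p, fst p) $ q" (is ?A)
    and "(A ** Pmat) $ p $ q = A $ p $ (snd q, fst q)" (is ?B)
proof -
  have "(Pmat ** A) $ p $ q = (\<Sum>r\<in>UNIV. if r = (snd p, fst p) then A $ r $ q else 0)"
    by (simp only: matrix_matrix_mult_def vec_lambda_beta) (rule sum.cong, auto simp: Pmat_nth)
  moreover have "(A ** Pmat) $ p $ q = (\<Sum>r\<in>UNIV. if r = (snd q, fst q) then A $ p $ r else 0)"
    by (simp only: matrix_matrix_mult_def vec_lambda_beta) (rule sum.cong, auto simp: Pmat_nth)
  ultimately show ?A ?B by simp_all
qed

lemma kron_mult_nth:
  fixes A :: "'a::ring_1^'N::finite^'N" and B :: "'a^'M::finite^'M"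
  shows "((A \<otimes>\<^sub>M mat 1) ** (mat 1 \<otimes>\<^sub>M B)) $ p $ q = A $ fst p $ fst q * B $ snd p $ snd q" (is ?A)
    and "((mat 1 \<otimes>\<^sub>M B) ** (A \<otimes>\<^sub>M mat 1)) $ p $ q = B $ snd p $ snd q * A $ fst p $ fst q" (is ?B)
proof -
  have "((A \<otimes>\<^sub>M mat 1) ** (mat 1 \<otimes>\<^sub>M B)) $ p $ q =
      (\<Sum>r\<in>UNIV. if r = (fst q, snd p) then A $ fst p $ fst q * B $ snd p $ snd q else 0)"
    by (simp only: matrix_matrix_mult_def vec_lambda_beta) (rule sum.cong, auto simp: kron_def mat_def)
  moreover have "((mat 1 \<otimes>\<^sub>M B) ** (A \<otimes>\<^sub>M mat 1)) $ p $ q =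
      (\<Sum>r\<in>UNIV. if r = (fst p, snd q) then B $ snd p $ snd q * A $ fst p $ fst q else 0)"
    by (simp only: matrix_matrix_mult_def vec_lambda_beta) (rule sum.cong, auto simp: kron_def mat_def)
  ultimately show ?A ?B by simp_all
qed

text \<open>Multiplication by \<open>P\<close> from the left or right exchanges row or column indices, which turns the matrix
  relation into the familiar quadratic relations between entries.\<close>
lemma rtt_iff:
  "rtt z A B \<longleftrightarrow> (\<forall>i j k l. z * (A $ i $ j * B $ k $ l) - A $ k $ j * B $ i $ l
      = B $ k $ l * A $ i $ j * z - B $ k $ j * A $ i $ l)"
proof -
  have "((mat z - Pmat) ** (A \<otimes>\<^sub>M mat 1) ** (mat 1 \<otimes>\<^sub>M B)) $ (i, k) $ (j, l)
      = z * (A $ i $ j * B $ k $ l) - A $ k $ j * B $ i $ l"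
    "((mat 1 \<otimes>\<^sub>M B) ** (A \<otimes>\<^sub>M mat 1) ** (mat z - Pmat)) $ (i, k) $ (j, l)
      = B $ k $ l * A $ i $ j * z - B $ k $ j * A $ i $ l" for i j k l
    by (simp_all add: matrix_diff_distrib mat_mult_nth Pmat_mult_nth kron_mult_nth flip: matrix_mul_assoc)
       (simp_all add: matrix_diff_distrib mat_mult_nth Pmat_mult_nth kron_mult_nth matrix_mul_assoc)
  then show ?thesis by (simp add: rtt_def vec_eq_iff) blast
qed

lemma kron_mult:
  fixes A A' :: "'a::ring_1^'N::finite^'N" and B B' :: "'a^'M::finite^'M"
  shows "(A ** A') \<otimes>\<^sub>M mat 1 = (A \<otimes>\<^sub>M mat 1) ** (A' \<otimes>\<^sub>M (mat 1 :: 'a^'M^'M))"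
    "mat 1 \<otimes>\<^sub>M (B ** B') = (mat 1 \<otimes>\<^sub>M B) ** ((mat 1 :: 'a^'N^'N) \<otimes>\<^sub>M B')"
proof -
  have "((A \<otimes>\<^sub>M mat 1) ** (A' \<otimes>\<^sub>M (mat 1 :: 'a^'M^'M))) $ p $ q =
      (\<Sum>a\<in>UNIV. \<Sum>b\<in>UNIV. if b = snd q then if snd p = snd q then A $ fst p $ a * A' $ a $ fst q else 0 else 0)" for p q
    by (simp only: matrix_matrix_mult_def vec_lambda_beta sum.cartesian_product UNIV_Times_UNIV)
       (rule sum.cong, auto simp: kron_def mat_def)
  then show "(A ** A') \<otimes>\<^sub>M mat 1 = (A \<otimes>\<^sub>M mat 1) ** (A' \<otimes>\<^sub>M (mat 1 :: 'a^'M^'M))"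
    by (auto simp: vec_eq_iff kron_def matrix_matrix_mult_def mat_def)
  have "((mat 1 \<otimes>\<^sub>M B) ** ((mat 1 :: 'a^'N^'N) \<otimes>\<^sub>M B')) $ p $ q =
      (\<Sum>b\<in>UNIV. \<Sum>a\<in>UNIV. if a = fst q then if fst p = fst q then B $ snd p $ b * B' $ b $ snd q else 0 else 0)" for p q
    by (subst sum.swap, simp only: matrix_matrix_mult_def vec_lambda_beta sum.cartesian_product UNIV_Times_UNIV)
       (rule sum.cong, auto simp: kron_def mat_def)
  then show "mat 1 \<otimes>\<^sub>M (B ** B') = (mat 1 \<otimes>\<^sub>M B) ** ((mat 1 :: 'a^'N^'N) \<otimes>\<^sub>M B')"
    by (auto simp: vec_eq_iff kron_def matrix_matrix_mult_def mat_def)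
qed

text \<open>The coproduct of the Yangian: the factors are moved past each other until each of the two
  relations can be applied.\<close>
lemma rtt_mult:
  assumes "rtt z A B" "rtt z A' B'"
    and "\<And>i j k l. A' $ i $ j * B $ k $ l = B $ k $ l * A' $ i $ j"
    and "\<And>i j k l. A $ i $ j * B' $ k $ l = B' $ k $ l * A $ i $ j"
  shows "rtt z (A ** A') (B ** B')"
proof -
  let ?R = "mat z - Pmat" and ?A = "A \<otimes>\<^sub>M mat 1" and ?A' = "A' \<otimes>\<^sub>M mat 1"
    and ?B = "mat 1 \<otimes>\<^sub>M B" and ?B' = "mat 1 \<otimes>\<^sub>M B'"
  have c: "?A' ** ?B = ?B ** ?A'" "?A ** ?B' = ?B' ** ?A"
    by (simp_all add: vec_eq_iff kron_mult_nth assms)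
  have "?R ** (?A ** ?A') ** (?B ** ?B') = ?R ** ?A ** (?A' ** ?B) ** ?B'"
    by (simp add: matrix_mul_assoc)
  also have "\<dots> = (?R ** ?A ** ?B) ** ?A' ** ?B'"
    by (simp add: c(1) matrix_mul_assoc)
  also have "\<dots> = ?B ** ?A ** (?R ** ?A' ** ?B')"
    using assms(1) by (simp add: rtt_def matrix_mul_assoc)
  also have "\<dots> = ?B ** (?A ** ?B') ** ?A' ** ?R"
    using assms(2) by (simp add: rtt_def matrix_mul_assoc)
  also have "\<dots> = (?B ** ?B') ** (?A ** ?A') ** ?R"
    by (simp add: c(2) matrix_mul_assoc)
  finally show ?thesis by (simp add: rtt_def kron_mult)
qed

definition central :: "'c::ring_1 \<Rightarrow> bool" where
  "central x \<longleftrightarrow> (\<forall>y. x * y = y * x)"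

lemma rtt_scalar:
  assumes "rtt z A B" "central c" "central d"
  shows "rtt z (c *\<^sub>M A) (d *\<^sub>M B)"
  unfolding rtt_iff
proof (intro allI, goal_cases)
  case (1 i j k l)
  have c: "x * c = c * x" "x * (c * y) = c * (x * y)" for x y
    using assms(2) unfolding central_def by (metis mult.assoc)+
  have d: "x * d = d * x" "x * (d * y) = d * (x * y)" for x y
    using assms(3) unfolding central_def by (metis mult.assoc)+
  have cd: "(c * x) * (d * y) = c * d * (x * y)" "(d * y) * (c * x) = c * d * (y * x)" for x y
    by (metis c d mult.assoc)+
  have z: "z * (c * d * x) = c * d * (z * x)" for x
    by (metis c d mult.assoc)
  have "c * d * (z * (A $ i $ j * B $ k $ l) - A $ k $ j * B $ i $ l)
      = c * d * (B $ k $ l * A $ i $ j * z - B $ k $ j * A $ i $ l)"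
    using assms(1) by (simp add: rtt_iff)
  then show ?case
    by (simp only: scalar_mat_def vec_lambda_beta cd z right_diff_distrib) (simp only: mult.assoc)
qed

text \<open>For \<open>A = 1 - gE\<^sup>t\<close> and \<open>B = 1 - g'E\<^sup>t\<close> the left side of the entry relation contributes
  \<open>z g g' [E\<^sub>j\<^sub>i, E\<^sub>l\<^sub>k]\<close>, the right side \<open>g' - g\<close> times the terms linear in \<open>E\<close>. These are matched by the
  commutation relations of \<open>gl\<^sub>N\<close> because \<open>z g g' = g' - g\<close>, as for \<open>z = u - v\<close>, \<open>g = 1/(u - c)\<close>,
  \<open>g' = 1/(v - c)\<close>.\<close>
lemma rtt_gl_family:
  fixes E :: "'N::finite \<Rightarrow> 'N \<Rightarrow> 'c::ring_1"
  assumes E: "gl_family E" and c: "central z" "central g" "central g'" and zg: "z * g * g' = g' - g"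
  shows "rtt z (\<chi> i j. (if i = j then 1 else 0) - g * E j i) (\<chi> i j. (if i = j then 1 else 0) - g' * E j i)"
  unfolding rtt_iff
proof (intro allI, goal_cases)
  case (1 i j k l)
  define \<delta> where "\<delta> = (\<lambda>i j::'N. if i = j then 1 else (0::'c))"
  define a b p q where "a = E j i" and "b = E l k" and "p = E j k" and "q = E l i"
  have ab: "a * b - b * a = \<delta> i l * p - \<delta> k j * q"
    using E[unfolded gl_family_def, rule_format, of j i l k] by (auto simp: a_def b_def p_def q_def \<delta>_def)
  have z: "x * z = z * x" "x * (z * y) = z * (x * y)" for x y
    using c(1) unfolding central_def by (metis mult.assoc)+
  have g: "x * g = g * x" "x * (g * y) = g * (x * y)" for x y
    using c(2) unfolding central_def by (metis mult.assoc)+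
  have g': "x * g' = g' * x" "x * (g' * y) = g' * (x * y)" for x y
    using c(3) unfolding central_def by (metis mult.assoc)+
  have swap: "x - p = y - q" if "x - y = p - q" for x y p q :: 'c
  proof -
    have "x = p - q + y" using that by (simp add: diff_eq_eq)
    then show ?thesis by simp
  qed
  have zz: "z * x - y * z = z * (x - y)" for x y
    by (simp add: z(1)[of y] right_diff_distrib)
  have gg: "(g * a) * (g' * b) = g * g' * (a * b)" "(g' * b) * (g * a) = g * g' * (b * a)"
    by (simp_all only: mult.assoc g'(2)[of a] g(2)[of b] g'(2)[of g])
  have e: "(\<delta> i j - g * a) * (\<delta> k l - g' * b) - (\<delta> k l - g' * b) * (\<delta> i j - g * a) = g * g' * (a * b - b * a)"
    by (cases "i = j"; cases "k = l"; simp add: left_diff_distrib right_diff_distrib gg \<delta>_def)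
  have "z * ((\<delta> i j - g * a) * (\<delta> k l - g' * b)) - (\<delta> k l - g' * b) * (\<delta> i j - g * a) * z
    = z * ((\<delta> i j - g * a) * (\<delta> k l - g' * b) - (\<delta> k l - g' * b) * (\<delta> i j - g * a))"
    by (rule zz)
  also have "\<dots> = z * g * g' * (a * b - b * a)" by (simp only: e mult.assoc)
  also have "\<dots> = (g' - g) * (\<delta> i l * p - \<delta> k j * q)" by (simp only: zg ab)
  also have "\<dots> = (\<delta> k j - g * p) * (\<delta> i l - g' * q) - (\<delta> k j - g' * p) * (\<delta> i l - g * q)"
  proof -
    have "(g * p) * (g' * q) = (g' * p) * (g * q)" by (simp only: mult.assoc g'(2)[of p] g(2)[of p] g'(2)[of g])
    then show ?thesis by (simp add: left_diff_distrib right_diff_distrib \<delta>_def)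
  qed
  finally show ?case
    by (simp only: vec_lambda_beta a_def b_def p_def q_def \<delta>_def) (rule swap)
qed

section \<open>Representations of the Yangian from solutions of the RTT relation\<close>

text \<open>The series in \<open>u\<inverse>\<close> is embedded in iterated Laurent series in two ways: as a constant in \<open>v\<close>, and as a
  series in \<open>v\<inverse>\<close> with coefficients constant in \<open>u\<close>.\<close>
definition rtt_series :: "('b::ring_1 fls)^'N::finite^'N \<Rightarrow> bool" where
  "rtt_series T \<longleftrightarrow> rtt (fls_const fls_X_inv - fls_X_inv)
     (map_matrix fls_const T) (map_matrix (map_fls fls_const) T)"

lemmas unital_hom_map_fls_const = unital_hom.unital_hom_map_fls[OF unital_hom_fls_const]

text \<open>The relators are coefficients of a matrix of iterated series, so the homomorphism from the free
  algebra is applied to that matrix as a whole: its image is the RTT relation for \<open>T\<close>.\<close>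
theorem yangian_hom_exists:
  fixes T :: "('b::complex_algebra_1 fls)^'N::finite^'N"
  assumes T: "unipotent_series T" and rtt: "rtt_series T"
  obtains h where "algebra_hom_on UNIV h" "map_matrix (map_fls h) Tmat = T"
    "\<And>i j r. h (yangian_t i j r) = fls_nth (T $ i $ j) (int r)"
proof -
  define f where "f = (\<lambda>(i, j, r). fls_nth (T $ i $ j) (int (Suc r)))"
  interpret e: unital_hom "free_eval f" by (rule unital_hom_free_eval)
  interpret E: unital_hom "map_fls (free_eval f)" by (rule e.unital_hom_map_fls)
  interpret EE: unital_hom "map_fls (map_fls (free_eval f))" by (rule E.unital_hom_map_fls)
  have fl: "f (i, j, r) = fls_nth (T $ i $ j) (int (Suc r))" for i j r
    by (simp add: f_def)
  have t: "free_eval f (free_t i j r) = fls_nth (T $ i $ j) (int r)" for i j r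
    using T by (cases r) (simp_all add: unipotent_series_def e.hom_one e.hom_zero free_eval_letter fl)
  let ?M = "map_matrix (map_fls (map_fls (free_eval f)))"
  have 1: "?M (\<chi> i j. fls_const (fps_to_fls (Abs_fps (free_t i j)))) = map_matrix fls_const T"
    using T by (auto simp: vec_eq_iff E.map_fls_const unipotent_series_def e.fls_nth_map_fls e.hom_zero t
      intro!: fls_eqI)
  have 2: "?M (\<chi> i j. fps_to_fls (Abs_fps (\<lambda>s. fls_const (free_t i j s)))) = map_matrix (map_fls fls_const) T"
    using T by (auto simp: vec_eq_iff E.fls_nth_map_fls unital_hom.fls_nth_map_fls[OF unital_hom_fls_const]
        unipotent_series_def E.hom_zero e.map_fls_const t intro!: fls_eqI)
  have "?M (mat 1 :: ('N \<times> 'N \<times> nat) free_algebra fls fls^'N^'N) = mat 1"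
    by (simp add: EE.map_matrix_mat EE.hom_one)
  then have "?M rtt_difference = 0"
    using rtt unfolding rtt_difference_def Let_def rtt_series_def rtt_def
    by (simp add: EE.map_matrix_diff EE.map_matrix_mult EE.map_matrix_kron EE.map_matrix_mat EE.map_matrix_Pmat
        1 2 EE.hom_diff E.map_fls_const e.map_fls_X_inv E.map_fls_X_inv)
  then have "fls_nth (fls_nth (map_fls (map_fls (free_eval f)) (rtt_difference $ p $ q)) s) r = 0" for p q s r
    by (metis nth_map_matrix fls_zero_nth zero_index)
  then have "free_eval f g = 0" if "g \<in> yangian_relators" for g
    using that by (auto simp: yangian_relators_def E.fls_nth_map_fls e.fls_nth_map_fls)
  then obtain h where h: "algebra_hom_on UNIV h" "\<And>x. h (abs_yangian x) = free_eval f x"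
    using yangian_lift by blast
  interpret h: unital_hom h by (rule algebra_homD(1)[OF h(1)])
  have *: "h (yangian_t i j r) = fls_nth (T $ i $ j) (int r)" for i j r
    by (simp add: yangian_t.abs_eq h(2) t)
  have T': "map_matrix (map_fls h) Tmat = T"
    using T by (auto simp: vec_eq_iff Tmat_def h.fls_nth_map_fls h.hom_zero * unipotent_series_def intro!: fls_eqI)
  show thesis by (rule that[OF h(1) T' *])
qed

lemma free_algebra_induct:
  assumes "P 1" and "\<And>x. P (letter x)"
    and "\<And>x y. P x \<Longrightarrow> P y \<Longrightarrow> P (x + y)" and "\<And>x y. P x \<Longrightarrow> P y \<Longrightarrow> P (x * y)"
    and scale: "\<And>c x. P x \<Longrightarrow> P (Poly_Mapping.single 0 c * x)"
  shows "P (x :: 'x free_algebra)"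
proof -
  have word: "P (Poly_Mapping.single w 1)" for w
  proof (induction w)
    case Nil
    then show ?case using assms(1) by (simp flip: zero_list_def)
  next
    case (Cons x w)
    have "Poly_Mapping.single (x # w) 1 = letter x * Poly_Mapping.single w (1::complex)"
      by (simp add: letter_def mult_single plus_list_def)
    then show ?case using assms(2,4) Cons by simp
  qed
  show ?thesis
  proof (induction x rule: poly_mapping_single_induct)
    case 1
    show ?case using scale[OF assms(1), of 0] by simp
  next
    case (2 y w c)
    have "Poly_Mapping.single w c = Poly_Mapping.single 0 c * Poly_Mapping.single w (1::complex)"
      by (simp add: mult_single)
    then show ?case using assms(3)[OF 2 scale[OF word]] by simp
  qed
qed

lemma yangian_generated: "x \<in> gen_subalgebra (range (\<lambda>(i, j, r). yangian_t i j r))"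
  for x :: "'N::finite yangian"
proof -
  let ?G = "gen_subalgebra (range (\<lambda>(i, j, r). yangian_t i j r)) :: 'N yangian set"
  have "abs_yangian y \<in> ?G" for y
  proof (induction y rule: free_algebra_induct)
    case (2 x)
    obtain i j r where x: "x = (i, j, r)" by (cases x) auto
    show ?case
      using gen_subalgebra.gen[OF rangeI[of "\<lambda>(i, j, r). yangian_t i j r" "(i, j, Suc r)"]]
      by (simp add: x yangian_t.abs_eq)
  next
    case (5 c x)
    then show ?case by (simp only: cscale_yangian.abs_eq[symmetric] gen_subalgebra.scale)
  qed (simp_all only: plus_yangian.abs_eq[symmetric] times_yangian.abs_eq[symmetric]
      one_yangian_def[symmetric] gen_subalgebra.intros)
  from this[of "rep_yangian x"] show ?thesis by (simp only: Quotient3_abs_rep[OF Quotient3_yangian])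
qed

lemma gl_envelope_generated: "x \<in> gen_subalgebra (range (\<lambda>(i, j). gl_E i j))"
  for x :: "'N::finite gl_envelope"
proof -
  let ?G = "gen_subalgebra (range (\<lambda>(i, j). gl_E i j)) :: 'N gl_envelope set"
  have "abs_gl_envelope y \<in> ?G" for y
  proof (induction y rule: free_algebra_induct)
    case (2 x)
    obtain i j where x: "x = (i, j)" by (cases x) auto
    show ?case
      using gen_subalgebra.gen[OF rangeI[of "\<lambda>(i, j). gl_E i j" "(i, j)"]]
      by (simp add: x gl_E.abs_eq)
  next
    case (5 c x)
    then show ?case by (simp only: cscale_gl_envelope.abs_eq[symmetric] gen_subalgebra.scale)
  qed (simp_all only: plus_gl_envelope.abs_eq[symmetric] times_gl_envelope.abs_eq[symmetric]
      one_gl_envelope_def[symmetric] gen_subalgebra.intros)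
  from this[of "rep_gl_envelope x"] show ?thesis by (simp only: Quotient3_abs_rep[OF Quotient3_gl_envelope])
qed

lemma unipotent_series_flip: "unipotent_series T \<Longrightarrow> unipotent_series (map_matrix fls_flip T)"
  by (simp add: unipotent_series_def fls_nth_flip)

lemma unipotent_Tmat: "unipotent_series Tmat"
  by (auto simp: unipotent_series_def Tmat_def yangian_t.abs_eq one_yangian_def zero_yangian_def)

text \<open>Ring homomorphisms preserve inverses, but \<open>matrix_inv\<close> is an inverse only where one exists; that
  \<open>T(-u)\<close> is invertible over the Yangian is due to its constant term.\<close>
theorem map_Smat:
  fixes h :: "'N::finite yangian \<Rightarrow> 'b::complex_algebra_1"
  assumes h: "algebra_hom_on UNIV h" and T: "map_matrix (map_fls h) Tmat = T"
    and V: "V ** map_matrix fls_flip T = mat 1"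
  shows "map_matrix (map_fls h) Smat = V ** T"
proof -
  interpret h: unital_hom h by (rule algebra_homD(1)[OF h])
  interpret H: unital_hom "map_fls h" by (rule h.unital_hom_map_fls)
  let ?m = "map_matrix (map_fls h)" and ?F = "map_matrix fls_flip Tmat"
  obtain W where W: "?F ** W = mat 1" "W ** ?F = (mat 1 :: ('N yangian fls)^'N^'N)"
    using unipotent_series_invertible[OF unipotent_series_flip[OF unipotent_Tmat]] by blast
  have "?m ?F = map_matrix fls_flip T"
    unfolding T[symmetric] by (auto simp: vec_eq_iff h.fls_nth_map_fls fls_nth_flip h.hom_uminus intro!: fls_eqI)
  then have "map_matrix fls_flip T ** ?m W = mat 1"
    using arg_cong[OF W(1), of ?m] by (simp add: H.map_matrix_mult H.map_matrix_mat H.hom_one)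
  then have "?m W = V"
    using V by (metis matrix_mul_assoc matrix_mul_lid matrix_mul_rid)
  then show ?thesis
    unfolding Smat_def matrix_inv_eqI[OF W] by (simp add: H.map_matrix_mult T)
qed

section \<open>Solutions of the RTT relation\<close>

lemma central_fls:
  assumes "\<And>k. central (fls_nth F k)"
  shows "central F"
  using assms unfolding central_def by (metis fls_commute)

lemma central_X_inv: "central (fls_X_inv :: 'a::ring_1 fls)"
  by (rule central_fls) (simp add: central_def)

lemma central_diff: "central x \<Longrightarrow> central y \<Longrightarrow> central (x - y)"
  by (simp add: central_def algebra_simps)

lemma central_const: "central x \<Longrightarrow> central (fls_const x)"
  by (rule central_fls) (simp add: central_def)

lemma central_scalar: "central (fls_scalar f)"
  unfolding central_def by (blast intro: fls_scalar_central)

lemma central_map_const: "(\<And>k. central (fls_nth F k)) \<Longrightarrow> central (map_fls fls_const F)"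
  by (rule central_fls) (simp add: unital_hom.fls_nth_map_fls[OF unital_hom_fls_const] central_const)

lemma central_scalar_nth: "central (fls_nth (fls_scalar f :: 'a::complex_algebra_1 fls) k)"
  by (simp add: fls_nth_scalar central_def cscale_central)

definition resolvent :: "complex \<Rightarrow> complex fls" where
  "resolvent c = 1 / (fls_X_inv - fls_const c)"

lemma X_inv_minus_const_nonzero: "fls_X_inv - fls_const c \<noteq> (0 :: complex fls)"
proof
  assume "fls_X_inv - fls_const c = (0 :: complex fls)"
  then have "fls_nth (fls_X_inv - fls_const c) (-1) = (0 :: complex)" by simp
  then show False by simp
qed

lemma resolvent_eq: "(fls_X_inv - fls_const c) * resolvent c = 1"
  using X_inv_minus_const_nonzero by (simp add: resolvent_def)

lemma resolvent_nth: "k \<le> 0 \<Longrightarrow> fls_nth (resolvent c) k = 0"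
proof -
  assume "k \<le> 0"
  have "fls_subdegree (fls_X_inv - fls_const c :: complex fls) = -1"
    by (rule fls_subdegree_eqI) auto
  moreover have "resolvent c \<noteq> 0" using resolvent_eq[of c] by auto
  ultimately have "fls_subdegree (resolvent c) = 1"
    using arg_cong[OF resolvent_eq[of c], of fls_subdegree] X_inv_minus_const_nonzero
    by (simp add: fls_subdegree_mult)
  then show ?thesis using \<open>k \<le> 0\<close> by simp
qed

text \<open>The matrix \<open>1 - g(u) E\<^sup>t\<close>. With \<open>g = 1/(u - c)\<close> and the matrix units of a tensor factor it is
  \<open>R(u - c)\<close> acting on the copy \<open>0\<close> and that factor.\<close>
definition lax :: "complex fls \<Rightarrow> ('N \<Rightarrow> 'N \<Rightarrow> 'b::complex_algebra_1) \<Rightarrow> ('b fls)^'N::finite^'N" where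
  "lax g E = (\<chi> i j. (if i = j then 1 else 0) - fls_scalar g * fls_const (E j i))"

lemma lax_unipotent: "unipotent_series (lax (resolvent c) E)"
  by (auto simp: unipotent_series_def lax_def fls_nth_scalar resolvent_nth)

lemma lax_rtt:
  fixes E :: "'N::finite \<Rightarrow> 'N \<Rightarrow> 'b::complex_algebra_1"
  assumes E: "gl_family E"
  shows "rtt_series (lax (resolvent c) E)"
proof -
  interpret k1: unital_hom "fls_const :: 'b fls \<Rightarrow> 'b fls fls" by (rule unital_hom_fls_const)
  interpret k0: unital_hom "fls_const :: 'b \<Rightarrow> 'b fls" by (rule unital_hom_fls_const)
  interpret k2: unital_hom "map_fls fls_const :: 'b fls \<Rightarrow> 'b fls fls" by (rule unital_hom_map_fls_const)
  interpret s: unital_hom "fls_scalar :: complex fls \<Rightarrow> 'b fls" by (rule unital_hom_fls_scalar)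
  define g :: "'b fls fls" where "g = fls_const (fls_scalar (resolvent c))"
  define g' :: "'b fls fls" where "g' = map_fls fls_const (fls_scalar (resolvent c))"
  define C :: "'b fls fls" where "C = fls_const (fls_const (c *\<^sub>C 1))"
  let ?u = "fls_const fls_X_inv :: 'b fls fls" and ?v = "fls_X_inv :: 'b fls fls"
  have sX: "fls_scalar fls_X_inv = (fls_X_inv :: 'b fls)"
    by (rule fls_eqI) (simp add: fls_nth_scalar cscale_one)
  have sc: "fls_scalar (fls_const c) = (fls_const (c *\<^sub>C 1) :: 'b fls)"
    by (rule fls_eqI) (simp add: fls_nth_scalar)
  have *: "(fls_X_inv - fls_const (c *\<^sub>C 1)) * fls_scalar (resolvent c) = (1 :: 'b fls)"
    using arg_cong[OF resolvent_eq[of c], of "fls_scalar :: _ \<Rightarrow> 'b fls"]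
    by (simp only: s.hom_mult s.hom_diff s.hom_one sX sc)
  have g: "(?u - C) * g = 1"
    using arg_cong[OF *, of "fls_const :: 'b fls \<Rightarrow> _"] by (simp only: k1.hom_mult k1.hom_diff k1.hom_one g_def C_def)
  have g': "(?v - C) * g' = 1"
    using arg_cong[OF *, of "map_fls fls_const :: 'b fls \<Rightarrow> _"]
    by (simp only: k2.hom_mult k2.hom_diff k2.hom_one g'_def C_def k0.map_fls_X_inv k0.map_fls_const)
  have cg: "central g" "central g'"
    unfolding g_def g'_def by (intro central_const central_scalar central_map_const central_scalar_nth)+
  have cz: "central (?u - ?v)"
    by (intro central_diff central_const central_X_inv)
  have "(?u - ?v) * g * g' = ((?u - C) * g) * g' - ((?v - C) * g') * g"
  proof -
    have "g * g' = g' * g" using cg(1) unfolding central_def by blast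
    then have "(?u - C) * (g * g') - (?v - C) * (g' * g) = (?u - ?v) * (g * g')"
      by (simp add: left_diff_distrib)
    then show ?thesis by (simp only: mult.assoc)
  qed
  also have "\<dots> = g' - g" by (simp only: g g' mult_1)
  finally have zg: "(?u - ?v) * g * g' = g' - g" .
  have E': "gl_family (\<lambda>i j. fls_const (fls_const (E i j)))"
    using E by (intro gl_family_hom[OF unital_hom_fls_const])
  have "map_matrix fls_const (lax (resolvent c) E) = (\<chi> i j. (if i = j then 1 else 0) - g * fls_const (fls_const (E j i)))"
    "map_matrix (map_fls fls_const) (lax (resolvent c) E) = (\<chi> i j. (if i = j then 1 else 0) - g' * fls_const (fls_const (E j i)))"
    by (simp_all add: vec_eq_iff lax_def k1.hom_diff k1.hom_mult k2.hom_diff k2.hom_mult k1.hom_one k1.hom_zero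
        k2.hom_one k2.hom_zero g_def g'_def k0.map_fls_const del: fls_const_mult_const)
  then show ?thesis
    using rtt_gl_family[OF E' cz cg zg] by (simp add: rtt_series_def)
qed

lemma rtt_series_mult:
  assumes "rtt_series A" "rtt_series B"
    and "\<And>i j k l. \<forall>r s. fls_nth (A $ i $ j) r * fls_nth (B $ k $ l) s = fls_nth (B $ k $ l) s * fls_nth (A $ i $ j) r"
  shows "rtt_series (A ** B)"
proof -
  have *: "fls_const F * map_fls fls_const G = map_fls fls_const G * fls_const F"
    if "\<forall>r s. fls_nth F r * fls_nth G s = fls_nth G s * fls_nth F r" for F G :: "'a fls"
    using that by (intro fls_commute)
      (auto simp: unital_hom.fls_nth_map_fls[OF unital_hom_fls_const] intro!: fls_eqI)
  have "rtt (fls_const fls_X_inv - fls_X_inv) (map_matrix fls_const A ** map_matrix fls_const B)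
      (map_matrix (map_fls fls_const) A ** map_matrix (map_fls fls_const) B)"
  proof (rule rtt_mult)
    fix i j k l
    have "\<forall>r s. fls_nth (B $ i $ j) r * fls_nth (A $ k $ l) s = fls_nth (A $ k $ l) s * fls_nth (B $ i $ j) r"
      by (intro allI assms(3)[rule_format, symmetric])
    from *[OF this] *[OF assms(3), of i j k l]
    show "map_matrix fls_const B $ i $ j * map_matrix (map_fls fls_const) A $ k $ l =
        map_matrix (map_fls fls_const) A $ k $ l * map_matrix fls_const B $ i $ j"
      "map_matrix fls_const A $ i $ j * map_matrix (map_fls fls_const) B $ k $ l =
        map_matrix (map_fls fls_const) B $ k $ l * map_matrix fls_const A $ i $ j"
      by (simp_all only: nth_map_matrix)
  qed (use assms(1,2) in \<open>simp_all only: rtt_series_def\<close>)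
  then show ?thesis
    by (simp add: rtt_series_def unital_hom.map_matrix_mult unital_hom_fls_const unital_hom_map_fls_const)
qed

lemma rtt_series_scalar:
  assumes "rtt_series A"
  shows "rtt_series (fls_scalar f *\<^sub>M A)"
  using rtt_scalar[OF assms[unfolded rtt_series_def], of "fls_const (fls_scalar f)" "map_fls fls_const (fls_scalar f)"]
  by (simp add: rtt_series_def unital_hom.map_matrix_scalar unital_hom_fls_const unital_hom_map_fls_const
      central_const central_scalar central_map_const central_scalar_nth)

lemma unipotent_series_mult:
  assumes "unipotent_series A" "unipotent_series B"
  shows "unipotent_series (A ** B)"
proof -
  have nth: "fls_nth ((A ** B) $ i $ j) n = (\<Sum>k\<in>UNIV. \<Sum>m=0..n. fls_nth (A $ i $ k) m * fls_nth (B $ k $ j) (n - m))" for i j n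
    using assms unfolding unipotent_series_def
    by (simp add: matrix_matrix_mult_def fls_nth_sum fls_times_nth_bounds[of 0 _ 0])
  have "(\<Sum>k\<in>UNIV. (if i = k then 1 else 0) * (if k = j then 1 else (0::'a))) = (if i = j then 1 else 0)" for i j :: 'b
    using matrix_mul_lid[of "mat 1 :: 'a^'b^'b"] by (simp add: matrix_matrix_mult_def mat_def vec_eq_iff)
  then show ?thesis
    using assms unfolding unipotent_series_def nth by simp
qed

section \<open>Joint eigenvalues of the Jucys--Murphy elements\<close>

text \<open>A polynomial in \<open>x\<close> given by the list of its integer roots.\<close>
definition lin_prod :: "'a::ring_1 \<Rightarrow> int list \<Rightarrow> 'a" where
  "lin_prod x as = (\<Prod>a\<leftarrow>as. x - of_int a)"

lemma lin_prod_simps [simp]: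
  "lin_prod x [] = 1" "lin_prod x (a # as) = (x - of_int a) * lin_prod x as"
  "lin_prod x (as @ bs) = lin_prod x as * lin_prod x bs"
  by (simp_all add: lin_prod_def)

lemma lin_prod_intertwine: "w * x = x' * w \<Longrightarrow> w * lin_prod x as = lin_prod x' as * w"
proof (induction as)
  case (Cons a as)
  have "w * ((x - of_int a) * lin_prod x as) = (w * (x - of_int a)) * lin_prod x as"
    by (simp add: mult.assoc)
  also have "w * (x - of_int a) = (x' - of_int a) * w"
    using Cons.prems by (simp add: left_diff_distrib right_diff_distrib mult_of_int_commute[of a w])
  finally show ?case using Cons by (simp add: mult.assoc)
qed simp

lemma lin_prod_remove1:
  assumes "b \<in> set as"
  shows "lin_prod x as = (x - of_int b) * lin_prod x (remove1 b as)"
  using assms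
proof (induction as)
  case (Cons a as)
  have c: "(x - of_int a) * (x - of_int b) = (x - of_int b) * (x - of_int a)"
    by (simp add: left_diff_distrib right_diff_distrib mult_of_int_commute[of a x]
        mult_of_int_commute[of b x] mult_of_int_commute[of a "of_int b"])
  show ?case
  proof (cases "a = b")
    case False
    then have "lin_prod x (a # as) = (x - of_int a) * (x - of_int b) * lin_prod x (remove1 b as)"
      using Cons by (simp add: mult.assoc)
    then show ?thesis using False by (simp add: c mult.assoc)
  qed simp
qed simp

text \<open>The difference of values of a polynomial at commuting \<open>y\<close> and \<open>x\<close> is divisible by \<open>y - x\<close>.\<close>
lemma lin_prod_diff:
  assumes "x * y = y * (x::'a::ring_1)"
  shows "\<exists>q. lin_prod y as - lin_prod x as = q * (y - x)"
proof (induction as)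
  case Nil
  show ?case by (rule exI[of _ 0]) simp
next
  case (Cons a as)
  then obtain q where q: "lin_prod y as - lin_prod x as = q * (y - x)" by blast
  have c: "(y - x) * lin_prod x as = lin_prod x as * (y - x)"
    by (rule lin_prod_intertwine) (simp add: algebra_simps assms)
  have "lin_prod y (a # as) - lin_prod x (a # as)
      = (y - of_int a) * (lin_prod y as - lin_prod x as) + (y - x) * lin_prod x as"
    by (simp add: algebra_simps)
  also have "\<dots> = ((y - of_int a) * q + lin_prod x as) * (y - x)"
    by (simp add: q c distrib_right mult.assoc)
  finally show ?case by blast
qed

lemma of_int_cscale: "of_int m *\<^sub>C 1 = (of_int m :: 'a::complex_algebra_1)"
proof -
  interpret unital_hom "\<lambda>c. c *\<^sub>C (1::'a)" by (rule unital_hom_cscale_one)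
  have "of_nat k *\<^sub>C 1 = (of_nat k :: 'a)" for k
    by (induction k) (simp_all add: cscale_add_left cscale_one)
  then show ?thesis by (cases m rule: int_cases2) (simp_all add: hom_uminus)
qed

lemma of_int_mult_eq_0_iff:
  "of_int m * z = (0::'a::complex_algebra_1) \<longleftrightarrow> m = 0 \<or> z = 0"
proof
  assume "of_int m * z = 0"
  then have "(of_int m *\<^sub>C 1) * z = 0" by (simp only: of_int_cscale)
  then have "of_int m *\<^sub>C z = 0" by (simp add: cscale_mult_left)
  then have "(inverse (of_int m) * of_int m) *\<^sub>C z = 0" by (simp flip: cscale_cscale)
  then show "m = 0 \<or> z = 0" by (cases "m = 0") (simp_all add: cscale_one)
qed auto

lemma of_int_left_commute: "w * (of_int m * v) = of_int m * (w * (v::'a::ring_1))"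
proof -
  have "(w * of_int m) * v = (of_int m * w) * v" by (simp only: mult_of_int_commute)
  then show ?thesis by (simp only: mult.assoc)
qed

lemma eigen_left_commute:
  assumes "x * w = w * x" "x * z = of_int a * (z::'a::ring_1)"
  shows "x * (w * z) = of_int a * (w * z)"
proof -
  have "x * (w * z) = w * (x * z)" using arg_cong[OF assms(1), of "\<lambda>y. y * z"] by (simp only: mult.assoc)
  then show ?thesis by (simp only: assms(2) of_int_left_commute)
qed

text \<open>The relations between the transpositions of a symmetric group that the theory of the Jucys--Murphy
  elements needs. Weights are looked for in the algebra itself, under left
  multiplication, so that no module has to be chosen.\<close>
locale transposition_rep =
  fixes n :: nat and P :: "nat \<Rightarrow> nat \<Rightarrow> 'a::complex_algebra_1"
  assumes P_sym: "P i j = P j i"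
    and P_square: "i \<in> {1..n} \<Longrightarrow> j \<in> {1..n} \<Longrightarrow> P i j * P i j = 1"
    and P_conj: "i \<in> {1..n} \<Longrightarrow> j \<in> {1..n} \<Longrightarrow> k \<in> {1..n} \<Longrightarrow> distinct [i, j, k] \<Longrightarrow> P i j * P j k = P i k * P i j"
    and P_commute: "i \<in> {1..n} \<Longrightarrow> j \<in> {1..n} \<Longrightarrow> k \<in> {1..n} \<Longrightarrow> l \<in> {1..n} \<Longrightarrow> distinct [i, j, k, l]
      \<Longrightarrow> P i j * P k l = P k l * P i j"
begin

definition JM :: "nat \<Rightarrow> 'a" where
  "JM r = (\<Sum>i\<in>{1..<r}. P i r)"

lemma JM_1: "JM (Suc 0) = 0"
  by (simp add: JM_def)

lemma P_JM_commute_below: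
  assumes "i \<noteq> j" "i \<in> {1..<r}" "j \<in> {1..<r}" "r \<le> n"
  shows "P i j * JM r = JM r * P i j"
proof -
  define \<tau> where "\<tau> = (\<lambda>k. if k = i then j else if k = j then i else k)"
  have *: "P i j * P k r = P (\<tau> k) r * P i j" if "k \<in> {1..<r}" for k
  proof (cases "k = i \<or> k = j")
    case True
    then show ?thesis
      using P_conj[of j i r] P_conj[of i j r] assms by (auto simp: \<tau>_def P_sym[of j i])
  next
    case False
    then show ?thesis using P_commute[of i j k r] assms that by (auto simp: \<tau>_def)
  qed
  have "P i j * JM r = (\<Sum>k\<in>{1..<r}. P (\<tau> k) r * P i j)"
    by (simp only: JM_def sum_distrib_left) (rule sum.cong, simp_all add: *)
  also have "\<dots> = (\<Sum>k\<in>{1..<r}. P k r * P i j)"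
    by (rule sum.reindex_bij_witness[of _ \<tau> \<tau>]) (use assms in \<open>auto simp: \<tau>_def\<close>)
  finally show ?thesis by (simp add: JM_def sum_distrib_right)
qed

lemma P_JM_commute_above:
  assumes "i \<noteq> j" "i \<in> {r<..n}" "j \<in> {r<..n}" "1 \<le> r"
  shows "P i j * JM r = JM r * P i j"
  unfolding JM_def sum_distrib_left sum_distrib_right
  by (rule sum.cong) (use assms in \<open>auto intro!: P_commute\<close>)

lemma JM_commute:
  assumes "r \<in> {1..n}" "s \<in> {1..n}"
  shows "JM r * JM s = JM s * JM r"
proof -
  have *: "JM r * JM s = JM s * JM r" if "r < s" "s \<le> n" for r s
    unfolding JM_def[of r] sum_distrib_left sum_distrib_right
    by (rule sum.cong) (use that in \<open>auto intro!: P_JM_commute_below\<close>)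
  show ?thesis using *[of r s] *[of s r] assms by (cases r s rule: linorder_cases) auto
qed

text \<open>The relations of the degenerate affine Hecke algebra.\<close>
lemma s_JM:
  assumes "1 \<le> i" "Suc i \<le> n"
  shows "P i (Suc i) * JM i = JM (Suc i) * P i (Suc i) - 1"
    and "P i (Suc i) * JM (Suc i) = JM i * P i (Suc i) + 1"
proof -
  let ?s = "P i (Suc i)"
  have ss: "?s * ?s = 1" using assms by (intro P_square) auto
  have *: "?s * P k i = P k (Suc i) * ?s" if "k \<in> {1..<i}" for k
    using P_conj[of "Suc i" i k] assms that by (simp add: P_sym[of "Suc i"] P_sym[of i k])
  have JM: "JM (Suc i) = (\<Sum>k\<in>{1..<i}. P k (Suc i)) + ?s"
    using assms by (simp add: JM_def)
  have "?s * JM i = (\<Sum>k\<in>{1..<i}. P k (Suc i) * ?s)"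
    by (simp only: JM_def sum_distrib_left) (rule sum.cong, simp_all add: *)
  then show 1: "?s * JM i = JM (Suc i) * ?s - 1"
    by (simp add: JM distrib_right ss sum_distrib_right)
  have "?s * JM i * ?s = JM (Suc i) - ?s"
    by (simp add: 1 left_diff_distrib mult.assoc ss)
  then have "?s * (?s * JM i * ?s) = ?s * JM (Suc i) - 1"
    by (simp add: right_diff_distrib ss)
  moreover have "?s * (?s * JM i * ?s) = JM i * ?s"
    by (simp add: ss flip: mult.assoc)
  ultimately show "?s * JM (Suc i) = JM i * ?s + 1" by simp
qed

lemma JM_s_mult:
  assumes "1 \<le> i" "Suc i \<le> n"
  shows "JM i * (P i (Suc i) * z) = P i (Suc i) * (JM (Suc i) * z) - z"
    and "JM (Suc i) * (P i (Suc i) * z) = P i (Suc i) * (JM i * z) + z"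
  using arg_cong[OF s_JM(2)[OF assms], of "\<lambda>x. x * z"] arg_cong[OF s_JM(1)[OF assms], of "\<lambda>x. x * z"]
  by (simp_all only: distrib_right left_diff_distrib mult.assoc mult_1 add_diff_cancel diff_add_cancel)

lemma braid:
  assumes "1 \<le> i" "i + 2 \<le> n"
  shows "P i (i+1) * (P (i+1) (i+2) * (P i (i+1) * z)) = P (i+1) (i+2) * (P i (i+1) * (P (i+1) (i+2) * z))"
proof -
  let ?s = "P i (i+1)" and ?t = "P (i+1) (i+2)"
  have sq: "?s * ?s = 1" "?t * ?t = 1" using assms by (auto intro!: P_square)
  have "?s * ?t * ?s = P i (i+2) * ?s * ?s" using P_conj[of i "i+1" "i+2"] assms by simp
  moreover have "?t * ?s * ?t = P i (i+2) * ?t * ?t"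
    using P_conj[of "Suc (Suc i)" "Suc i" i] assms
    by (simp add: P_sym[of "Suc (Suc i)" "Suc i"] P_sym[of "Suc (Suc i)" i] P_sym[of "Suc i" i])
  ultimately have "?s * ?t * ?s = ?t * ?s * ?t" by (simp only: mult.assoc sq)
  from arg_cong[OF this, of "\<lambda>x. x * z"] show ?thesis by (simp only: mult.assoc)
qed

text \<open>Let \<open>x, y\<close> be consecutive Jucys--Murphy elements, \<open>s\<close> the transposition that links them and
  \<open>\<phi> = s(x - y) + 1\<close> the intertwiner, so that \<open>\<phi>y = x\<phi>\<close> and \<open>\<phi>\<^sup>2 = 1 - (x - y)\<^sup>2\<close>. If \<open>p(x) = 0\<close>, then
  \<open>\<phi> p(y) = p(x) \<phi> = 0\<close>, hence \<open>(y + 1 - x)(y - 1 - x) p(y) = 0\<close>. Both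
  linear factors divide \<open>p(y + 1)\<close> and \<open>p(y - 1)\<close> respectively, as these differ from \<open>p(x) = 0\<close> by
  multiples of them. Therefore \<open>p(y + 1) p(y - 1) p(y) = 0\<close>.\<close>
lemma JM_annihilated:
  assumes "Suc i \<le> n"
  shows "\<exists>as. lin_prod (JM (Suc i)) as = 0"
  using assms
proof (induction i)
  case 0
  show ?case by (rule exI[of _ "[0]"]) (simp add: JM_1)
next
  case (Suc i)
  define x y s where "x = JM (Suc i)" and "y = JM (Suc (Suc i))" and "s = P (Suc i) (Suc (Suc i))"
  define \<phi> where "\<phi> = s * (x - y) + 1"
  obtain as where as: "lin_prod x as = 0" using Suc by (auto simp: x_def)
  have xy: "x * y = y * x" unfolding x_def y_def using Suc.prems by (intro JM_commute) auto
  have ss: "s * s = 1" unfolding s_def using Suc.prems by (intro P_square) auto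
  have sx: "s * x = y * s - 1" and sy: "s * y = x * s + 1"
    unfolding s_def x_def y_def using s_JM[of "Suc i"] Suc.prems by auto
  have "\<phi> * y = (s * y) * (x - y) + y"
    by (simp add: \<phi>_def algebra_simps xy)
  also have "\<dots> = x * \<phi>"
    by (simp add: sy \<phi>_def algebra_simps)
  finally have "\<phi> * lin_prod y as = lin_prod x as * \<phi>" by (rule lin_prod_intertwine)
  then have 0: "\<phi> * lin_prod y as = 0" by (simp add: as)
  have d: "s * (x - y) = (y - x) * s - 2" by (simp add: algebra_simps sx sy)
  have \<phi>2: "\<phi> = (y - x) * s - 1" by (simp only: \<phi>_def d) simp
  have "\<phi> * \<phi> = ((y - x) * s - 1) * (s * (x - y) + 1)"
    by (subst (1) \<phi>2) (simp only: \<phi>_def)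
  also have "\<dots> = (y - x) * (s * s) * (x - y) + ((y - x) * s - s * (x - y)) - 1"
    by (simp add: algebra_simps)
  also have "\<dots> = (y - x) * (x - y) + 1"
    by (simp add: ss d)
  also have "\<dots> = - ((y + 1 - x) * (y - 1 - x))"
    by (simp add: algebra_simps)
  finally have "(y + 1 - x) * (y - 1 - x) * lin_prod y as = - (\<phi> * (\<phi> * lin_prod y as))"
    by (simp flip: mult.assoc)
  then have 1: "(y + 1 - x) * ((y - 1 - x) * lin_prod y as) = 0"
    by (simp add: 0 mult.assoc)
  obtain q1 where q1: "lin_prod (y + 1) as = q1 * (y + 1 - x)"
    using lin_prod_diff[of x "y + 1" as] xy as by (auto simp: algebra_simps)
  obtain q2 where q2: "lin_prod (y - 1) as = q2 * (y - 1 - x)"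
    using lin_prod_diff[of x "y - 1" as] xy as by (auto simp: algebra_simps)
  have "(y + 1) * (y - 1 - x) = (y - 1 - x) * (y + 1)" by (simp add: algebra_simps xy)
  have c: "(y + 1 - x) * lin_prod (y - 1) as = lin_prod (y - 1) as * (y + 1 - x)"
    by (rule lin_prod_intertwine) (simp add: algebra_simps xy)
  have shift: "lin_prod (y + 1) as = lin_prod y (map (\<lambda>a. a - 1) as)"
    "lin_prod (y - 1) as = lin_prod y (map (\<lambda>a. a + 1) as)"
    by (induction as) (simp_all add: algebra_simps)
  have "lin_prod (y + 1) as * lin_prod (y - 1) as * lin_prod y as
      = q1 * (lin_prod (y - 1) as * (y + 1 - x)) * lin_prod y as"
    by (simp add: q1 c mult.assoc)
  also have "\<dots> = q1 * q2 * ((y - 1 - x) * (y + 1 - x) * lin_prod y as)"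
    by (simp add: q2 mult.assoc)
  also have "(y - 1 - x) * (y + 1 - x) = (y + 1 - x) * (y - 1 - x)"
    by (simp add: algebra_simps xy)
  also have "\<dots> * lin_prod y as = 0"
    using 1 by (simp add: mult.assoc)
  finally have "lin_prod y (map (\<lambda>a. a - 1) as @ map (\<lambda>a. a + 1) as @ as) = 0"
    by (simp add: shift mult.assoc)
  then show ?case unfolding y_def by blast
qed

end

text \<open>The added assumption says that an integer eigenvalue has no Jordan block of size two, which
  holds whenever the transpositions act by self-adjoint operators.\<close>
locale semisimple_transposition_rep = transposition_rep +
  assumes semisimple: "r \<in> {1..n} \<Longrightarrow> (JM r - of_int a) * ((JM r - of_int a) * z) = 0 \<Longrightarrow> (JM r - of_int a) * z = 0"
begin

definition is_weight :: "nat \<Rightarrow> (nat \<Rightarrow> int) \<Rightarrow> bool" where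
  "is_weight q a \<longleftrightarrow> (\<exists>z. z \<noteq> 0 \<and> (\<forall>r\<in>{1..q}. JM r * z = of_int (a r) * z))"

lemma weight_mono:
  assumes "is_weight q a" "p \<le> q" "\<And>r. r \<in> {1..p} \<Longrightarrow> a r = b r"
  shows "is_weight p b"
proof -
  obtain z where z: "z \<noteq> 0" "\<forall>r\<in>{1..q}. JM r * z = of_int (a r) * z"
    using assms(1) is_weight_def by blast
  have "JM r * z = of_int (b r) * z" if "r \<in> {1..p}" for r
    using bspec[OF z(2), of r] that assms(2) assms(3)[OF that] by simp
  then show ?thesis unfolding is_weight_def using z(1) by blast
qed

lemma weight_1:
  assumes "is_weight q a" "1 \<le> q"
  shows "a 1 = 0"
proof -
  obtain z where z: "z \<noteq> 0" "\<forall>r\<in>{1..q}. JM r * z = of_int (a r) * z"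
    using assms(1) is_weight_def by blast
  have "of_int (a 1) * z = 0" using bspec[OF z(2), of 1] assms(2) by (simp add: JM_1)
  then show ?thesis using z(1) by (simp add: of_int_mult_eq_0_iff)
qed

text \<open>If both eigenvalues were \<open>c\<close>, then \<open>(x\<^sub>i - c) s z = - z\<close> would exhibit a Jordan block of size two.\<close>
lemma weight_neq:
  assumes "is_weight q a" "q \<le> n" "1 \<le> i" "Suc i \<le> q"
  shows "a i \<noteq> a (Suc i)"
proof
  assume eq: "a i = a (Suc i)"
  obtain z where z: "z \<noteq> 0" "\<forall>r\<in>{1..q}. JM r * z = of_int (a r) * z"
    using assms(1) is_weight_def by blast
  let ?s = "P i (Suc i)" and ?c = "of_int (a i) :: 'a"
  have "JM i * (?s * z) = ?s * (JM (Suc i) * z) - z"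
    using JM_s_mult(1)[of i z] assms by simp
  also have "?s * (JM (Suc i) * z) = ?c * (?s * z)"
    using z(2) assms by (simp add: eq of_int_left_commute)
  finally have 1: "(JM i - ?c) * (?s * z) = - z" by (simp add: algebra_simps)
  moreover have "(JM i - ?c) * z = 0" using z(2) assms by (simp add: algebra_simps)
  ultimately have "(JM i - ?c) * ((JM i - ?c) * (?s * z)) = 0" by simp
  then have "(JM i - ?c) * (?s * z) = 0" by (rule semisimple[rotated]) (use assms in auto)
  then show False using 1 z(1) by simp
qed

text \<open>The vector \<open>y = (a\<^sub>i\<^sub>+\<^sub>1 - a\<^sub>i) s z - z\<close> has the two eigenvalues exchanged; it remains to exclude \<open>y = 0\<close>.\<close>
lemma weight_swap':
  assumes "q \<le> n" "1 \<le> i" "Suc i \<le> q" and z: "\<forall>r\<in>{1..q}. JM r * z = of_int (a r) * z"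
    and "of_int (a (Suc i) - a i) * (P i (Suc i) * z) \<noteq> z"
  shows "is_weight q (a(i := a (Suc i), Suc i := a i))"
proof -
  let ?s = "P i (Suc i)" and ?a = "of_int (a i) :: 'a" and ?b = "of_int (a (Suc i)) :: 'a"
  define d :: 'a where "d = of_int (a (Suc i) - a i)"
  define y where "y = d * (?s * z) - z"
  have d: "w * (d * v) = d * (w * v)" for w v
    unfolding d_def by (rule of_int_left_commute)
  note ab = of_int_left_commute[of ?s]
  have sX: "JM i * (?s * z) = ?s * (JM (Suc i) * z) - z" "JM (Suc i) * (?s * z) = ?s * (JM i * z) + z"
    using JM_s_mult[of i z] assms by simp_all
  have zi: "JM i * z = ?a * z" "JM (Suc i) * z = ?b * z" using z assms by auto
  have "JM r * y = of_int ((a(i := a (Suc i), Suc i := a i)) r) * y" if r: "r \<in> {1..q}" for r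
  proof (cases "r = i \<or> r = Suc i")
    case True
    have "JM i * y = d * (?b * (?s * z) - z) - ?a * z"
      by (simp only: y_def right_diff_distrib d[of "JM i"] d[of "JM (Suc i)"] sX zi ab)
    also have "\<dots> = ?b * y"
      by (simp add: y_def right_diff_distrib d[of ?b]) (simp add: d_def left_diff_distrib)
    finally have 1: "JM i * y = ?b * y" .
    have "JM (Suc i) * y = d * (?a * (?s * z) + z) - ?b * z"
      by (simp only: y_def right_diff_distrib d[of "JM i"] d[of "JM (Suc i)"] sX zi ab)
    also have "\<dots> = ?a * y"
      by (simp add: y_def right_diff_distrib distrib_left d[of ?a]) (simp add: d_def left_diff_distrib)
    finally show ?thesis using 1 True by auto
  next
    case False
    have "JM r * ?s = ?s * JM r"
      using P_JM_commute_below[of i "Suc i" r] P_JM_commute_above[of i "Suc i" r] False assms r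
      by (cases "r < i") auto
    then have "JM r * (?s * z) = of_int (a r) * (?s * z)"
      using z r by (intro eigen_left_commute) auto
    then have "JM r * y = of_int (a r) * y"
      using z r by (simp add: y_def right_diff_distrib d[of "JM r"] d[of "of_int (a r)"])
    then show ?thesis using False by auto
  qed
  moreover have "y \<noteq> 0" using assms(5) by (simp add: y_def d_def)
  ultimately show ?thesis unfolding is_weight_def by blast
qed

text \<open>If \<open>d s z = z\<close> with \<open>d = a\<^sub>i\<^sub>+\<^sub>1 - a\<^sub>i\<close>, then \<open>d\<^sup>2 z = z\<close> because \<open>s\<^sup>2 = 1\<close>, so \<open>d = 1\<close> or \<open>d = - 1\<close>.\<close>
lemma weight_swap:
  assumes w: "is_weight q a" and i: "q \<le> n" "1 \<le> i" "Suc i \<le> q" and d1: "\<bar>a (Suc i) - a i\<bar> \<noteq> 1"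
  shows "is_weight q (a(i := a (Suc i), Suc i := a i))"
proof -
  obtain z where z: "z \<noteq> 0" "\<forall>r\<in>{1..q}. JM r * z = of_int (a r) * z"
    using w is_weight_def by blast
  let ?s = "P i (Suc i)"
  define d where "d = a (Suc i) - a i"
  have ss: "?s * ?s = 1" using i by (intro P_square) auto
  have "of_int d * (?s * z) \<noteq> z"
  proof
    assume *: "of_int d * (?s * z) = z"
    then have "?s * z = ?s * (of_int d * (?s * z))" by simp
    also have "\<dots> = of_int d * ((?s * ?s) * z)" by (simp only: of_int_left_commute mult.assoc)
    also have "\<dots> = of_int d * z" by (simp add: ss)
    finally have "of_int (d * d) * z = z" using * by (simp add: mult.assoc)
    then have "of_int (d * d - 1) * z = 0" by (simp add: algebra_simps)
    then have "d * d = 1" using z(1) unfolding of_int_mult_eq_0_iff by simp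
    then show False using d1 unfolding d_def by (auto simp: zmult_eq_1_iff)
  qed
  then show ?thesis using weight_swap'[OF i z(2)] by (simp add: d_def)
qed

text \<open>Exchanging either neighbouring pair of \<open>(a, a \<plusminus> 1, a)\<close> would create two equal adjacent eigenvalues. So the
  two simple transpositions act on \<open>z\<close> by opposite signs, which contradicts the braid
  relation.\<close>
lemma weight_no_braid:
  assumes w: "is_weight q a" and i: "q \<le> n" "1 \<le> i" "i + 2 \<le> q"
    and "a (i + 2) = a i" "\<bar>a (i + 1) - a i\<bar> = 1"
  shows False
proof -
  obtain z where z: "z \<noteq> 0" "\<forall>r\<in>{1..q}. JM r * z = of_int (a r) * z"
    using w is_weight_def by blast
  define e where "e = a (i + 1) - a i"
  have e: "e = 1 \<or> e = - 1" using assms by (auto simp: e_def)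
  let ?s = "P i (i+1)" and ?t = "P (i+1) (i+2)"
  have s: "of_int e * (?s * z) = z"
    using weight_neq[OF weight_swap'[OF _ _ _ z(2), of i] i(1), of "i+1"] i assms(5) by (auto simp: e_def)
  have t: "of_int (- e) * (?t * z) = z"
    using weight_neq[OF weight_swap'[OF _ _ _ z(2), of "i+1"] i(1), of i] i assms(5) by (auto simp: e_def)
  have br: "?s * (?t * (?s * z)) = ?t * (?s * (?t * z))"
    using braid[of i z] i by simp
  have "z + z = 0"
  proof (cases "e = 1")
    case True
    then have "?s * z = z" "- (?t * z) = z" using s t by simp_all
    then have "?s * z = z" "?t * z = - z" by (simp_all add: minus_equation_iff[of _ z])
    then have "- z = z" using br by simp
    then show ?thesis by (simp only: neg_eq_iff_add_eq_0)
  next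
    case False
    then have "- (?s * z) = z" "?t * z = z" using s t e by simp_all
    then have "?s * z = - z" "?t * z = z" by (simp_all add: minus_equation_iff[of _ z])
    then have "- z = z" using br by simp
    then show ?thesis by (simp only: neg_eq_iff_add_eq_0)
  qed
  then have "of_int 2 * z = 0" by (simp add: mult_2)
  then show False using z(1) unfolding of_int_mult_eq_0_iff by simp
qed

text \<open>Otherwise the last eigenvalue could be moved to the front by admissible exchanges. As the
  first eigenvalue is always \<open>0\<close>, the two leading eigenvalues would both be \<open>0\<close>.\<close>
lemma weight_new_neighbour:
  assumes "is_weight q a" "2 \<le> q" "q \<le> n"
  shows "\<exists>p\<in>{1..<q}. \<bar>a p - a q\<bar> = 1"
  using assms
proof (induction q arbitrary: a)
  case (Suc q)
  show ?case
  proof (rule ccontr)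
    assume none: "\<not> ?thesis"
    let ?b = "a(q := a (Suc q), Suc q := a q)"
    have "\<bar>a q - a (Suc q)\<bar> \<noteq> 1" using none Suc.prems by auto
    then have b: "is_weight (Suc q) ?b"
      using Suc.prems by (intro weight_swap) (auto simp: abs_minus_commute)
    show False
    proof (cases "q = 1")
      case True
      then show ?thesis
        using weight_1[OF Suc.prems(1)] weight_1[OF b] weight_neq[OF Suc.prems(1), of 1] Suc.prems(3) by auto
    next
      case False
      then have "\<exists>p\<in>{1..<q}. \<bar>?b p - ?b q\<bar> = 1"
        using Suc.prems by (intro Suc.IH weight_mono[OF b]) auto
      then show ?thesis using none by auto
    qed
  qed
qed simp

text \<open>The eigenvalue \<open>a\<^sub>p\<close> can be moved right until it is adjacent to \<open>a\<^sub>m = a\<^sub>p \<plusminus> 1\<close>, which produces the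
  pattern excluded by \<open>weight_no_braid\<close>.\<close>
lemma weight_no_sandwich:
  assumes "is_weight q a" "q \<le> n" "1 \<le> p" "p < m" "Suc m \<le> q"
    and "\<And>r. p < r \<Longrightarrow> r < m \<Longrightarrow> \<bar>a r - a p\<bar> \<noteq> 1"
    and "a (Suc m) = a p" "\<bar>a m - a p\<bar> = 1"
  shows False
  using assms
proof (induction "m - p" arbitrary: p a)
  case (Suc k)
  show ?case
  proof (cases "m = Suc p")
    case True
    then show ?thesis using weight_no_braid[of q a p] Suc.prems by auto
  next
    case False
    let ?b = "a(p := a (Suc p), Suc p := a p)"
    have "\<bar>a (Suc p) - a p\<bar> \<noteq> 1" using Suc.prems False by auto
    then have "is_weight q ?b" using Suc.prems by (intro weight_swap) auto
    moreover have "k = m - Suc p" using Suc.hyps(2) by simp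
    ultimately show ?thesis
      using Suc.hyps(1)[of "Suc p" ?b] Suc.prems False by auto
  qed
qed simp

text \<open>Between two consecutive occurrences of \<open>a\<close> both \<open>a + 1\<close> and \<open>a - 1\<close> must occur. The last
  occurrence is moved left as long as its neighbour differs from \<open>a \<plusminus> 1\<close>. Let \<open>b\<close> be the neighbour where this
  stops, and suppose that it is not the value sought. If \<open>b\<close> occurs a second time in the interval, then by induction
  both \<open>b + 1\<close> and \<open>b - 1\<close> occur between the two occurrences of \<open>b\<close>, and one of these is \<open>a\<close>, a
  contradiction. If it does not, the first occurrence of \<open>a\<close> can be moved right up to \<open>b\<close>.\<close>
lemma weight_repeat:
  assumes "is_weight q a" "q \<le> n" "1 \<le> p" "p < q" "a p = a q"
    and "\<And>r. p < r \<Longrightarrow> r < q \<Longrightarrow> a r \<noteq> a q"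
    and e: "\<bar>e\<bar> = 1"
  shows "\<exists>r. p < r \<and> r < q \<and> a r = a q + e"
  using assms
proof (induction q arbitrary: a p e rule: less_induct)
  case (less q)
  note prems = less.prems
  obtain k where q: "q = Suc k" using prems(4) by (cases q) auto
  have pk: "p < k"
  proof -
    have "p \<noteq> k" using weight_neq[OF prems(1,2,3)] prems(4,5) q by auto
    then show ?thesis using prems(4) q by simp
  qed
  show ?case
  proof (cases "\<bar>a k - a q\<bar> = 1")
    case False
    \<comment> \<open>move the last eigenvalue one place to the left\<close>
    let ?b = "a(k := a q, q := a k)"
    have "is_weight q ?b"
      using weight_swap[OF prems(1,2), of k] False pk q by (auto simp: abs_minus_commute)
    then have "is_weight k ?b" by (rule weight_mono) (use q in auto)
    then have "\<exists>r. p < r \<and> r < k \<and> ?b r = ?b k + e"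
      by (rule less.IH[rotated]) (use prems pk q in auto)
    then show ?thesis using q by auto
  next
    case True
    show ?thesis
    proof (cases "a k = a q + e")
      case False
      then have ke: "a k = a q - e" using True prems(7) by linarith
      show ?thesis
      proof (rule ccontr)
        assume none: "\<not> ?thesis"
        show False
        proof (cases "\<exists>r. p < r \<and> r < k \<and> a r = a k")
          case True
          \<comment> \<open>the occurrence of \<open>b = a k\<close> closest to \<open>k\<close>\<close>
          define r where "r = (GREATEST r. r < k \<and> a r = a k)"
          obtain r0 where r0: "p < r0" "r0 < k" "a r0 = a k" using True by blast
          have r: "r < k" "a r = a k" and "p < r"
            and r_max: "\<And>t. t < k \<Longrightarrow> a t = a k \<Longrightarrow> t \<le> r"
            using GreatestI_nat[of "\<lambda>r. r < k \<and> a r = a k" r0 k] r0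
              Greatest_le_nat[of "\<lambda>r. r < k \<and> a r = a k" _ k] unfolding r_def
            by (auto intro: less_le_trans)
          have "\<exists>t. r < t \<and> t < k \<and> a t = a k + e"
          proof (rule less.IH)
            show "is_weight k a" by (rule weight_mono[OF prems(1)]) (use q in auto)
            show "a t \<noteq> a k" if "r < t" "t < k" for t using r_max that by force
          qed (use q prems r \<open>p < r\<close> in auto)
          then obtain t where t: "r < t" "t < k" "a t = a k + e" by blast
          then have "a t \<noteq> a q" using prems(6)[of t] \<open>p < r\<close> q by auto
          then show False using t(3) ke by simp
        next
          case False
          have apart: "\<bar>a r - a p\<bar> \<noteq> 1" if r: "p < r" "r < k" for r
          proof -
            have "a r \<noteq> a q + e" "a r \<noteq> a q - e" using none False ke r q by auto
            then show ?thesis using prems(5,7) by linarith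
          qed
          show False
          proof (rule weight_no_sandwich[OF prems(1,2,3) pk])
            show "Suc k \<le> q" "a (Suc k) = a p" using q prems(5) by simp_all
            show "\<bar>a k - a p\<bar> = 1" using \<open>\<bar>a k - a q\<bar> = 1\<close> unfolding prems(5) .
          qed (rule apart)
        qed
      qed
    qed (use pk q in auto)
  qed
qed

text \<open>Some product of linear factors annihilates \<open>JM q\<close>. Its factors are removed one by one from the
  left of \<open>\<Prod>(x - a) F\<close>: were removing a factor \<open>x - b\<close> to leave a nonzero element \<open>z\<close>, then \<open>z\<close> would be a weight
  vector with last eigenvalue \<open>b\<close>. So \<open>b\<close> is one of the \<open>a\<close>, the element \<open>z\<close> is a multiple of
  \<open>x - b\<close>, and \<open>(x - b) z = 0\<close> forces \<open>z = 0\<close> by semisimplicity.\<close>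
theorem eigenvalue_bound:
  assumes q: "1 \<le> q" "q \<le> n" and F: "\<And>r. r \<in> {1..<q} \<Longrightarrow> JM r * F = of_int (c r) * F"
    and as: "\<And>b. is_weight q (c(q := b)) \<Longrightarrow> b \<in> set as"
  shows "lin_prod (JM q) as * F = 0"
proof -
  have "lin_prod (JM q) as * F = 0" if "lin_prod (JM q) bs * (lin_prod (JM q) as * F) = 0" for bs
    using that
  proof (induction bs)
    case (Cons b bs)
    define z where "z = lin_prod (JM q) bs * (lin_prod (JM q) as * F)"
    have eig: "(JM q - of_int b) * z = 0" using Cons.prems by (simp add: z_def mult.assoc)
    have "z = 0"
    proof (rule ccontr)
      assume "z \<noteq> 0"
      have z': "z = lin_prod (JM q) (bs @ as) * F" by (simp add: z_def mult.assoc)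
      have "JM r * z = of_int (c r) * z" if "r \<in> {1..<q}" for r
      proof -
        have "JM r * lin_prod (JM q) (bs @ as) = lin_prod (JM q) (bs @ as) * JM r"
          by (rule lin_prod_intertwine, rule JM_commute) (use that q in auto)
        then show ?thesis unfolding z' using F[OF that] by (intro eigen_left_commute)
      qed
      then have "is_weight q (c(q := b))"
        unfolding is_weight_def using \<open>z \<noteq> 0\<close> eig q
        by (intro exI[of _ z]) (auto simp: left_diff_distrib)
      then have b: "b \<in> set (bs @ as)" "b \<in> set as" using as by auto
      define y where "y = lin_prod (JM q) bs * (lin_prod (JM q) (remove1 b as) * F)"
      have "(JM q - of_int b) * lin_prod (JM q) bs = lin_prod (JM q) bs * (JM q - of_int b)"
        by (rule lin_prod_intertwine)
          (simp add: left_diff_distrib right_diff_distrib mult_of_int_commute[of b "JM q"])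
      from arg_cong[OF this, of "\<lambda>x. x * (lin_prod (JM q) (remove1 b as) * F)"]
      have zy: "z = (JM q - of_int b) * y"
        unfolding z_def y_def lin_prod_remove1[OF b(2)] by (simp only: mult.assoc)
      then have "(JM q - of_int b) * y = 0"
        using semisimple[of q b y] q eig by auto
      then show False using zy \<open>z \<noteq> 0\<close> by simp
    qed
    then show ?case using Cons.IH by (simp add: z_def)
  qed simp
  moreover obtain bs where "lin_prod (JM q) bs = 0"
    using JM_annihilated[of "q - 1"] q by auto
  ultimately show ?thesis by (metis mult_zero_left)
qed

end

section \<open>Contents of addable boxes\<close>

definition order_ideal :: "(nat \<times> nat) set \<Rightarrow> bool" where
  "order_ideal D \<longleftrightarrow> finite D \<and> (\<forall>(i, j)\<in>D. 1 \<le> i \<and> 1 \<le> j \<and> {1..i} \<times> {1..j} \<subseteq> D)"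

lemma order_idealD:
  assumes "order_ideal D" "(i, j) \<in> D"
  shows "1 \<le> i" "1 \<le> j" "1 \<le> i' \<Longrightarrow> i' \<le> i \<Longrightarrow> 1 \<le> j' \<Longrightarrow> j' \<le> j \<Longrightarrow> (i', j') \<in> D"
  using assms unfolding order_ideal_def by fastforce+

lemma order_idealI:
  assumes "finite D" "\<And>i j. (i, j) \<in> D \<Longrightarrow> 1 \<le> i \<and> 1 \<le> j"
    and "\<And>i j i' j'. (i, j) \<in> D \<Longrightarrow> 1 \<le> i' \<Longrightarrow> i' \<le> i \<Longrightarrow> 1 \<le> j' \<Longrightarrow> j' \<le> j \<Longrightarrow> (i', j') \<in> D"
  shows "order_ideal D"
  unfolding order_ideal_def
proof (intro conjI ballI, fact, clarify)
  fix i j assume "(i, j) \<in> D"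
  then show "1 \<le> i \<and> 1 \<le> j \<and> {1..i} \<times> {1..j} \<subseteq> D"
    using assms(2,3)[of i j] by (auto simp: subset_iff)
qed

lemma order_ideal_diagram:
  assumes "sorted_wrt (\<ge>) lam"
  shows "order_ideal (diagram lam)"
proof -
  have "diagram lam \<subseteq> (\<Union>i\<in>{1..length lam}. {i} \<times> {1..lam ! (i - 1)})"
    by (auto simp: diagram_def)
  then have "finite (diagram lam)" by (rule finite_subset) auto
  moreover have "lam ! (i - 1) \<le> lam ! (i' - 1)" if "1 \<le> i'" "i' \<le> i" "i \<le> length lam" for i i'
    using sorted_wrt_nth_less[OF assms, of "i' - 1" "i - 1"] that by (cases "i = i'") auto
  then have "(i', j') \<in> diagram lam"
    if "(i, j) \<in> diagram lam" "1 \<le> i'" "i' \<le> i" "1 \<le> j'" "j' \<le> j" for i j i' j'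
    using that unfolding diagram_def by (fastforce intro: order_trans)
  ultimately show ?thesis
    unfolding order_ideal_def by (auto simp: diagram_def)
qed

lemma initial_segment:
  assumes "finite S" "\<And>j. j \<in> S \<Longrightarrow> {1..j} \<subseteq> S" "0 \<notin> S"
  shows "S = {1..card S}"
proof (cases "S = {}")
  case False
  then have "{1..Max S} \<subseteq> S" using assms(1,2) Max_in by blast
  moreover have "j \<in> {1..Max S}" if "j \<in> S" for j
    using assms(1,3) that by (cases j) auto
  ultimately have "S = {1..Max S}" by blast
  then show ?thesis by (metis card_atLeastAtMost diff_Suc_1)
qed simp

text \<open>Order ideals are easier to extend by a box than lists of row lengths; the row lengths of an ideal are
  recovered by counting.\<close>
lemma is_diagram_iff: "is_diagram D \<longleftrightarrow> order_ideal D"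
proof
  assume "is_diagram D"
  then show "order_ideal D" by (auto simp: is_diagram_def partition_of_def order_ideal_diagram)
next
  assume D: "order_ideal D"
  define l where "l = card {i. (i, 1) \<in> D}"
  define r where "r i = card {j. (i, j) \<in> D}" for i
  have fin: "finite {i. (i, 1) \<in> D}" "finite {j. (i, j) \<in> D}" for i
  proof -
    have "finite D" using D by (simp add: order_ideal_def)
    then have "finite (fst ` D)" "finite (snd ` D)" by simp_all
    moreover have "{i. (i, 1) \<in> D} \<subseteq> fst ` D" "{j. (i, j) \<in> D} \<subseteq> snd ` D"
      by (auto intro: rev_image_eqI)
    ultimately show "finite {i. (i, 1) \<in> D}" "finite {j. (i, j) \<in> D}"
      by (blast intro: finite_subset)+
  qed
  have col: "{i. (i, 1) \<in> D} = {1..l}"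
    unfolding l_def
  proof (rule initial_segment)
    show "{1..i} \<subseteq> {i. (i, 1) \<in> D}" if "i \<in> {i. (i, 1) \<in> D}" for i
      using order_idealD(3)[OF D, of i 1 _ 1] that by auto
    show "0 \<notin> {i. (i, 1) \<in> D}" using order_idealD(1)[OF D, of 0 1] by auto
  qed (rule fin)
  have row: "{j. (i, j) \<in> D} = {1..r i}" for i
    unfolding r_def
  proof (rule initial_segment)
    show "{1..j} \<subseteq> {j. (i, j) \<in> D}" if "j \<in> {j. (i, j) \<in> D}" for j
      using order_idealD(1)[OF D, of i j] order_idealD(3)[OF D, of i j i] that by auto
    show "0 \<notin> {j. (i, j) \<in> D}" using order_idealD(2)[OF D, of i 0] by auto
  qed (rule fin)
  have col': "(i, 1) \<in> D \<longleftrightarrow> 1 \<le> i \<and> i \<le> l" for i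
    using col by (auto simp: set_eq_iff)
  have row': "(i, j) \<in> D \<longleftrightarrow> 1 \<le> j \<and> j \<le> r i" for i j
    using row[of i] by (auto simp: set_eq_iff)
  have mono: "r i' \<le> r i" if "1 \<le> i" "i \<le> i'" for i i'
  proof (cases "r i' = 0")
    case False
    then have "(i', r i') \<in> D" using row' by simp
    then have "(i, r i') \<in> D" using order_idealD(3)[OF D] that False by fastforce
    then show ?thesis using row' by simp
  qed simp
  define lam where "lam = map r [1..<Suc l]"
  have nth: "lam ! (i - 1) = r i" if "1 \<le> i" "i \<le> l" for i
    using that by (simp add: lam_def del: upt_Suc)
  have "sorted_wrt (\<ge>) lam"
    unfolding lam_def sorted_wrt_map by (rule sorted_wrt_mono_rel[OF _ sorted_wrt_upt]) (auto intro: mono)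
  moreover have "0 \<notin> set lam"
    using col' row'[of _ 1] by (force simp: lam_def)
  moreover have "(i, j) \<in> D \<longleftrightarrow> (i, j) \<in> diagram lam" for i j
  proof -
    have "(i, j) \<in> D \<Longrightarrow> (i, 1) \<in> D" using order_idealD[OF D] by blast
    then show ?thesis
      using nth row'[of i j] col'[of i] by (auto simp: diagram_def lam_def simp del: upt_Suc)
  qed
  then have "D = diagram lam" by auto
  ultimately show "is_diagram D" unfolding is_diagram_def partition_of_def by blast
qed

lemma order_ideal_insert:
  assumes D: "order_ideal D" and "1 \<le> i" "1 \<le> j"
    and up: "i = 1 \<or> (i - 1, j) \<in> D" and left: "j = 1 \<or> (i, j - 1) \<in> D"
  shows "order_ideal (insert (i, j) D)"
proof -
  have "(i', j') \<in> insert (i, j) D" if "1 \<le> i'" "i' \<le> i" "1 \<le> j'" "j' \<le> j" for i' j'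
  proof (cases "i' = i")
    case True
    then show ?thesis using that left order_idealD(3)[OF D, of i "j - 1" i j'] assms(2)
      by (cases "j' = j") auto
  next
    case False
    then show ?thesis using that up order_idealD(3)[OF D, of "i - 1" j i' j'] by auto
  qed
  note new = this
  show ?thesis
  proof (rule order_idealI)
    show "finite (insert (i, j) D)" using D by (simp add: order_ideal_def)
    show "1 \<le> i' \<and> 1 \<le> j'" if "(i', j') \<in> insert (i, j) D" for i' j'
      using that order_idealD(1,2)[OF D, of i' j'] assms(2,3) by auto
    show "(i'', j'') \<in> insert (i, j) D" if "(i', j') \<in> insert (i, j) D" "1 \<le> i''" "i'' \<le> i'" "1 \<le> j''" "j'' \<le> j'"
      for i' j' i'' j''
      using that order_idealD(3)[OF D, of i' j' i'' j''] new[of i'' j''] by auto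
  qed
qed

text \<open>The restriction of a standard tableau to the entries \<open>1, \<dots>, m\<close>. The shape is
  the image of \<open>U\<close> rather than a separate parameter, because it changes with \<open>m\<close>.\<close>
locale standard_filling =
  fixes U :: "nat \<Rightarrow> nat \<times> nat" and m :: nat
  assumes ideal: "order_ideal (U ` {1..m})"
    and inj: "inj_on U {1..m}"
    and increasing: "k \<in> {1..m} \<Longrightarrow> l \<in> {1..m} \<Longrightarrow>
      (fst (U k) = fst (U l) \<and> snd (U k) < snd (U l)) \<or>
      (snd (U k) = snd (U l) \<and> fst (U k) < fst (U l)) \<Longrightarrow> k < l"
begin

abbreviation content :: "nat \<Rightarrow> int" where "content k \<equiv> box_content (U k)"

text \<open>The corner in the row of the first box and the column of the second one links the two entries.\<close>
lemma increasing_both: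
  assumes "k \<in> {1..m}" "l \<in> {1..m}" "fst (U k) \<le> fst (U l)" "snd (U k) \<le> snd (U l)"
  shows "k \<le> l"
proof -
  have "(fst (U l), snd (U l)) \<in> U ` {1..m}" "(fst (U k), snd (U k)) \<in> U ` {1..m}" using assms by auto
  then have "(fst (U k), snd (U l)) \<in> U ` {1..m}"
    using order_idealD[OF ideal] assms(3,4) by blast
  then obtain t where t: "t \<in> {1..m}" "U t = (fst (U k), snd (U l))" by auto
  have "k \<le> t"
    using increasing[OF assms(1) t(1)] t inj_onD[OF inj, of k t] assms
    by (cases "snd (U k) = snd (U l)") (auto simp: prod_eq_iff)
  moreover have "t \<le> l"
    using increasing[OF t(1) assms(2)] t inj_onD[OF inj, of t l] assms
    by (cases "fst (U k) = fst (U l)") (auto simp: prod_eq_iff)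
  ultimately show ?thesis by simp
qed

text \<open>The hypotheses are the local rules for the last eigenvalue \<open>x\<close> of a weight that extends the contents. If
  \<open>x\<close> is a content already, let \<open>(i, j)\<close> be the last box on its diagonal. The entries with contents
  \<open>x \<plusminus> 1\<close> that come later cannot lie above and to the left of this box, so \<open>(i, j + 1)\<close> and \<open>(i + 1, j)\<close> are filled and
  \<open>(i + 1, j + 1)\<close> is addable. If \<open>x\<close> is new, the neighbouring content \<open>x \<plusminus> 1\<close> occurs; it
  lies between \<open>0\<close> and \<open>x\<close>, since all boxes of the first row or column up to it are filled, and the addable
  box is the next one in the first row or the first column.\<close>
lemma addable_box:
  assumes none: "m = 0 \<Longrightarrow> x = 0"
    and neighbour: "m \<ge> 1 \<Longrightarrow> \<exists>p\<in>{1..m}. \<bar>content p - x\<bar> = 1"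
    and repeat: "\<And>p e. p \<in> {1..m} \<Longrightarrow> content p = x \<Longrightarrow> (\<And>r. p < r \<Longrightarrow> r \<le> m \<Longrightarrow> content r \<noteq> x) \<Longrightarrow> \<bar>e\<bar> = 1
      \<Longrightarrow> \<exists>r. p < r \<and> r \<le> m \<and> content r = x + e"
  shows "\<exists>b. b \<notin> U ` {1..m} \<and> order_ideal (insert b (U ` {1..m})) \<and> box_content b = x"
proof (cases "\<exists>p\<in>{1..m}. content p = x")
  case False
  let ?D = "U ` {1..m}"
  have out: "(i, j) \<notin> ?D" if "int j - int i = x" for i j
  proof
    assume "(i, j) \<in> ?D"
    then obtain p where "p \<in> {1..m}" "U p = (i, j)" by auto
    moreover have "content p = x" using calculation that by (simp add: box_content_def)
    ultimately show False using False by blast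
  qed
  show ?thesis
  proof (cases "m = 0")
    case True
    then show ?thesis using none by (intro exI[of _ "(1, 1)"]) (auto simp: order_ideal_def box_content_def)
  next
    case m: False
    then obtain p where p: "p \<in> {1..m}" "\<bar>content p - x\<bar> = 1" using neighbour by auto
    obtain i j where ij: "U p = (i, j)" by fastforce
    then have D: "(i, j) \<in> ?D" using p(1) by (metis image_eqI)
    note down = order_idealD[OF ideal D]
    have cij: "\<bar>int j - int i - x\<bar> = 1" using p(2) ij by (simp add: box_content_def)
    have "(1, 1) \<in> ?D" using down by auto
    then have "x \<noteq> 0" using out[of 1 1] by auto
    then consider "x > 0" | "x < 0" by linarith
    then show ?thesis
    proof cases
      case 1
      have "\<not> nat x + 1 \<le> j" using out[of "nat x + 1" 1] down(3)[of 1 "nat x + 1"] down(1) 1 by auto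
      then have "j = nat x" using cij down(1,2) 1 by linarith
      then have "(1, nat x) \<in> ?D" using down by auto
      then show ?thesis using 1 out[of "nat x + 1" 1]
        by (intro exI[of _ "(1, nat x + 1)"] conjI order_ideal_insert[OF ideal]) (auto simp: box_content_def)
    next
      case 2
      have "\<not> nat (- x) + 1 \<le> i" using out[of 1 "nat (- x) + 1"] down(3)[of "nat (- x) + 1" 1] down(2) 2 by auto
      then have "i = nat (- x)" using cij down(1,2) 2 by linarith
      then have "(nat (- x), 1) \<in> ?D" using down by auto
      then show ?thesis using 2 out[of 1 "nat (- x) + 1"]
        by (intro exI[of _ "(nat (- x) + 1, 1)"] conjI order_ideal_insert[OF ideal]) (auto simp: box_content_def)
    qed
  qed
next
  case True
  let ?D = "U ` {1..m}"
  define p where "p = (GREATEST p. p \<in> {1..m} \<and> content p = x)"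
  have p: "p \<in> {1..m}" "content p = x" and last: "\<And>r. r \<in> {1..m} \<Longrightarrow> content r = x \<Longrightarrow> r \<le> p"
  proof -
    obtain p0 where p0: "p0 \<in> {1..m} \<and> content p0 = x" using True by blast
    show "p \<in> {1..m}" "content p = x"
      unfolding p_def using GreatestI_nat[of "\<lambda>p. p \<in> {1..m} \<and> content p = x" p0 m, OF p0] by auto
    show "r \<le> p" if "r \<in> {1..m}" "content r = x" for r
      unfolding p_def using that by (intro Greatest_le_nat[of _ _ m]) auto
  qed
  obtain i j where ij: "U p = (i, j)" by fastforce
  have x: "x = int j - int i" using p(2) ij by (simp add: box_content_def)
  have ij1: "1 \<le> i" "1 \<le> j" using order_idealD[OF ideal, of i j] p(1) ij by (metis image_eqI)+
  have later: "\<exists>r\<in>{1..m}. p < r \<and> content r = x + e" if e: "\<bar>e\<bar> = 1" for e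
  proof -
    have "content r \<noteq> x" if "p < r" "r \<le> m" for r using last[of r] that p(1) by auto
    then obtain r where "p < r" "r \<le> m" "content r = x + e" using repeat[OF p _ e] by blast
    then show ?thesis using p(1) by auto
  qed
  have right: "(i, j + 1) \<in> ?D"
  proof -
    obtain r where r: "r \<in> {1..m}" "p < r" "content r = x + 1" using later[of 1] by auto
    obtain i' j' where ij': "U r = (i', j')" by fastforce
    have "int j' - int i' = int j - int i + 1" using r(3) ij' x by (simp add: box_content_def)
    moreover have "\<not> (i' \<le> i \<and> j' \<le> j)" using increasing_both[OF r(1) p(1)] ij ij' r(2) by auto
    ultimately have "i \<le> i'" "j + 1 \<le> j'" by linarith+
    moreover have "(i', j') \<in> ?D" using r(1) ij' by (metis image_eqI)
    ultimately show ?thesis using order_idealD(3)[OF ideal, of i' j' i "j + 1"] ij1 by simp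
  qed
  have below: "(i + 1, j) \<in> ?D"
  proof -
    obtain r where r: "r \<in> {1..m}" "p < r" "content r = x - 1" using later[of "- 1"] by auto
    obtain i' j' where ij': "U r = (i', j')" by fastforce
    have "int j' - int i' = int j - int i - 1" using r(3) ij' x by (simp add: box_content_def)
    moreover have "\<not> (i' \<le> i \<and> j' \<le> j)" using increasing_both[OF r(1) p(1)] ij ij' r(2) by auto
    ultimately have "i + 1 \<le> i'" "j \<le> j'" by linarith+
    moreover have "(i', j') \<in> ?D" using r(1) ij' by (metis image_eqI)
    ultimately show ?thesis using order_idealD(3)[OF ideal, of i' j' "i + 1" j] ij1 by simp
  qed
  have "(i + 1, j + 1) \<notin> ?D"
  proof
    assume "(i + 1, j + 1) \<in> ?D"
    then obtain t where t: "t \<in> {1..m}" "U t = (i + 1, j + 1)" by auto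
    have "t \<le> p" by (rule last) (use t x in \<open>auto simp: box_content_def\<close>)
    moreover have "p \<le> t" by (rule increasing_both) (use t p ij in auto)
    ultimately show False using t ij by auto
  qed
  moreover have "order_ideal (insert (i + 1, j + 1) ?D)"
    by (rule order_ideal_insert[OF ideal]) (use right below in auto)
  ultimately show ?thesis using x by (intro exI[of _ "(i + 1, j + 1)"]) (auto simp: box_content_def)
qed

end

lemma standard_filling_of_tableau:
  assumes "partition_of n lam" "standard_tableau lam U" "m \<le> n"
  shows "standard_filling U m"
proof -
  have n: "sum_list lam = n" and sorted: "sorted_wrt (\<ge>) lam" using assms(1) by (auto simp: partition_of_def)
  have bij: "bij_betw U {1..n} (diagram lam)" and inc: "\<And>k l. k \<in> {1..n} \<Longrightarrow> l \<in> {1..n} \<Longrightarrow>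
      (fst (U k) = fst (U l) \<and> snd (U k) < snd (U l)) \<or>
      (snd (U k) = snd (U l) \<and> fst (U k) < fst (U l)) \<Longrightarrow> k < l"
    using assms(2) unfolding standard_tableau_def n by blast+
  have full: "standard_filling U n"
    using bij inc order_ideal_diagram[OF sorted] by unfold_locales (auto simp: bij_betw_def)
  show ?thesis
  proof
    show "inj_on U {1..m}" using bij assms(3) by (auto simp: bij_betw_def intro: inj_on_subset)
    show "k < l" if "k \<in> {1..m}" "l \<in> {1..m}"
      "(fst (U k) = fst (U l) \<and> snd (U k) < snd (U l)) \<or>
      (snd (U k) = snd (U l) \<and> fst (U k) < fst (U l))" for k l
      using inc that assms(3) by auto
    have D: "order_ideal (U ` {1..n})" using full by (rule standard_filling.ideal)
    have down: "(i', j') \<in> U ` {1..m}" if k: "k \<in> {1..m}" and "U k = (i, j)" "1 \<le> i'" "i' \<le> i" "1 \<le> j'" "j' \<le> j" for k i j i' j'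
    proof -
      have kn: "k \<in> {1..n}" using k assms(3) by auto
      then have "(i, j) \<in> U ` {1..n}" using that by (metis image_eqI)
      then have "(i', j') \<in> U ` {1..n}" using order_idealD(3)[OF D] that by blast
      then obtain l where l: "l \<in> {1..n}" "U l = (i', j')" by auto
      then have "l \<le> k" using standard_filling.increasing_both[OF full l(1) kn] that by auto
      then show ?thesis using l k by force
    qed
    show "order_ideal (U ` {1..m})"
    proof (rule order_idealI)
      show "1 \<le> i \<and> 1 \<le> j" if "(i, j) \<in> U ` {1..m}" for i j
        using order_idealD(1,2)[OF D, of i j] that assms(3) by auto
      show "(i', j') \<in> U ` {1..m}" if ij: "(i, j) \<in> U ` {1..m}" "1 \<le> i'" "i' \<le> i" "1 \<le> j'" "j' \<le> j" for i j i' j'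
      proof -
        obtain k where "k \<in> {1..m}" "U k = (i, j)" using ij(1) by auto
        then show ?thesis using down ij(2-) by blast
      qed
    qed simp
  qed
qed

text \<open>Finiteness is essential: \<open>sorted_list_of_set\<close> yields the empty list for an infinite set.\<close>
lemma finite_other_contents: "finite (other_contents U n)"
proof -
  have "finite {b. order_ideal (insert b D)}" if "finite D" for D :: "(nat \<times> nat) set"
  proof -
    define M where "M = Suc (card D)"
    have "b \<in> {..M} \<times> {..M}" if b: "order_ideal (insert b D)" for b
    proof -
      obtain i j where ij: "b = (i, j)" by fastforce
      have ge: "1 \<le> i" "1 \<le> j" using order_idealD[OF b, of i j] ij by auto
      have c: "card (insert b D) \<le> M" unfolding M_def using card_insert_le_m1[of "Suc (card D)"] \<open>finite D\<close>
        by (simp add: card_insert_if)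
      have "{1..i} \<times> {1..j} \<subseteq> insert b D" using b ij unfolding order_ideal_def by auto
      then have "i * j \<le> M"
        using card_mono[of "insert b D" "{1..i} \<times> {1..j}"] c \<open>finite D\<close> by (simp add: card_cartesian_product)
      moreover have "i \<le> i * j" "j \<le> i * j" using ge by simp_all
      ultimately have "i \<le> M" "j \<le> M" by linarith+
      then show ?thesis using ij by simp
    qed
    then have "{b. order_ideal (insert b D)} \<subseteq> {..M} \<times> {..M}" by blast
    then show ?thesis by (rule finite_subset) simp
  qed
  then have "finite {b. order_ideal (insert b (U ` {1..<n}))}" by simp
  then have "finite (box_content ` {b. order_ideal (insert b (U ` {1..<n}))})" by (rule finite_imageI)
  then show ?thesis
    by (rule finite_subset[rotated]) (auto simp: other_contents_def is_diagram_iff)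
qed

text \<open>The content of \<open>U (m + 1)\<close> is listed separately because \<open>other_contents\<close> leaves out that box.\<close>
lemma (in semisimple_transposition_rep) weight_content:
  assumes U: "standard_filling U m" and w: "is_weight (Suc m) ((\<lambda>k. box_content (U k))(Suc m := x))"
    and m: "Suc m \<le> n"
  shows "x \<in> insert (box_content (U (Suc m))) (other_contents U (Suc m))"
proof -
  interpret standard_filling U m by fact
  let ?a = "(\<lambda>k. box_content (U k))(Suc m := x)"
  have "\<exists>b. b \<notin> U ` {1..m} \<and> order_ideal (insert b (U ` {1..m})) \<and> box_content b = x"
  proof (rule addable_box)
    show "x = 0" if "m = 0" using weight_1[OF w] that by simp
    show "\<exists>p\<in>{1..m}. \<bar>content p - x\<bar> = 1" if "m \<ge> 1"
      using weight_new_neighbour[OF w] that m by (force split: if_splits)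
    fix p e assume *: "p \<in> {1..m}" "content p = x" "\<And>r. p < r \<Longrightarrow> r \<le> m \<Longrightarrow> content r \<noteq> x" "\<bar>e :: int\<bar> = 1"
    have "\<exists>r. p < r \<and> r < Suc m \<and> ?a r = ?a (Suc m) + e"
      by (rule weight_repeat[OF w m]) (use * in auto)
    then show "\<exists>r. p < r \<and> r \<le> m \<and> content r = x + e" by auto
  qed
  then obtain b where b: "b \<notin> U ` {1..m}" "order_ideal (insert b (U ` {1..m}))" "box_content b = x" by blast
  have "{1..<Suc m} = {1..m}" by auto
  then have other: "other_contents U (Suc m) = {box_content b | b. b \<notin> U ` {1..m} \<and> b \<noteq> U (Suc m) \<and>
      order_ideal (insert b (U ` {1..m}))}"
    unfolding other_contents_def is_diagram_iff by (simp only:)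
  show ?thesis
  proof (cases "b = U (Suc m)")
    case False
    then have "x \<in> other_contents U (Suc m)" unfolding other using b by blast
    then show ?thesis by simp
  qed (use b(3) in simp)
qed

section \<open>Tensor space\<close>

text \<open>The matrix sending the basis vector \<open>e\<^sub>v\<close> to \<open>e\<^sub>w\<close> if \<open>f v = Some w\<close>, and to \<open>0\<close> if \<open>f v = None\<close>. Matrix
  units in a factor and permutations of factors are of this form, and products of such matrices become
  compositions of partial maps.\<close>
definition basis_map :: "('i \<Rightarrow> 'i option) \<Rightarrow> (complex, 'i::finite) endo" where
  "basis_map f = Endo (\<chi> w v. if f v = Some w then 1 else 0)"

lemma mat_of_basis_map: "mat_of (basis_map f) $ w $ v = (if f v = Some w then 1 else 0)"
  by (simp add: basis_map_def Endo_inverse)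

lemma endo_eqI: "(\<And>i j. mat_of x $ i $ j = mat_of y $ i $ j) \<Longrightarrow> x = y"
  by (metis mat_of_inject vec_eq_iff)

lemma basis_map_mult: "basis_map f * basis_map g = basis_map (\<lambda>v. Option.bind (g v) f)"
proof (rule endo_eqI)
  fix w v
  have "mat_of (basis_map f * basis_map g) $ w $ v =
      (\<Sum>x\<in>UNIV. if g v = Some x then if f x = Some w then 1 else 0 else 0)"
    by (simp add: times_endo.rep_eq matrix_matrix_mult_def mat_of_basis_map if_distrib cong: if_cong)
       (rule sum.cong, auto)
  also have "\<dots> = (if Option.bind (g v) f = Some w then 1 else 0)"
    by (cases "g v") simp_all
  finally show "mat_of (basis_map f * basis_map g) $ w $ v = mat_of (basis_map (\<lambda>v. Option.bind (g v) f)) $ w $ v"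
    by (simp add: mat_of_basis_map)
qed

lemma basis_map_Some: "basis_map Some = 1"
  by (rule endo_eqI) (auto simp: mat_of_basis_map one_endo.rep_eq mat_def)

definition vec_upd :: "'a^'n::finite \<Rightarrow> 'n \<Rightarrow> 'a \<Rightarrow> 'a^'n" where
  "vec_upd v m i = (\<chi> l. if l = m then i else v $ l)"

lemma vec_upd_nth [simp]: "vec_upd v m i $ l = (if l = m then i else v $ l)"
  by (simp add: vec_upd_def)

definition unit_at :: "'n::finite \<Rightarrow> 'N::finite \<Rightarrow> 'N \<Rightarrow> (complex, 'N^'n) endo" where
  "unit_at m i j = Endo (in_factor m (matrix_unit i j))"

lemma vec_upd_eq_iff: "vec_upd v m i = w \<longleftrightarrow> w $ m = i \<and> (\<forall>l. l \<noteq> m \<longrightarrow> w $ l = v $ l)"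
proof
  assume "vec_upd v m i = w"
  then show "w $ m = i \<and> (\<forall>l. l \<noteq> m \<longrightarrow> w $ l = v $ l)" by (auto simp flip: \<open>vec_upd v m i = w\<close>)
next
  assume "w $ m = i \<and> (\<forall>l. l \<noteq> m \<longrightarrow> w $ l = v $ l)"
  then have "vec_upd v m i $ l = w $ l" for l by simp
  then show "vec_upd v m i = w" by (simp add: vec_eq_iff)
qed

lemma unit_at_eq: "unit_at m i j = basis_map (\<lambda>v. if v $ m = j then Some (vec_upd v m i) else None)"
proof (rule endo_eqI)
  fix w v :: "'a^'b"
  have "mat_of (unit_at m i j) $ w $ v = (if v $ m = j \<and> vec_upd v m i = w then 1 else 0)"
    unfolding vec_upd_eq_iff by (simp add: unit_at_def Endo_inverse in_factor_def matrix_unit_def) blast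
  then show "mat_of (unit_at m i j) $ w $ v =
      mat_of (basis_map (\<lambda>v. if v $ m = j then Some (vec_upd v m i) else None)) $ w $ v"
    by (simp add: mat_of_basis_map)
qed

lemma basis_map_None: "basis_map (\<lambda>v. None) = 0"
  by (rule endo_eqI) (simp add: mat_of_basis_map zero_endo.rep_eq)

lemma unit_at_mult: "unit_at m i j * unit_at m k l = (if j = k then unit_at m i l else 0)"
proof -
  have "vec_upd (vec_upd v m a) m b = vec_upd v m b" for v :: "'a^'b" and a b
    by (simp add: vec_eq_iff)
  then have "unit_at m i j * unit_at m k l =
      basis_map (\<lambda>v. if v $ m = l \<and> k = j then Some (vec_upd v m i) else None)"
    unfolding unit_at_eq basis_map_mult by (intro arg_cong[of _ _ basis_map] ext) simp
  then show ?thesis by (cases "j = k") (simp_all add: unit_at_eq basis_map_None)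
qed

lemma unit_at_commute:
  assumes "m \<noteq> m'"
  shows "unit_at m i j * unit_at m' k l = unit_at m' k l * unit_at m i j"
proof -
  have "vec_upd (vec_upd v m' k) m i = vec_upd (vec_upd v m i) m' k" for v :: "'b^'a"
    using assms by (simp add: vec_eq_iff)
  then show ?thesis
    using assms unfolding unit_at_eq basis_map_mult by (intro arg_cong[of _ _ basis_map] ext) simp
qed

lemma gl_family_unit_at: "gl_family (unit_at m)"
  by (auto simp: gl_family_def unit_at_mult)

text \<open>The action of \<open>gl\<^sub>N\<close> on a tensor product: only the terms with both matrix units in the same
  factor contribute to the commutator.\<close>
lemma gl_family_total:
  fixes S :: "'n::finite set"
  shows "gl_family (\<lambda>(i::'N::finite) j. \<Sum>m\<in>S. unit_at m i j)"
proof -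
  have "(\<Sum>m\<in>S. unit_at m i j) * (\<Sum>m\<in>S. unit_at m k l) - (\<Sum>m\<in>S. unit_at m k l) * (\<Sum>m\<in>S. unit_at m i j)
     = (\<Sum>m\<in>S. (if k = j then unit_at m i l else 0) - (if i = l then unit_at m k j else 0))" for i j k l :: 'N
  proof -
    have g: "unit_at m i j * unit_at m k l - unit_at m k l * unit_at m i j =
      (if k = j then unit_at m i l else 0) - (if i = l then unit_at m k j else 0)" for m :: 'n
      using gl_family_unit_at[of m] unfolding gl_family_def by blast
    have "(\<Sum>m'\<in>S. unit_at m i j * unit_at m' k l - unit_at m' k l * unit_at m i j)
      = (\<Sum>m'\<in>S. if m' = m then unit_at m i j * unit_at m k l - unit_at m k l * unit_at m i j else 0)" for m
      by (rule sum.cong) (auto simp: unit_at_commute)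
    then have "(\<Sum>m\<in>S. \<Sum>m'\<in>S. unit_at m i j * unit_at m' k l - unit_at m' k l * unit_at m i j)
      = (\<Sum>m\<in>S. (if k = j then unit_at m i l else 0) - (if i = l then unit_at m k j else 0))"
      by (intro sum.cong refl) (simp add: g)
    then show ?thesis
      by (simp add: sum_product sum_subtractf sum.swap[of "\<lambda>m m'. unit_at m k l * unit_at m' i j"])
  qed
  then show ?thesis
    unfolding gl_family_def by (simp add: sum_subtractf)
qed

definition symmetric_group :: "nat \<Rightarrow> nat perm set" where
  "symmetric_group n = {s. \<forall>k. k \<notin> {1..n} \<longrightarrow> Perm.apply s k = k}"

lemma symmetric_group_apply:
  assumes "s \<in> symmetric_group n" "k \<in> {1..n}"
  shows "Perm.apply s k \<in> {1..n}"
proof (rule ccontr)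
  assume *: "Perm.apply s k \<notin> {1..n}"
  then have "Perm.apply s (Perm.apply s k) = Perm.apply s k"
    using assms(1) by (auto simp: symmetric_group_def)
  then have "Perm.apply s k = k" by (metis apply_inj)
  then show False using * assms(2) by simp
qed

lemma symmetric_group_mult: "s \<in> symmetric_group n \<Longrightarrow> t \<in> symmetric_group n \<Longrightarrow> s * t \<in> symmetric_group n"
  by (simp add: symmetric_group_def apply_times)

lemma symmetric_group_inverse:
  assumes "s \<in> symmetric_group n"
  shows "inverse s \<in> symmetric_group n"
proof -
  have "Perm.apply (inverse s) k = k" if "k \<notin> {1..n}" for k
  proof -
    have "Perm.apply (inverse s) (Perm.apply s k) = k" by (simp add: apply_sequence)
    then show ?thesis using assms that by (simp add: symmetric_group_def)
  qed
  then show ?thesis by (simp add: symmetric_group_def)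
qed

lemma symmetric_group_swap: "i \<in> {1..n} \<Longrightarrow> j \<in> {1..n} \<Longrightarrow> Perm.swap i j \<in> symmetric_group n"
  by (auto simp: symmetric_group_def)

lemma perm_apply_inverse [simp]:
  "Perm.apply (inverse s) (Perm.apply s k) = k" "Perm.apply s (Perm.apply (inverse s) k) = k"
  by (simp_all add: apply_sequence)

lemma apply_swap: "Perm.apply (Perm.swap i j) k = (if k = i then j else if k = j then i else k)"
  by auto

text \<open>The parameter \<open>N_type\<close> only fixes the type of the index set of \<open>\<complex>\<^sup>N\<close>.\<close>
locale tensor_positions =
  fixes n :: nat and pos :: "nat \<Rightarrow> 'n::finite" and N_type :: "'N::finite itself"
  assumes pos: "bij_betw pos {1..n} UNIV" and n: "n = CARD('n)"
begin

definition idx :: "'n \<Rightarrow> nat" where "idx = inv_into {1..n} pos"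

lemma pos_idx [simp]: "pos (idx l) = l" and idx_range: "idx l \<in> {1..n}"
  using bij_betw_inv_into_right[OF pos, of l] bij_betw_inv_into[OF pos]
  unfolding idx_def by (auto simp: bij_betw_def)

lemma idx_pos [simp]: "k \<in> {1..n} \<Longrightarrow> idx (pos k) = k"
  unfolding idx_def by (rule bij_betw_inv_into_left[OF pos])

definition act :: "nat perm \<Rightarrow> 'N^'n \<Rightarrow> 'N^'n" where
  "act s v = (\<chi> l. v $ pos (Perm.apply (inverse s) (idx l)))"

definition PM :: "nat perm \<Rightarrow> (complex, 'N^'n) endo" where
  "PM s = Endo (perm_mat pos s)"

lemma PM_eq:
  assumes "s \<in> symmetric_group n"
  shows "PM s = basis_map (\<lambda>v. Some (act s v))"
proof (rule endo_eqI)
  fix w v :: "'N^'n"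
  have "(\<forall>k\<in>{1..n}. w $ pos (Perm.apply s k) = v $ pos k) \<longleftrightarrow> act s v = w"
  proof
    assume *: "\<forall>k\<in>{1..n}. w $ pos (Perm.apply s k) = v $ pos k"
    have "v $ pos (Perm.apply (inverse s) (idx l)) = w $ l" for l
      using bspec[OF *, of "Perm.apply (inverse s) (idx l)"]
        symmetric_group_apply[OF symmetric_group_inverse[OF assms] idx_range, of l] by simp
    then show "act s v = w" by (simp add: act_def vec_eq_iff)
  next
    assume "act s v = w"
    then show "\<forall>k\<in>{1..n}. w $ pos (Perm.apply s k) = v $ pos k"
      using symmetric_group_apply[OF assms] by (auto simp: act_def)
  qed
  then show "mat_of (PM s) $ w $ v = mat_of (basis_map (\<lambda>v. Some (act s v))) $ w $ v"
    by (simp add: PM_def Endo_inverse perm_mat_def mat_of_basis_map n[symmetric])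
qed

lemma act_mult:
  assumes "s \<in> symmetric_group n" "t \<in> symmetric_group n"
  shows "act (s * t) v = act s (act t v)"
proof -
  have "inverse (s * t) = inverse t * inverse s" by (rule perm.inverse_distrib_swap)
  then show ?thesis
    using symmetric_group_apply[OF symmetric_group_inverse[OF assms(1)] idx_range]
    by (simp add: act_def vec_eq_iff apply_times)
qed

lemma PM_mult:
  assumes "s \<in> symmetric_group n" "t \<in> symmetric_group n"
  shows "PM (s * t) = PM s * PM t"
  using assms by (simp add: PM_eq symmetric_group_mult basis_map_mult act_mult)

lemma PM_1: "PM 1 = 1"
proof -
  have "act 1 v = v" for v by (simp add: act_def vec_eq_iff)
  moreover have "1 \<in> symmetric_group n" by (simp add: symmetric_group_def)
  ultimately show ?thesis by (simp add: PM_eq basis_map_Some)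
qed

lemma PM_unit_at:
  assumes s: "s \<in> symmetric_group n" and k: "k \<in> {1..n}"
  shows "PM s * unit_at (pos k) i j = unit_at (pos (Perm.apply s k)) i j * PM s"
proof -
  note sk = symmetric_group_apply[OF s k]
  have "act s v $ pos (Perm.apply s k) = v $ pos k" for v
    using sk by (simp add: act_def)
  moreover have "act s (vec_upd v (pos k) i) = vec_upd (act s v) (pos (Perm.apply s k)) i" for v
  proof -
    have "pos (Perm.apply (inverse s) (idx l)) = pos k \<longleftrightarrow> l = pos (Perm.apply s k)" for l
    proof
      assume "pos (Perm.apply (inverse s) (idx l)) = pos k"
      then have "idx (pos (Perm.apply (inverse s) (idx l))) = idx (pos k)" by simp
      then have "Perm.apply (inverse s) (idx l) = k"
        using k symmetric_group_apply[OF symmetric_group_inverse[OF s] idx_range, of l] by simp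
      then have "idx l = Perm.apply s k" by (metis perm_apply_inverse(2))
      then show "l = pos (Perm.apply s k)" by (metis pos_idx)
    qed (use sk in simp)
    then show ?thesis by (simp add: act_def vec_eq_iff)
  qed
  ultimately show ?thesis
    unfolding PM_eq[OF s] unit_at_eq basis_map_mult by (intro arg_cong[of _ _ basis_map] ext) simp
qed

text \<open>Permuting the tensor factors permutes the summands.\<close>
lemma PM_total:
  assumes s: "s \<in> symmetric_group n"
  shows "PM s * (\<Sum>m\<in>UNIV. unit_at m i j) = (\<Sum>m\<in>UNIV. unit_at m i j) * PM s"
proof -
  have bij: "bij_betw (\<lambda>l. pos (Perm.apply s (idx l))) UNIV UNIV"
  proof (rule bij_betw_byWitness[of _ "\<lambda>l. pos (Perm.apply (inverse s) (idx l))"])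
    show "\<forall>a\<in>UNIV. pos (Perm.apply (inverse s) (idx (pos (Perm.apply s (idx a))))) = a"
      using symmetric_group_apply[OF s idx_range] by simp
    show "\<forall>a\<in>UNIV. pos (Perm.apply s (idx (pos (Perm.apply (inverse s) (idx a))))) = a"
      using symmetric_group_apply[OF symmetric_group_inverse[OF s] idx_range] by simp
  qed auto
  have "PM s * (\<Sum>m\<in>UNIV. unit_at m i j) = (\<Sum>l\<in>UNIV. unit_at (pos (Perm.apply s (idx l))) i j * PM s)"
    unfolding sum_distrib_left using PM_unit_at[OF s idx_range] by (simp add: pos_idx)
  also have "\<dots> = (\<Sum>l\<in>UNIV. unit_at l i j * PM s)"
    by (rule sum.reindex_bij_betw[OF bij])
  finally show ?thesis by (simp add: sum_distrib_right)
qed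

text \<open>\<open>P\<^sub>0\<^sub>kP\<^sub>0\<^sub>l = P\<^sub>0\<^sub>lP\<^sub>k\<^sub>l\<close>, with the factor \<open>0\<close> written out.\<close>
lemma unit_at_exchange:
  assumes k: "k \<in> {1..n}" and l: "l \<in> {1..n}" and "k \<noteq> l"
  shows "(\<Sum>j\<in>UNIV. unit_at (pos k) j a * unit_at (pos l) b j) = unit_at (pos l) b a * PM (Perm.swap k l)"
proof (rule endo_eqI)
  fix w v :: "'N^'n"
  have neq: "pos k \<noteq> pos l" using assms idx_pos by metis
  have act: "act (Perm.swap k l) v $ m = (if m = pos k then v $ pos l else if m = pos l then v $ pos k else v $ m)" for m
  proof (cases "m = pos k \<or> m = pos l")
    case False
    then have "idx m \<noteq> k" "idx m \<noteq> l" by (metis pos_idx)+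
    then show ?thesis using False by (simp add: act_def)
  qed (use k l neq in \<open>auto simp: act_def\<close>)
  have "mat_of (unit_at (pos k) j a * unit_at (pos l) b j) $ w $ v =
      (if v $ pos l = j then if v $ pos k = a \<and> vec_upd (vec_upd v (pos l) b) (pos k) j = w then 1 else 0 else 0)" for j
    using neq unfolding unit_at_eq basis_map_mult mat_of_basis_map by auto
  then have "mat_of (\<Sum>j\<in>UNIV. unit_at (pos k) j a * unit_at (pos l) b j) $ w $ v =
      (if v $ pos k = a \<and> vec_upd (vec_upd v (pos l) b) (pos k) (v $ pos l) = w then 1 else 0)"
    by (simp add: mat_of_sum)
  moreover have "vec_upd (act (Perm.swap k l) v) (pos l) b = vec_upd (vec_upd v (pos l) b) (pos k) (v $ pos l)"
    using neq by (simp add: vec_eq_iff act)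
  ultimately show "mat_of (\<Sum>j\<in>UNIV. unit_at (pos k) j a * unit_at (pos l) b j) $ w $ v =
      mat_of (unit_at (pos l) b a * PM (Perm.swap k l)) $ w $ v"
    using neq act[of "pos l"]
    unfolding PM_eq[OF symmetric_group_swap[OF k l]] unit_at_eq basis_map_mult mat_of_basis_map by auto
qed

definition transp :: "nat \<Rightarrow> nat \<Rightarrow> (complex, 'N^'n) endo" where
  "transp i j = PM (Perm.swap i j)"

sublocale transposition_rep n transp
proof
  show "transp i j = transp j i" for i j by (simp add: transp_def swap_sym)
  have sw: "Perm.swap i j \<in> symmetric_group n" if "i \<in> {1..n}" "j \<in> {1..n}" for i j
    using that by (rule symmetric_group_swap)
  show "transp i j * transp i j = 1" if "i \<in> {1..n}" "j \<in> {1..n}" for i j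
  proof -
    show ?thesis using sw that by (simp add: transp_def PM_1 flip: PM_mult)
  qed
  show "transp i j * transp j k = transp i k * transp i j"
    if "i \<in> {1..n}" "j \<in> {1..n}" "k \<in> {1..n}" "distinct [i, j, k]" for i j k
  proof -
    have "Perm.swap i j * Perm.swap j k = Perm.swap i k * Perm.swap i j"
      by (rule perm_eqI) (use that(4) in \<open>auto simp: apply_times apply_swap\<close>)
    then show ?thesis using sw that by (simp add: transp_def flip: PM_mult)
  qed
  show "transp i j * transp k l = transp k l * transp i j"
    if "i \<in> {1..n}" "j \<in> {1..n}" "k \<in> {1..n}" "l \<in> {1..n}" "distinct [i, j, k, l]" for i j k l
  proof -
    have "Perm.swap i j * Perm.swap k l = Perm.swap k l * Perm.swap i j"
      by (rule perm_eqI) (use that(5) in \<open>auto simp: apply_times apply_swap\<close>)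
    then show ?thesis using sw that by (simp add: transp_def flip: PM_mult)
  qed
qed

end

definition real_symmetric :: "(complex, 'i::finite) endo \<Rightarrow> bool" where
  "real_symmetric x \<longleftrightarrow> (\<forall>i j. mat_of x $ i $ j = mat_of x $ j $ i \<and> mat_of x $ i $ j \<in> \<real>)"

lemma real_symmetric_diff: "real_symmetric x \<Longrightarrow> real_symmetric y \<Longrightarrow> real_symmetric (x - y)"
  by (simp add: real_symmetric_def minus_endo.rep_eq)

lemma real_symmetric_sum: "(\<And>a. a \<in> A \<Longrightarrow> real_symmetric (f a)) \<Longrightarrow> real_symmetric (sum f A)"
  by (induction A rule: infinite_finite_induct)
    (auto simp: real_symmetric_def zero_endo.rep_eq plus_endo.rep_eq)

lemma real_symmetric_of_int: "real_symmetric (of_int a)"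
proof -
  have "real_symmetric (of_nat k :: (complex, 'i::finite) endo)" for k
    by (induction k) (auto simp: real_symmetric_def zero_endo.rep_eq one_endo.rep_eq plus_endo.rep_eq mat_def)
  then show ?thesis
    by (cases a rule: int_cases2) (auto simp: real_symmetric_def uminus_endo.rep_eq)
qed

text \<open>With \<open>Y = AZ\<close> and \<open>A\<close> self-adjoint, \<open>Y\<^sup>*Y = Z\<^sup>*A\<^sup>2Z = 0\<close>, so \<open>Y = 0\<close>.\<close>
lemma real_symmetric_square_kernel:
  assumes A: "real_symmetric A" and 0: "A * (A * Z) = 0"
  shows "A * Z = 0"
proof (rule endo_eqI)
  fix i j
  define Y where "Y = A * Z"
  let ?a = "\<lambda>k l. mat_of A $ k $ l" and ?y = "\<lambda>k. mat_of Y $ k $ j" and ?z = "\<lambda>k. mat_of Z $ k $ j"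
  have a: "cnj (?a k l) = ?a l k" for k l
    using A unfolding real_symmetric_def by (metis Reals_cnj_iff)
  have y: "?y k = (\<Sum>l\<in>UNIV. ?a k l * ?z l)" for k
    by (simp add: Y_def times_endo.rep_eq matrix_matrix_mult_def)
  have ay: "(\<Sum>k\<in>UNIV. ?a l k * ?y k) = 0" for l
  proof -
    have "mat_of (A * Y) $ l $ j = 0" using 0 by (simp add: Y_def zero_endo.rep_eq)
    then show ?thesis by (simp add: times_endo.rep_eq matrix_matrix_mult_def)
  qed
  have "(\<Sum>k\<in>UNIV. cnj (?y k) * ?y k) = (\<Sum>k\<in>UNIV. \<Sum>l\<in>UNIV. cnj (?z l) * (?a l k * ?y k))"
    by (rule sum.cong[OF refl], subst (1) y) (simp add: a sum_distrib_left mult_ac)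
  also have "\<dots> = (\<Sum>l\<in>UNIV. cnj (?z l) * (\<Sum>k\<in>UNIV. ?a l k * ?y k))"
    by (subst sum.swap) (simp add: sum_distrib_left)
  also have "\<dots> = 0" by (simp add: ay)
  finally have "(\<Sum>k\<in>UNIV. cnj (?y k) * ?y k) = 0" .
  moreover have "complex_of_real (\<Sum>k\<in>UNIV. (cmod (?y k))\<^sup>2) = (\<Sum>k\<in>UNIV. cnj (?y k) * ?y k)"
    unfolding of_real_sum complex_norm_square by (rule sum.cong[OF refl], rule mult.commute)
  ultimately have "(\<Sum>k\<in>UNIV. (cmod (?y k))\<^sup>2) = 0"
    by (simp only: of_real_eq_0_iff)
  then have "cmod (?y i) ^ 2 = 0"
    by (subst (asm) sum_nonneg_eq_0_iff) auto
  then show "mat_of (A * Z) $ i $ j = mat_of 0 $ i $ j" by (simp add: Y_def zero_endo.rep_eq)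
qed

context tensor_positions
begin

lemma real_symmetric_transp:
  assumes "i \<in> {1..n}" "j \<in> {1..n}"
  shows "real_symmetric (transp i j)"
proof -
  have s: "Perm.swap i j \<in> symmetric_group n" using assms by (rule symmetric_group_swap)
  have "act (Perm.swap i j) (act (Perm.swap i j) v) = v" for v
    by (simp flip: act_mult[OF s s]) (simp add: act_def vec_eq_iff)
  then have "act (Perm.swap i j) v = w \<longleftrightarrow> act (Perm.swap i j) w = v" for v w by metis
  then show ?thesis
    unfolding transp_def PM_eq[OF s] real_symmetric_def mat_of_basis_map by auto
qed

sublocale semisimple_transposition_rep n transp
proof
  show "(JM r - of_int a) * z = 0" if "r \<in> {1..n}" "(JM r - of_int a) * ((JM r - of_int a) * z) = 0" for r a z
  proof (rule real_symmetric_square_kernel[OF _ that(2)])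
    show "real_symmetric (JM r - of_int a)"
      unfolding JM_def using that(1)
      by (intro real_symmetric_diff real_symmetric_sum real_symmetric_of_int real_symmetric_transp) auto
  qed
qed

definition alg :: "sym_algebra \<Rightarrow> (complex, 'N^'n) endo" where
  "alg = lin PM"

lemma mat_of_alg: "mat_of (alg x) = sym_algebra_mat pos x"
  by (simp add: alg_def lin_def sym_algebra_mat_def mat_of_sum cscale_endo.rep_eq PM_def Endo_inverse
      scalar_mat_def cscale_complex_def vec_eq_iff)

definition supported :: "sym_algebra \<Rightarrow> bool" where
  "supported x \<longleftrightarrow> Poly_Mapping.keys x \<subseteq> symmetric_group n"

lemma alg_mult: "supported x \<Longrightarrow> supported y \<Longrightarrow> alg (x * y) = alg x * alg y"
  unfolding alg_def supported_def by (rule lin_mult) (auto simp: plus_perm_def PM_mult)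

lemma supported_mult: "supported x \<Longrightarrow> supported y \<Longrightarrow> supported (x * y)"
  unfolding supported_def using keys_mult[of x y] symmetric_group_mult by (fastforce simp: plus_perm_def)

lemma supported_diff: "supported x \<Longrightarrow> supported y \<Longrightarrow> supported (x - y)"
  unfolding supported_def using keys_diff[of x y] by blast

lemma supported_single: "s \<in> symmetric_group n \<Longrightarrow> supported (Poly_Mapping.single s c)"
  by (simp add: supported_def)

lemma supported_const: "supported (sym_const c)"
  unfolding sym_const_def by (rule supported_single) (simp add: symmetric_group_def zero_perm_def)

lemma supported_jucys_murphy: "r \<le> n \<Longrightarrow> supported (jucys_murphy r)"
proof -
  assume r: "r \<le> n"
  have supported_sum: "supported (sum f A)" if "\<And>a. a \<in> A \<Longrightarrow> supported (f a)" for f :: "nat \<Rightarrow> sym_algebra" and A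
    using that
  proof (induction A rule: infinite_finite_induct)
    case (insert x F)
    then show ?case using keys_add[of "f x" "sum f F"] unfolding supported_def by auto
  qed (simp_all add: supported_def)
  show ?thesis unfolding jucys_murphy_def
    by (intro supported_sum supported_single symmetric_group_swap) (use r in auto)
qed

lemma alg_const: "alg (sym_const c) = c *\<^sub>C 1"
proof -
  have "PM 0 = 1" using PM_1 by (simp add: zero_perm_def)
  then show ?thesis by (simp add: alg_def sym_const_def)
qed

lemma alg_diff: "alg (x - y) = alg x - alg y"
  using lin_add[of PM "x - y" y] by (simp add: alg_def)

lemma alg_1: "alg 1 = 1" and supported_1: "supported 1"
  using alg_const[of 1] supported_const[of 1] by (simp_all add: sym_const_def single_one cscale_one)

lemma alg_jucys_murphy: "alg (jucys_murphy r) = JM r"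
  by (simp add: alg_def jucys_murphy_def JM_def lin_sum cscale_one transp_def)

lemma alg_lin_prod:
  assumes "r \<le> n"
  shows "alg (\<Prod>a\<leftarrow>as. jucys_murphy r - sym_const (of_int a)) = lin_prod (JM r) as
    \<and> supported (\<Prod>a\<leftarrow>as. jucys_murphy r - sym_const (of_int a))"
  using assms
  by (induction as) (simp_all add: alg_1 supported_1 alg_mult supported_mult alg_diff alg_const alg_jucys_murphy
      supported_diff supported_const supported_jucys_murphy of_int_cscale)

text \<open>The image of the primitive idempotent of the tableau with entries \<open>1, \<dots>, k\<close>.\<close>
definition idem :: "(nat \<Rightarrow> nat \<times> nat) \<Rightarrow> nat \<Rightarrow> (complex, 'N^'n) endo" where
  "idem U k = alg (primitive_idempotent U k)"

lemma idem_supported: "k \<le> n \<Longrightarrow> supported (primitive_idempotent U k)"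
  by (induction U k rule: primitive_idempotent.induct)
    (auto simp: supported_1 Let_def supported_mult supported_const alg_lin_prod)

text \<open>The scalar is the inverse of the product of the differences \<open>\<sigma> - a\<close>.\<close>
lemma idem_Suc:
  assumes "1 \<le> k" "Suc k \<le> n"
  shows "\<exists>c. idem U (Suc k) = c *\<^sub>C (idem U k * lin_prod (JM (Suc k)) (sorted_list_of_set (other_contents U (Suc k))))"
proof -
  obtain m where "k = Suc m" using assms(1) by (cases k) auto
  then show ?thesis
    using assms(2) idem_supported[of k U]
    by (auto simp: idem_def Let_def alg_mult supported_mult supported_const alg_lin_prod alg_const cscale_mult_right
        intro!: exI)
qed

lemma idem_1: "k \<le> 1 \<Longrightarrow> idem U k = 1"
  by (cases k) (simp_all add: idem_def alg_1)

text \<open>\<open>E\<^sub>U\<close> is a polynomial in the Jucys--Murphy elements.\<close>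
lemma idem_commute:
  assumes "k \<le> n" "\<And>r. r \<in> {1..k} \<Longrightarrow> w * JM r = JM r * w"
  shows "w * idem U k = idem U k * w"
  using assms
proof (induction k)
  case (Suc k)
  show ?case
  proof (cases "k = 0")
    case False
    then obtain c where c: "idem U (Suc k) =
        c *\<^sub>C (idem U k * lin_prod (JM (Suc k)) (sorted_list_of_set (other_contents U (Suc k))))"
      using idem_Suc[of k U] Suc.prems by auto
    define L where "L = lin_prod (JM (Suc k)) (sorted_list_of_set (other_contents U (Suc k)))"
    have 1: "w * L = L * w" unfolding L_def by (rule lin_prod_intertwine) (use Suc.prems in auto)
    have 2: "w * idem U k = idem U k * w" using Suc by auto
    have "w * (idem U k * L) = (w * idem U k) * L" by (simp only: mult.assoc)
    also have "\<dots> = idem U k * (w * L)" by (simp only: 2 mult.assoc)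
    also have "\<dots> = idem U k * L * w" by (simp only: 1 mult.assoc)
    finally show ?thesis by (simp add: c L_def[symmetric] cscale_mult_left cscale_mult_right)
  qed (simp add: idem_1)
qed (simp add: idem_1)

text \<open>In the step from \<open>k\<close> to \<open>k + 1\<close>, for \<open>r \<le> k\<close> the eigenvalue is inherited from the smaller tableau, whose
  idempotent is the left factor. For \<open>r = k + 1\<close> the product of all \<open>JM r - a\<close>, where \<open>a\<close> runs over the contents of
  all addable boxes, kills the smaller idempotent, and the factor with \<open>a = \<sigma>\<^sub>r\<close> is the only one left out of the
  recursive definition.\<close>
theorem idem_eigen:
  assumes U: "\<And>m. m \<le> n \<Longrightarrow> standard_filling U m" and "k \<le> n" "r \<in> {1..k}"
  shows "JM r * idem U k = of_int (box_content (U r)) * idem U k"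
  using assms(2,3)
proof (induction k arbitrary: r)
  case (Suc k)
  show ?case
  proof (cases "k = 0")
    case True
    interpret standard_filling U 1 using U Suc.prems by auto
    obtain i j where ij: "U 1 = (i, j)" by fastforce
    have "(i, j) \<in> U ` {1..1}" using ij by simp
    note down = order_idealD[OF ideal this]
    have "(1, 1) \<in> U ` {1..1}" by (rule down(3)) (use down(1,2) in simp_all)
    then have "U 1 = (1, 1)" by simp
    then show ?thesis using True Suc.prems by (auto simp: JM_1 box_content_def)
  next
    case False
    define L where "L = sorted_list_of_set (other_contents U (Suc k))"
    obtain c where c: "idem U (Suc k) = c *\<^sub>C (idem U k * lin_prod (JM (Suc k)) L)"
      using idem_Suc[of k U] Suc.prems False by (auto simp: L_def)
    have comm: "lin_prod (JM (Suc k)) L * idem U k = idem U k * lin_prod (JM (Suc k)) L"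
    proof (rule idem_commute)
      fix r assume "r \<in> {1..k}"
      then show "lin_prod (JM (Suc k)) L * JM r = JM r * lin_prod (JM (Suc k)) L"
        by (intro lin_prod_intertwine[symmetric] JM_commute) (use Suc.prems in auto)
    qed (use Suc.prems in simp)
    have "JM r * (idem U k * lin_prod (JM (Suc k)) L) =
        of_int (box_content (U r)) * (idem U k * lin_prod (JM (Suc k)) L)"
    proof (cases "r = Suc k")
      case False
      then have "JM r * idem U k = of_int (box_content (U r)) * idem U k" using Suc by auto
      from arg_cong[OF this, of "\<lambda>x. x * lin_prod (JM (Suc k)) L"] show ?thesis by (simp only: mult.assoc)
    next
      case True
      have "lin_prod (JM (Suc k)) (box_content (U (Suc k)) # L) * idem U k = 0"
      proof (rule eigenvalue_bound[where c = "\<lambda>k. box_content (U k)"])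
        show "JM r * idem U k = of_int (box_content (U r)) * idem U k" if "r \<in> {1..<Suc k}" for r
          using Suc that by auto
        show "b \<in> set (box_content (U (Suc k)) # L)"
          if "is_weight (Suc k) ((\<lambda>k. box_content (U k))(Suc k := b))" for b
          using weight_content[OF U that] Suc.prems by (simp add: L_def finite_other_contents)
      qed (use Suc.prems in auto)
      then show ?thesis unfolding True comm[symmetric] by (simp add: left_diff_distrib mult.assoc)
    qed
    then show ?thesis by (simp add: c cscale_mult_right)
  qed
qed simp

end

section \<open>Scalar factors\<close>

lemma scalar_mat_mult:
  assumes "central c" "central d"
  shows "(c *\<^sub>M A) ** (d *\<^sub>M B) = (c * d) *\<^sub>M (A ** B)"
proof -
  have "(c * x) * (d * y) = c * d * (x * y)" for x y
  proof -
    have "(c * x) * (d * y) = c * (x * d) * y" by (simp only: mult.assoc)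
    also have "x * d = d * x" using assms(2) unfolding central_def by simp
    finally show ?thesis by (simp only: mult.assoc)
  qed
  then show ?thesis
    by (simp add: vec_eq_iff scalar_mat_def matrix_matrix_mult_def sum_distrib_left)
qed

lemma scalar_mat_scalar_mat: "c *\<^sub>M d *\<^sub>M A = (c * d :: 'a::semigroup_mult) *\<^sub>M A"
  by (simp add: vec_eq_iff scalar_mat_def mult.assoc)

lemma scalar_mat_one [simp]: "(1::'a::monoid_mult) *\<^sub>M A = A"
  by (simp add: vec_eq_iff scalar_mat_def)

lemma resolvent_neg: "fls_flip (resolvent c) = - (1 / (fls_X_inv + fls_const c))"
proof -
  interpret unital_hom "fls_flip :: complex fls \<Rightarrow> complex fls" by (rule unital_hom_fls_flip)
  have nz: "fls_X_inv + fls_const c \<noteq> (0 :: complex fls)"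
    using X_inv_minus_const_nonzero[of "- c"] by simp
  have "(- fls_X_inv - fls_const c) * fls_flip (resolvent c) = 1"
    using arg_cong[OF resolvent_eq[of c], of fls_flip]
    by (simp only: hom_mult hom_diff hom_one fls_flip_X_inv fls_flip_const)
  then have "(fls_X_inv + fls_const c) * (- fls_flip (resolvent c)) = 1"
    by (simp add: algebra_simps)
  then have "- fls_flip (resolvent c) = 1 / (fls_X_inv + fls_const c)"
    using nz by (simp add: field_simps)
  then show ?thesis by (metis minus_minus)
qed

lemma flip_lax: "map_matrix fls_flip (lax g E) = lax (fls_flip g) E"
proof -
  interpret unital_hom "fls_flip :: 'a fls \<Rightarrow> 'a fls" by (rule unital_hom_fls_flip)
  show ?thesis
    by (simp add: vec_eq_iff lax_def hom_diff hom_mult hom_one hom_zero fls_flip_scalar fls_flip_const)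
qed

lemma map_lax:
  fixes h :: "'a::complex_algebra_1 \<Rightarrow> 'b::complex_algebra_1"
  assumes "algebra_hom_on UNIV h"
  shows "map_matrix (map_fls h) (fls_scalar f *\<^sub>M lax g E) = fls_scalar f *\<^sub>M lax g (\<lambda>i j. h (E i j))"
proof -
  interpret h: unital_hom h by (rule algebra_homD(1)[OF assms])
  interpret H: unital_hom "map_fls h" by (rule h.unital_hom_map_fls)
  have "map_fls h (fls_scalar f) = fls_scalar f" for f
    by (rule fls_eqI) (simp add: h.fls_nth_map_fls fls_nth_scalar algebra_homD(2)[OF assms] h.hom_one)
  then show ?thesis
    by (simp add: vec_eq_iff lax_def scalar_mat_def H.hom_diff H.hom_mult H.hom_one H.hom_zero h.map_fls_const)
qed

text \<open>Both are polynomials of degree one in the same matrix \<open>E\<^sup>t\<close> with central coefficients.\<close>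
lemma lax_commute:
  fixes E :: "'N::finite \<Rightarrow> 'N \<Rightarrow> 'b::complex_algebra_1"
  shows "lax f E ** lax g E = lax g E ** lax f E"
proof -
  define A where "A = (\<chi> i j. fls_const (E j i))"
  have R: "lax f E = mat 1 - fls_scalar f *\<^sub>M A" for f
    by (simp add: lax_def A_def vec_eq_iff mat_def scalar_mat_def)
  have "(fls_scalar f *\<^sub>M A) ** (fls_scalar g *\<^sub>M A) = (fls_scalar g *\<^sub>M A) ** (fls_scalar f *\<^sub>M A)"
    by (simp add: scalar_mat_mult central_scalar fls_scalar_central[of f "fls_scalar g"])
  then show ?thesis by (simp add: R matrix_diff_distrib)
qed

definition unipotent_scalar :: "complex fls \<Rightarrow> bool" where
  "unipotent_scalar h \<longleftrightarrow> (\<forall>k<0. fls_nth h k = 0) \<and> fls_nth h 0 = 1"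

lemma unipotent_series_scalar:
  fixes T :: "('b::complex_algebra_1 fls)^'N::finite^'N"
  assumes "unipotent_scalar h" "unipotent_series T"
  shows "unipotent_series (fls_scalar h *\<^sub>M T)"
proof -
  have "fls_nth (fls_scalar h * T $ i $ j) k = (\<Sum>m=0..k. fls_nth h m *\<^sub>C fls_nth (T $ i $ j) (k - m))" for i j k
    using assms by (subst fls_times_nth_bounds[of 0 _ 0])
      (simp_all add: unipotent_scalar_def unipotent_series_def fls_nth_scalar cscale_mult_left)
  then show ?thesis
    using assms by (simp add: unipotent_scalar_def unipotent_series_def scalar_mat_def cscale_one)
qed

lemma flip_scalar_mat:
  "map_matrix fls_flip (fls_scalar h *\<^sub>M T) = fls_scalar (fls_flip h) *\<^sub>M map_matrix fls_flip T"
  by (simp add: unital_hom.map_matrix_scalar[OF unital_hom_fls_flip] fls_flip_scalar)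

lemma map_Smat_scaled:
  fixes \<Phi> :: "'N::finite yangian \<Rightarrow> 'b::complex_algebra_1"
  assumes \<Phi>: "algebra_hom_on UNIV \<Phi>" and T: "map_matrix (map_fls \<Phi>) Tmat = fls_scalar h *\<^sub>M T"
    and h: "unipotent_scalar h" and V: "V ** map_matrix fls_flip T = mat 1"
  shows "map_matrix (map_fls \<Phi>) Smat = fls_scalar (h / fls_flip h) *\<^sub>M (V ** T)"
proof -
  interpret s: unital_hom "fls_scalar :: complex fls \<Rightarrow> 'b fls" by (rule unital_hom_fls_scalar)
  have "fls_nth (fls_flip h) 0 = 1" using h by (simp add: fls_nth_flip unipotent_scalar_def)
  then have nz: "fls_flip h \<noteq> 0" by auto
  have "(fls_scalar (1 / fls_flip h) *\<^sub>M V) ** map_matrix fls_flip (fls_scalar h *\<^sub>M T)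
      = fls_scalar (1 / fls_flip h * fls_flip h) *\<^sub>M mat 1"
    by (simp only: flip_scalar_mat scalar_mat_mult central_scalar V s.hom_mult)
  also have "\<dots> = mat 1" using nz by (simp add: s.hom_one)
  finally have "map_matrix (map_fls \<Phi>) Smat =
      (fls_scalar (1 / fls_flip h) *\<^sub>M V) ** (fls_scalar h *\<^sub>M T)"
    by (rule map_Smat[OF \<Phi> T])
  also have "\<dots> = fls_scalar (1 / fls_flip h * h) *\<^sub>M (V ** T)"
    by (simp only: scalar_mat_mult central_scalar s.hom_mult)
  finally show ?thesis by simp
qed

section \<open>The evaluation homomorphism\<close>

text \<open>With \<open>L(u) = 1 - E\<^sup>t/(u - w)\<close>, the numerator \<open>u - w - E\<^sup>t\<close> is \<open>(u - w) L(u)\<close> and the denominator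
  \<open>u + w + E\<^sup>t\<close> is \<open>(u + w) L(-u)\<close>, so the scalar prefactor cancels and the displayed fraction is \<open>L(u) L(-u)\<inverse> = L(-u)\<inverse> L(u)\<close>.\<close>
lemma evaluation_hom:
  assumes h: "unipotent_scalar h"
  obtains ev :: "'N::finite yangian \<Rightarrow> 'N gl_envelope" where "algebra_hom_on UNIV ev"
    "map_matrix (map_fls ev) Tmat = fls_scalar h *\<^sub>M lax (resolvent (\<omega> / 4)) gl_E"
    "map_matrix (map_fls ev) Smat = fls_scalar (h / fls_flip h) *\<^sub>M evaluation_Smat \<omega>"
proof -
  let ?w = "fls_const (\<omega> / 4) :: complex fls"
  let ?L = "lax (resolvent (\<omega> / 4)) gl_E :: ('N gl_envelope fls)^'N^'N"
  interpret s: unital_hom "fls_scalar :: complex fls \<Rightarrow> 'N gl_envelope fls" by (rule unital_hom_fls_scalar)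
  obtain ev :: "'N yangian \<Rightarrow> 'N gl_envelope" where ev: "algebra_hom_on UNIV ev"
    "map_matrix (map_fls ev) Tmat = fls_scalar h *\<^sub>M ?L"
    using yangian_hom_exists[of "fls_scalar h *\<^sub>M ?L"] unipotent_series_scalar[OF h lax_unipotent]
      rtt_series_scalar[OF lax_rtt[OF gl_family_gl_E]] by metis
  obtain V where V: "map_matrix fls_flip ?L ** V = mat 1" "V ** map_matrix fls_flip ?L = mat 1"
    using unipotent_series_invertible[OF unipotent_series_flip[OF lax_unipotent]] by blast
  have minus: "fls_X_inv - ?w \<noteq> 0" by (rule X_inv_minus_const_nonzero)
  have plus: "fls_X_inv + ?w \<noteq> 0" using X_inv_minus_const_nonzero[of "- (\<omega> / 4)"] by simp
  let ?Et = "map_matrix fls_const (transpose Emat) :: ('N gl_envelope fls)^'N^'N"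
  have Et: "transpose Emat $ i $ j = gl_E j i" for i j :: 'N by (simp add: Emat_def transpose_def)
  have numerator: "mat (fls_scalar (fls_X_inv - ?w)) - ?Et = fls_scalar (fls_X_inv - ?w) *\<^sub>M ?L"
  proof -
    have "fls_scalar (fls_X_inv - ?w) * (fls_scalar (resolvent (\<omega> / 4)) * x) = (x :: 'N gl_envelope fls)" for x
      by (simp only: mult.assoc[symmetric] s.hom_mult[symmetric] resolvent_eq s.hom_one mult_1)
    then show ?thesis
      by (simp add: vec_eq_iff mat_def scalar_mat_def lax_def Et right_diff_distrib)
  qed
  have denominator: "mat (fls_scalar (fls_X_inv + ?w)) + ?Et = fls_scalar (fls_X_inv + ?w) *\<^sub>M map_matrix fls_flip ?L"
  proof -
    have "fls_scalar (fls_X_inv + ?w) * (fls_scalar (1 / (fls_X_inv + ?w)) * x) = (x :: 'N gl_envelope fls)" for x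
      using plus by (simp add: s.hom_one flip: mult.assoc s.hom_mult)
    then show ?thesis
      unfolding flip_lax resolvent_neg
      by (simp add: vec_eq_iff mat_def scalar_mat_def lax_def s.hom_uminus Et distrib_left)
  qed
  have "matrix_inv (fls_scalar (fls_X_inv + ?w) *\<^sub>M map_matrix fls_flip ?L) = fls_scalar (1 / (fls_X_inv + ?w)) *\<^sub>M V"
    by (rule matrix_inv_eqI)
      (simp_all add: scalar_mat_mult central_scalar V plus s.hom_one flip: s.hom_mult)
  then have "evaluation_Smat \<omega> = fls_scalar ((fls_X_inv + ?w) / (fls_X_inv - ?w)) *\<^sub>M
      ((fls_scalar (fls_X_inv - ?w) *\<^sub>M ?L) ** (fls_scalar (1 / (fls_X_inv + ?w)) *\<^sub>M V))"
    unfolding evaluation_Smat_def Let_def numerator denominator by simp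
  also have "\<dots> = fls_scalar ((fls_X_inv + ?w) / (fls_X_inv - ?w) * ((fls_X_inv - ?w) * (1 / (fls_X_inv + ?w)))) *\<^sub>M (?L ** V)"
    by (simp only: scalar_mat_mult central_scalar scalar_mat_scalar_mat s.hom_mult)
  also have "(fls_X_inv + ?w) / (fls_X_inv - ?w) * ((fls_X_inv - ?w) * (1 / (fls_X_inv + ?w))) = 1"
    using plus minus by simp
  finally have "evaluation_Smat \<omega> = ?L ** V" by (simp add: s.hom_one)
  also have "?L ** V = V ** (map_matrix fls_flip ?L ** ?L) ** V"
    by (simp add: V matrix_mul_assoc)
  also have "map_matrix fls_flip ?L ** ?L = ?L ** map_matrix fls_flip ?L"
    by (simp only: flip_lax lax_commute)
  also have "V ** (?L ** map_matrix fls_flip ?L) ** V = V ** ?L"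
    by (simp add: V flip: matrix_mul_assoc)
  finally have "evaluation_Smat \<omega> = V ** ?L" .
  then have "map_matrix (map_fls ev) Smat = fls_scalar (h / fls_flip h) *\<^sub>M evaluation_Smat \<omega>"
    using map_Smat_scaled[OF ev h V(2)] by simp
  then show thesis using that ev by blast
qed

section \<open>Matrices over the algebra of matrices\<close>

text \<open>The isomorphism from \<open>N \<times> N\<close> matrices whose entries are series of operators on tensor space to matrices of
  scalar series on \<open>\<complex>\<^sup>N \<otimes> (\<complex>\<^sup>N)\<^sup>\<otimes>\<^sup>n\<close>.\<close>
definition flatten :: "((complex, 'i::finite) endo fls)^'N::finite^'N \<Rightarrow> (complex fls)^('N \<times> 'i)^('N \<times> 'i)" where
  "flatten S = (\<chi> p q. map_fls (\<lambda>b. mat_of b $ snd p $ snd q) (S $ fst p $ fst q))"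

lemma fls_nth_flatten: "fls_nth (flatten S $ p $ q) k = mat_of (fls_nth (S $ fst p $ fst q) k) $ snd p $ snd q"
  by (simp add: flatten_def fls_nth_map zero_endo.rep_eq)

lemma flatten_mult: "flatten (A ** B) = flatten A ** flatten B"
proof -
  have entry: "mat_of (fls_nth (F * G) n) $ w $ v =
      (\<Sum>x\<in>UNIV. fls_nth (map_fls (\<lambda>b. mat_of b $ w $ x) F * map_fls (\<lambda>b. mat_of b $ x $ v) G) n)"
    for F G :: "(complex, 'i::finite) endo fls" and w v n
  proof -
    obtain a b where ab: "\<And>k. k<a \<Longrightarrow> fls_nth F k = 0" "\<And>k. k<b \<Longrightarrow> fls_nth G k = 0"
      using fls_nth_vanishes_belowE[of F] fls_nth_vanishes_belowE[of G] by metis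
    have "(\<Sum>x\<in>UNIV. fls_nth (map_fls (\<lambda>b. mat_of b $ w $ x) F * map_fls (\<lambda>b. mat_of b $ x $ v) G) n) =
      (\<Sum>x\<in>UNIV. \<Sum>i=a..n-b. mat_of (fls_nth F i) $ w $ x * mat_of (fls_nth G (n - i)) $ x $ v)"
      by (subst fls_times_nth_bounds[of a _ b]) (simp_all add: fls_nth_map zero_endo.rep_eq ab)
    also have "\<dots> = (\<Sum>i=a..n-b. mat_of (fls_nth F i * fls_nth G (n - i)) $ w $ v)"
      by (subst sum.swap) (simp add: times_endo.rep_eq matrix_matrix_mult_def)
    finally show ?thesis
      by (simp add: fls_times_nth_bounds[OF ab] mat_of_sum)
  qed
  have "fls_nth (flatten (A ** B) $ p $ q) n = fls_nth ((flatten A ** flatten B) $ p $ q) n" for p q n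
  proof -
    have "fls_nth (flatten (A ** B) $ p $ q) n = (\<Sum>k\<in>UNIV. \<Sum>x\<in>UNIV.
        fls_nth (flatten A $ p $ (k, x) * flatten B $ (k, x) $ q) n)"
      by (simp add: fls_nth_flatten matrix_matrix_mult_def fls_nth_sum mat_of_sum entry) (simp add: flatten_def)
    also have "\<dots> = (\<Sum>r\<in>UNIV. fls_nth (flatten A $ p $ r * flatten B $ r $ q) n)"
      by (simp add: sum.cartesian_product case_prod_unfold)
    finally show ?thesis by (simp add: matrix_matrix_mult_def fls_nth_sum)
  qed
  then show ?thesis by (simp add: vec_eq_iff fls_eq_iff)
qed

lemma flatten_one: "flatten (mat 1) = mat 1"
proof -
  have "fls_nth (flatten (mat 1) $ p $ q) n = fls_nth (mat 1 $ p $ q :: complex fls) n" for p q :: "'a \<times> 'b" and n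
    by (auto simp: fls_nth_flatten mat_def one_endo.rep_eq zero_endo.rep_eq prod_eq_iff)
  then show ?thesis by (simp add: vec_eq_iff fls_eq_iff)
qed

lemma flatten_scalar: "flatten (fls_scalar f *\<^sub>M A) = f *\<^sub>M flatten A"
proof -
  have "fls_nth (flatten (fls_scalar f *\<^sub>M A) $ p $ q) n = fls_nth ((f *\<^sub>M flatten A) $ p $ q) n" for p q n
  proof -
    let ?F = "A $ fst p $ fst q"
    obtain a b where ab: "\<And>k. k<a \<Longrightarrow> fls_nth f k = 0" "\<And>k. k<b \<Longrightarrow> fls_nth ?F k = 0"
      using fls_nth_vanishes_belowE[of f] fls_nth_vanishes_belowE[of ?F] by metis
    have "fls_nth (fls_scalar f * ?F) n = (\<Sum>i=a..n-b. fls_nth f i *\<^sub>C fls_nth ?F (n - i))"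
      by (subst fls_times_nth_bounds[of a _ b]) (simp_all add: ab fls_nth_scalar cscale_mult_left)
    moreover have "fls_nth (f * flatten A $ p $ q) n = (\<Sum>i=a..n-b. fls_nth f i * mat_of (fls_nth ?F (n - i)) $ snd p $ snd q)"
      by (subst fls_times_nth_bounds[of a _ b]) (simp_all add: ab fls_nth_flatten zero_endo.rep_eq)
    ultimately show ?thesis
      by (simp add: fls_nth_flatten scalar_mat_def mat_of_sum cscale_endo.rep_eq cscale_complex_def)
  qed
  then show ?thesis by (simp add: vec_eq_iff fls_eq_iff)
qed

lemma flatten_lax: "flatten (lax (1 / z) (unit_at m)) = in_factors_0 m (Rmat z)"
proof -
  have "fls_nth (flatten (lax (1 / z) (unit_at m)) $ p $ q) n = fls_nth (in_factors_0 m (Rmat z) $ p $ q) n"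
    for p q :: "'a \<times> ('a^'b)" and n
  proof -
    define C where "C = (\<forall>l. l \<noteq> m \<longrightarrow> snd p $ l = snd q $ l)"
    have unit: "mat_of (unit_at m (fst q) (fst p)) $ snd p $ snd q =
        (if C \<and> fst p = snd q $ m \<and> snd p $ m = fst q then 1 else 0)"
      by (simp add: unit_at_def Endo_inverse in_factor_def matrix_unit_def C_def) blast
    have eq: "snd p = snd q \<longleftrightarrow> C \<and> snd p $ m = snd q $ m"
      unfolding vec_eq_iff C_def by metis
    have lhs: "fls_nth (flatten (lax (1 / z) (unit_at m)) $ p $ q) n =
        (if fst p = fst q \<and> snd p = snd q \<and> n = 0 then 1 else 0) -
        fls_nth (1 / z) n * mat_of (unit_at m (fst q) (fst p)) $ snd p $ snd q"
      by (simp add: fls_nth_flatten lax_def minus_endo.rep_eq one_endo.rep_eq zero_endo.rep_eq mat_def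
          fls_nth_scalar cscale_mult_left cscale_endo.rep_eq cscale_complex_def)
    have "in_factors_0 m (Rmat z) $ p $ q = (if C then Rmat z $ (fst p, snd p $ m) $ (fst q, snd q $ m) else 0)"
      by (simp only: in_factors_0_def C_def vec_lambda_beta)
    also have "Rmat z $ (fst p, snd p $ m) $ (fst q, snd q $ m) =
        (if fst p = fst q \<and> snd p $ m = snd q $ m then 1 else 0) -
        1 / z * (if fst p = snd q $ m \<and> snd p $ m = fst q then 1 else 0)"
      by (simp add: Rmat_def mat_def scalar_mat_def Pmat_nth)
    finally have rhs: "in_factors_0 m (Rmat z) $ p $ q =
        (if C then (if fst p = fst q \<and> snd p $ m = snd q $ m then 1 else 0) -
        1 / z * (if fst p = snd q $ m \<and> snd p $ m = fst q then 1 else 0) else 0)" .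
    have coeff: "fls_nth (if C then (if a then 1 else 0) - 1 / z * (if b then 1 else 0) else 0) n =
        (if C \<and> a \<and> n = 0 then 1 else 0) - fls_nth (1 / z) n * (if C \<and> b then 1 else 0)" for a b
      by simp
    show ?thesis unfolding lhs rhs unit eq coeff by (simp only: conj_ac)
  qed
  then show ?thesis by (simp add: vec_eq_iff fls_eq_iff)
qed

lemma mat_prod_append: "mat_prod (As @ [A]) = mat_prod As ** A"
  unfolding mat_prod_def by (induction As) (simp_all add: matrix_mul_assoc)

lemma mat_prod_Cons: "mat_prod (A # As) = A ** mat_prod As"
  by (simp add: mat_prod_def)

section \<open>The fusion procedure\<close>

context tensor_positions
begin

fun R_chain :: "(nat \<Rightarrow> complex fls) \<Rightarrow> nat \<Rightarrow> ((complex, 'N^'n) endo fls)^'N^'N" where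
  "R_chain g 0 = mat 1"
| "R_chain g (Suc k) = R_chain g k ** lax (g (Suc k)) (unit_at (pos (Suc k)))"

text \<open>Used to see that the entries of \<open>R\<^sub>0\<^sub>k\<close> commute with those of \<open>R\<^sub>0\<^sub>l\<close> for \<open>k \<noteq> l\<close>, as the
  coproduct \<open>rtt_series_mult\<close> requires.\<close>
lemma const_commutes_lax:
  assumes "\<And>i j. x * E i j = E i j * x"
  shows "fls_const x * lax g E $ i $ j = lax g E $ i $ j * fls_const x"
proof (rule fls_eqI)
  fix r
  have "x * ((c *\<^sub>C 1) * E j i) = ((c *\<^sub>C 1) * E j i) * x" for c
    by (simp add: cscale_mult_left cscale_mult_right assms)
  then show "fls_nth (fls_const x * lax g E $ i $ j) r = fls_nth (lax g E $ i $ j * fls_const x) r"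
    by (simp add: lax_def right_diff_distrib left_diff_distrib fls_nth_scalar)
qed

lemma R_chain_commutes:
  assumes "\<And>m i j. m \<in> {1..k} \<Longrightarrow> x * unit_at (pos m) i j = unit_at (pos m) i j * x"
  shows "fls_const x * R_chain g k $ i $ j = R_chain g k $ i $ j * fls_const x"
  using assms
proof (induction k arbitrary: i j)
  case 0
  show ?case by (simp add: mat_def)
next
  case (Suc k)
  let ?R = "lax (g (Suc k)) (unit_at (pos (Suc k)))"
  have 1: "fls_const x * R_chain g k $ i $ l = R_chain g k $ i $ l * fls_const x" for l
    using Suc by auto
  have 2: "fls_const x * ?R $ l $ j = ?R $ l $ j * fls_const x" for l
    by (rule const_commutes_lax) (use Suc.prems in auto)
  have "fls_const x * (R_chain g k $ i $ l * ?R $ l $ j) = (R_chain g k $ i $ l * ?R $ l $ j) * fls_const x" for l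
  proof -
    have "fls_const x * (R_chain g k $ i $ l * ?R $ l $ j) = (fls_const x * R_chain g k $ i $ l) * ?R $ l $ j"
      by (simp only: mult.assoc)
    also have "\<dots> = R_chain g k $ i $ l * (fls_const x * ?R $ l $ j)" by (simp only: 1 mult.assoc)
    finally show ?thesis by (simp only: 2 mult.assoc)
  qed
  then show ?case
    by (simp add: matrix_matrix_mult_def sum_distrib_left sum_distrib_right)
qed

lemma R_chain_lax:
  assumes "k \<le> n"
  shows "unipotent_series (R_chain (\<lambda>m. resolvent (c m)) k) \<and> rtt_series (R_chain (\<lambda>m. resolvent (c m)) k)"
  using assms
proof (induction k)
  case 0
  have "rtt_series (mat 1 :: ((complex, 'N^'n) endo fls)^'N^'N)"
    by (simp add: rtt_series_def unital_hom.map_matrix_mat unital_hom_fls_const unital_hom_map_fls_const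
        unital_hom.hom_one) (auto simp: rtt_iff mat_def)
  moreover have "unipotent_series (mat 1 :: ((complex, 'N^'n) endo fls)^'N^'N)"
    by (simp add: unipotent_series_def mat_def)
  ultimately show ?case by simp
next
  case (Suc k)
  let ?A = "R_chain (\<lambda>m. resolvent (c m)) k" and ?B = "lax (resolvent (c (Suc k))) (unit_at (pos (Suc k)))"
  have "rtt_series (?A ** ?B)"
  proof (rule rtt_series_mult)
    show "rtt_series ?A" using Suc by simp
    show "rtt_series ?B" by (rule lax_rtt) (rule gl_family_unit_at)
    fix i j a b
    show "\<forall>r s. fls_nth (?A $ i $ j) r * fls_nth (?B $ a $ b) s = fls_nth (?B $ a $ b) s * fls_nth (?A $ i $ j) r"
    proof (intro allI)
      fix r s
      let ?x = "fls_nth (?B $ a $ b) s"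
      have neq: "pos m \<noteq> pos (Suc k)" if "m \<in> {1..k}" for m
        using that Suc.prems idx_pos[of m] idx_pos[of "Suc k"] by fastforce
      have "fls_const ?x * ?A $ i $ j = ?A $ i $ j * fls_const ?x"
      proof (rule R_chain_commutes)
        fix m i j assume m: "m \<in> {1..k}"
        have "fls_const (unit_at (pos m) i j) * ?B $ a $ b = ?B $ a $ b * fls_const (unit_at (pos m) i j)"
          by (rule const_commutes_lax) (rule unit_at_commute[OF neq[OF m]])
        from arg_cong[OF this, of "\<lambda>F. fls_nth F s"]
        show "?x * unit_at (pos m) i j = unit_at (pos m) i j * ?x" by simp
      qed
      from arg_cong[OF this, of "\<lambda>F. fls_nth F r"]
      show "fls_nth (?A $ i $ j) r * ?x = ?x * fls_nth (?A $ i $ j) r" by simp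
    qed
  qed
  moreover have "unipotent_series (?A ** ?B)"
    by (rule unipotent_series_mult) (use Suc lax_unipotent in simp_all)
  ultimately show ?case by simp
qed

lemma flip_R_chain: "map_matrix fls_flip (R_chain g k) = R_chain (\<lambda>m. fls_flip (g m)) k"
proof -
  interpret unital_hom "fls_flip :: (complex, 'N^'n) endo fls \<Rightarrow> _" by (rule unital_hom_fls_flip)
  show ?thesis
    by (induction k) (simp_all add: map_matrix_mat hom_one map_matrix_mult flip_lax)
qed

abbreviation R0 :: "nat \<Rightarrow> complex fls \<Rightarrow> (complex fls)^('N \<times> ('N^'n))^('N \<times> ('N^'n))" where
  "R0 k z \<equiv> in_factors_0 (pos k) (Rmat z)"

lemma flatten_R_chain: "flatten (R_chain (\<lambda>m. 1 / z m) k) = mat_prod (map (\<lambda>k. R0 k (z k)) [1..<Suc k])"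
proof (induction k)
  case (Suc k)
  have "[1..<Suc (Suc k)] = [1..<Suc k] @ [Suc k]" by simp
  then show ?case using Suc by (simp only: R_chain.simps flatten_mult flatten_lax map_append mat_prod_append list.map)
qed (simp add: flatten_one mat_prod_def)

lemma R_chain_inverse:
  assumes "\<And>m. m \<in> {1..k} \<Longrightarrow> \<exists>V. (lax (1 / z m) (unit_at (pos m)) :: ((complex, 'N^'n) endo fls)^'N^'N) ** V = mat 1 \<and>
      V ** lax (1 / z m) (unit_at (pos m)) = mat 1"
  shows "\<exists>V. V ** R_chain (\<lambda>m. 1 / z m) k = mat 1 \<and>
     flatten V = mat_prod (map (\<lambda>k. matrix_inv (R0 k (z k))) (rev [1..<Suc k]))"
  using assms
proof (induction k)
  case 0
  show ?case by (rule exI[of _ "mat 1"]) (simp add: flatten_one mat_prod_def)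
next
  case (Suc k)
  have "\<exists>V. V ** R_chain (\<lambda>m. 1 / z m) k = mat 1 \<and>
     flatten V = mat_prod (map (\<lambda>k. matrix_inv (R0 k (z k))) (rev [1..<Suc k]))"
    by (rule Suc.IH) (use Suc.prems in auto)
  then obtain V where V: "V ** R_chain (\<lambda>m. 1 / z m) k = mat 1"
    "flatten V = mat_prod (map (\<lambda>k. matrix_inv (R0 k (z k))) (rev [1..<Suc k]))" by blast
  let ?R = "lax (1 / z (Suc k)) (unit_at (pos (Suc k))) :: ((complex, 'N^'n) endo fls)^'N^'N"
  obtain W where W: "?R ** W = mat 1" "W ** ?R = mat 1" using Suc.prems[of "Suc k"] by auto
  have "W ** V ** (R_chain (\<lambda>m. 1 / z m) k ** ?R) = W ** (V ** R_chain (\<lambda>m. 1 / z m) k) ** ?R"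
    by (simp only: matrix_mul_assoc)
  also have "\<dots> = mat 1" by (simp add: V W)
  finally have 1: "W ** V ** R_chain (\<lambda>m. 1 / z m) (Suc k) = mat 1" by simp
  have "matrix_inv (R0 (Suc k) (z (Suc k))) = flatten W"
    unfolding flatten_lax[symmetric]
    by (rule matrix_inv_eqI) (simp_all add: W flatten_one flip: flatten_mult)
  moreover have "rev [1..<Suc (Suc k)] = Suc k # rev [1..<Suc k]" by simp
  ultimately have "flatten (W ** V) = mat_prod (map (\<lambda>k. matrix_inv (R0 k (z k))) (rev [1..<Suc (Suc k)]))"
    by (simp only: flatten_mult V list.map mat_prod_Cons)
  with 1 show ?case by blast
qed

text \<open>Operators on tensor space, scalar series and \<open>P\<^sub>0\<^sub>k\<close> as elements of one ring, the \<open>N \<times> N\<close> matrices over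
  series of operators, where the fusion identity is a computation.\<close>
definition cst :: "(complex, 'N^'n) endo \<Rightarrow> ((complex, 'N^'n) endo fls, 'N) endo" where
  "cst x = Endo (mat (fls_const x))"

definition scl :: "complex fls \<Rightarrow> ((complex, 'N^'n) endo fls, 'N) endo" where
  "scl f = Endo (mat (fls_scalar f))"

definition P0 :: "nat \<Rightarrow> ((complex, 'N^'n) endo fls, 'N) endo" where
  "P0 k = Endo (\<chi> i j. fls_const (unit_at (pos k) j i))"

lemma cst_mult: "cst (x * y) = cst x * cst y"
  by (rule endo_eqI) (simp add: cst_def Endo_inverse times_endo.rep_eq mat_mult_nth, simp add: mat_def)

lemma cst_0: "cst 0 = 0"
  by (rule endo_eqI) (simp add: cst_def Endo_inverse zero_endo.rep_eq mat_def)

lemma cst_add: "cst (x + y) = cst x + cst y"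
  by (rule endo_eqI) (simp add: cst_def Endo_inverse plus_endo.rep_eq mat_def fls_plus_const)

lemma cst_cscale: "cst (c *\<^sub>C x) = scl (fls_const c) * cst x"
proof -
  have "fls_scalar (fls_const c) * fls_const x = fls_const (c *\<^sub>C x)"
    by (rule fls_eqI) (simp add: fls_nth_scalar cscale_mult_left)
  then show ?thesis
    by (intro endo_eqI) (simp add: cst_def scl_def Endo_inverse times_endo.rep_eq mat_mult_nth, simp add: mat_def)
qed

lemma scl_central: "scl f * y = y * scl f"
  by (rule endo_eqI) (simp add: scl_def Endo_inverse times_endo.rep_eq mat_mult_nth fls_scalar_central)

lemma scl_left_commute: "y * (scl f * z) = scl f * (y * z)"
  by (metis mult.assoc scl_central)

lemma scl_mult: "scl (f * g) = scl f * scl g"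
  by (rule endo_eqI) (simp add: scl_def Endo_inverse times_endo.rep_eq mat_mult_nth,
      simp add: mat_def unital_hom.hom_mult[OF unital_hom_fls_scalar])

lemma scl_diff: "scl (f - g) = scl f - scl g"
  by (rule endo_eqI) (simp add: scl_def Endo_inverse minus_endo.rep_eq mat_def unital_hom.hom_diff[OF unital_hom_fls_scalar])

lemma P0_exchange:
  assumes "i \<in> {1..n}" "k \<in> {1..n}" "i \<noteq> k"
  shows "P0 i * P0 k = P0 k * cst (transp i k)"
proof (rule endo_eqI)
  interpret unital_hom "fls_const :: (complex, 'N^'n) endo \<Rightarrow> _" by (rule unital_hom_fls_const)
  fix a b
  have "mat_of (P0 i * P0 k) $ a $ b = fls_const (\<Sum>j\<in>UNIV. unit_at (pos i) j a * unit_at (pos k) b j)"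
    by (simp add: P0_def times_endo.rep_eq Endo_inverse matrix_matrix_mult_def hom_sum)
  also have "\<dots> = mat_of (P0 k * cst (transp i k)) $ a $ b"
    unfolding unit_at_exchange[OF assms]
    by (simp add: P0_def cst_def times_endo.rep_eq Endo_inverse mat_mult_nth transp_def)
  finally show "mat_of (P0 i * P0 k) $ a $ b = mat_of (P0 k * cst (transp i k)) $ a $ b" .
qed

lemma P0_cst:
  assumes "\<And>i j. x * unit_at (pos k) i j = unit_at (pos k) i j * x"
  shows "P0 k * cst x = cst x * P0 k"
  by (rule endo_eqI) (simp add: P0_def cst_def times_endo.rep_eq Endo_inverse mat_mult_nth assms)

lemma Endo_lax: "Endo (lax g (unit_at (pos k))) = 1 - scl g * P0 k"
  by (rule endo_eqI) (simp add: lax_def P0_def scl_def Endo_inverse times_endo.rep_eq minus_endo.rep_eq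
      one_endo.rep_eq mat_mult_nth, simp add: mat_def)

text \<open>The smaller idempotent involves only the factors \<open>1, \<dots>, k\<close>.\<close>
lemma idem_unit_at:
  assumes "k < l" "l \<le> n"
  shows "idem U k * unit_at (pos l) i j = unit_at (pos l) i j * idem U k"
proof (rule idem_commute[symmetric])
  fix r assume r: "r \<in> {1..k}"
  have "unit_at (pos l) i j * transp a r = transp a r * unit_at (pos l) i j" if "a \<in> {1..<r}" for a
    using PM_unit_at[OF symmetric_group_swap, of a r l i j] that r assms by (simp add: transp_def)
  then show "unit_at (pos l) i j * JM r = JM r * unit_at (pos l) i j"
    unfolding JM_def sum_distrib_left sum_distrib_right by (intro sum.cong refl)
qed (use assms in simp)

lemma idem_total:
  "idem U n * (\<Sum>m\<in>UNIV. unit_at m i j) = (\<Sum>m\<in>UNIV. unit_at m i j) * idem U n"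
proof (rule idem_commute[symmetric])
  define T where "T = (\<Sum>m\<in>UNIV. unit_at m i j :: (complex, 'N^'n) endo)"
  fix r assume r: "r \<in> {1..n}"
  have "T * transp a r = transp a r * T" if "a \<in> {1..<r}" for a
    using PM_total[OF symmetric_group_swap, of a r i j] that r by (simp add: transp_def T_def)
  then have "T * JM r = JM r * T"
    unfolding JM_def sum_distrib_left sum_distrib_right by (intro sum.cong refl)
  then show "(\<Sum>m\<in>UNIV. unit_at m i j) * JM r = JM r * (\<Sum>m\<in>UNIV. unit_at m i j)"
    by (simp only: T_def)
qed simp

lemma resolvent_shift: "resolvent (s + c) - resolvent c * resolvent (s + c) * fls_const s = resolvent c"
proof -
  have 1: "(fls_X_inv - fls_const c) * resolvent c = 1" by (rule resolvent_eq)
  have 2: "(fls_X_inv - fls_const c - fls_const s) * resolvent (s + c) = 1"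
    using resolvent_eq[of "s + c"] by (simp add: fls_plus_const[symmetric] algebra_simps)
  have "resolvent c = resolvent c * ((fls_X_inv - fls_const c - fls_const s) * resolvent (s + c))"
    by (simp add: 2)
  also have "\<dots> = ((fls_X_inv - fls_const c) * resolvent c) * resolvent (s + c) - resolvent c * resolvent (s + c) * fls_const s"
    by (simp add: algebra_simps)
  finally show ?thesis by (simp add: 1)
qed

text \<open>Write \<open>q = k + 1\<close> and \<open>F\<^sub>q = F\<^sub>k G\<close>. As \<open>F\<^sub>k\<close> commutes with \<open>P\<^sub>0\<^sub>q\<close>, it can be moved left past the last factor, where
  the induction hypothesis applies; then it is moved back. In the product
  \<open>(1 - (P\<^sub>0\<^sub>1 + \<dots> + P\<^sub>0\<^sub>k)/(u - c)) (1 - P\<^sub>0\<^sub>q/(u - c - \<sigma>\<^sub>q)) F\<^sub>q\<close> the quadratic terms are \<open>\<Sum>P\<^sub>0\<^sub>iP\<^sub>0\<^sub>q F\<^sub>q = P\<^sub>0\<^sub>q \<Sum>P\<^sub>i\<^sub>q F\<^sub>q = \<sigma>\<^sub>q P\<^sub>0\<^sub>q F\<^sub>q\<close>, and \<open>resolvent_shift\<close> combines them with the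
  linear term in \<open>P\<^sub>0\<^sub>q\<close>.\<close>
theorem fusion:
  assumes U: "\<And>m. m \<le> n \<Longrightarrow> standard_filling U m" and "k \<le> n"
  shows "Endo (R_chain (\<lambda>m. resolvent (of_int (box_content (U m)) + c)) k) * cst (idem U k)
    = (1 - scl (resolvent c) * (\<Sum>i\<in>{1..k}. P0 i)) * cst (idem U k)"
  using assms(2)
proof (induction k)
  case 0
  show ?case by (simp flip: one_endo_def)
next
  case (Suc k)
  define q where "q = Suc k"
  let ?\<sigma> = "of_int (box_content (U q)) :: complex"
  define A where "A = Endo (R_chain (\<lambda>m. resolvent (of_int (box_content (U m)) + c)) k)"
  define g where "g = scl (resolvent c)"
  define gq where "gq = scl (resolvent (?\<sigma> + c))"
  define S where "S = (\<Sum>i\<in>{1..k}. P0 i)"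
  define F where "F = cst (idem U q)"
  have q: "q \<in> {1..n}" using Suc.prems by (simp add: q_def)
  obtain G where G: "idem U q = idem U k * G"
  proof (cases "k = 0")
    case True
    then show ?thesis using that[of 1] by (simp add: q_def idem_1)
  next
    case False
    then show ?thesis using idem_Suc[of k U] Suc.prems that by (auto simp: q_def cscale_mult_right[symmetric])
  qed
  have IH: "A * cst (idem U k) = (1 - g * S) * cst (idem U k)"
    using Suc by (simp add: A_def g_def S_def)
  have P0F: "P0 q * cst (idem U k) = cst (idem U k) * P0 q"
    by (rule P0_cst) (use idem_unit_at q in \<open>simp add: q_def\<close>)
  have T: "(1 - gq * P0 q) * cst (idem U k) = cst (idem U k) * (1 - gq * P0 q)"
    by (simp add: left_diff_distrib right_diff_distrib mult.assoc P0F gq_def scl_left_commute)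
  have "S * P0 q = P0 q * cst (JM q)"
  proof -
    have "S * P0 q = (\<Sum>i\<in>{1..k}. P0 q * cst (transp i q))"
      unfolding S_def sum_distrib_right by (rule sum.cong[OF refl], rule P0_exchange) (use q in \<open>auto simp: q_def\<close>)
    also have "\<dots> = P0 q * (\<Sum>i\<in>{1..k}. cst (transp i q))" by (simp add: sum_distrib_left)
    also have "(\<Sum>i\<in>{1..k}. cst (transp i q)) = cst (JM q)"
    proof -
      have "cst (sum f B) = (\<Sum>i\<in>B. cst (f i))" for f :: "nat \<Rightarrow> _" and B
        by (induction B rule: infinite_finite_induct) (simp_all add: cst_add cst_0)
      moreover have "{1..<q} = {1..k}" by (auto simp: q_def)
      ultimately show ?thesis by (simp add: JM_def)
    qed
    finally show ?thesis .
  qed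
  then have "S * (P0 q * F) = P0 q * cst (JM q * idem U q)"
    by (simp add: F_def cst_mult flip: mult.assoc)
  also have "JM q * idem U q = ?\<sigma> *\<^sub>C idem U q"
    using idem_eigen[OF U, of q q] q by (simp add: cscale_mult_left flip: of_int_cscale[where 'a = "(complex, 'N^'n) endo"])
  also have "P0 q * cst (?\<sigma> *\<^sub>C idem U q) = scl (fls_const ?\<sigma>) * (P0 q * F)"
    by (simp add: cst_cscale scl_left_commute F_def)
  finally have SP: "S * (P0 q * F) = scl (fls_const ?\<sigma>) * (P0 q * F)" .
  have "A * (1 - gq * P0 q) * F = A * ((1 - gq * P0 q) * cst (idem U k)) * cst G"
    by (simp only: F_def G cst_mult mult.assoc)
  also have "\<dots> = (A * cst (idem U k)) * (1 - gq * P0 q) * cst G"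
    by (simp only: T mult.assoc)
  also have "\<dots> = (1 - g * S) * (cst (idem U k) * (1 - gq * P0 q)) * cst G"
    by (simp only: IH mult.assoc)
  also have "\<dots> = (1 - g * S) * ((1 - gq * P0 q) * F)"
    by (simp only: T[symmetric] F_def G cst_mult mult.assoc)
  also have "\<dots> = F - g * (S * F) - gq * (P0 q * F) + g * (S * (gq * (P0 q * F)))"
    by (simp add: left_diff_distrib right_diff_distrib mult.assoc)
  also have "S * (gq * (P0 q * F)) = gq * (S * (P0 q * F))"
    by (simp only: gq_def scl_left_commute)
  also have "g * (gq * (S * (P0 q * F))) = scl (resolvent c * resolvent (?\<sigma> + c) * fls_const ?\<sigma>) * (P0 q * F)"
    by (simp only: SP g_def gq_def scl_mult mult.assoc)
  also have "F - g * (S * F) - gq * (P0 q * F) + \<dots> =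
      F - g * (S * F) - scl (resolvent (?\<sigma> + c) - resolvent c * resolvent (?\<sigma> + c) * fls_const ?\<sigma>) * (P0 q * F)"
    by (simp add: scl_diff left_diff_distrib gq_def)
  also have "\<dots> = (1 - g * (S + P0 q)) * F"
    by (simp only: resolvent_shift) (simp add: g_def left_diff_distrib distrib_left distrib_right mult.assoc)
  finally show ?case
    by (simp add: A_def F_def g_def S_def gq_def q_def Endo_mult Endo_lax)
qed

end

section \<open>The representations of the reflection algebra\<close>

text \<open>For a product \<open>\<Phi>(x) \<Phi>(y) F\<close> the factor \<open>\<Phi>(y)\<close> is replaced by \<open>\<Psi>(y)\<close>, and then \<open>F\<close> is moved left past
  \<open>\<Psi>(y)\<close> to meet \<open>\<Phi>(x)\<close>.\<close>
lemma representations_agree: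
  fixes \<Phi> \<Psi> :: "'N::finite yangian \<Rightarrow> 'b::complex_algebra_1"
  assumes \<Phi>: "algebra_hom_on UNIV \<Phi>" and \<Psi>: "algebra_hom_on UNIV \<Psi>"
    and gen: "\<And>i j r. \<Phi> (yangian_t i j r) * F = \<Psi> (yangian_t i j r) * F"
    and comm: "\<And>x. \<Psi> x * F = F * \<Psi> x"
  shows "\<Phi> x * F = \<Psi> x * F"
proof -
  interpret P: unital_hom \<Phi> by (rule algebra_homD(1)[OF \<Phi>])
  interpret Q: unital_hom \<Psi> by (rule algebra_homD(1)[OF \<Psi>])
  from yangian_generated[of x] show ?thesis
  proof induction
    case (gen g)
    then show ?case using assms(3) by auto
  next
    case (mult x y)
    have "\<Phi> (x * y) * F = \<Phi> x * (\<Psi> y * F)" by (simp only: P.hom_mult mult.assoc mult.IH(2))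
    also have "\<dots> = (\<Phi> x * F) * \<Psi> y" by (simp only: comm mult.assoc)
    also have "\<dots> = \<Psi> x * (F * \<Psi> y)" by (simp only: mult.IH(1) mult.assoc)
    also have "\<dots> = \<Psi> (x * y) * F" by (simp only: comm[symmetric] Q.hom_mult mult.assoc)
    finally show ?case .
  qed (simp_all add: P.hom_one Q.hom_one P.hom_add Q.hom_add distrib_right algebra_homD(2)[OF \<Phi>]
      algebra_homD(2)[OF \<Psi>] cscale_mult_left)
qed

lemma matrix_rep_mat_of:
  fixes h :: "'a::complex_algebra_1 \<Rightarrow> (complex, 'i::finite) endo"
  assumes "algebra_hom_on UNIV h"
  shows "matrix_rep_on A (\<lambda>x. mat_of (h x))"
  using assms unfolding matrix_rep_on_def algebra_hom_on_def
  by (simp add: one_endo.rep_eq plus_endo.rep_eq times_endo.rep_eq cscale_endo.rep_eq scalar_mat_def cscale_complex_def)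

context tensor_positions
begin

lemma fusion_entries:
  assumes U: "\<And>m. m \<le> n \<Longrightarrow> standard_filling U m"
  shows "fls_nth ((fls_scalar h *\<^sub>M R_chain (\<lambda>m. resolvent (of_int (box_content (U m)) + c)) n) $ i $ j) r * idem U n =
    fls_nth ((fls_scalar h *\<^sub>M lax (resolvent c) (\<lambda>i j. \<Sum>m\<in>UNIV. unit_at m i j)) $ i $ j) r * idem U n"
proof -
  interpret unital_hom "fls_const :: (complex, 'N^'n) endo \<Rightarrow> _" by (rule unital_hom_fls_const)
  let ?A = "R_chain (\<lambda>m. resolvent (of_int (box_content (U m)) + c)) n"
  let ?B = "lax (resolvent c) (\<lambda>i j. \<Sum>m\<in>UNIV. unit_at m i j) :: ((complex, 'N^'n) endo fls)^'N^'N"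
  have P0: "(\<Sum>m\<in>{1..n}. P0 m) = Endo (\<chi> i j. fls_const (\<Sum>m\<in>UNIV. unit_at m j i))"
  proof (rule endo_eqI)
    fix i j
    have "mat_of (\<Sum>m\<in>{1..n}. P0 m) $ i $ j = (\<Sum>m\<in>{1..n}. fls_const (unit_at (pos m) j i))"
      by (simp add: mat_of_sum P0_def Endo_inverse)
    also have "\<dots> = (\<Sum>m\<in>UNIV. fls_const (unit_at m j i))"
      by (rule sum.reindex_bij_betw[OF pos])
    finally show "mat_of (\<Sum>m\<in>{1..n}. P0 m) $ i $ j = mat_of (Endo (\<chi> i j. fls_const (\<Sum>m\<in>UNIV. unit_at m j i))) $ i $ j"
      by (simp add: Endo_inverse hom_sum)
  qed
  have "Endo ?B = 1 - scl (resolvent c) * (\<Sum>m\<in>{1..n}. P0 m)"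
    unfolding P0 by (rule endo_eqI) (simp add: lax_def scl_def Endo_inverse times_endo.rep_eq minus_endo.rep_eq
      one_endo.rep_eq mat_mult_nth, simp add: mat_def)
  then have "Endo ?A * cst (idem U n) = Endo ?B * cst (idem U n)"
    using fusion[OF U, of n c] by simp
  from arg_cong[OF this, of "\<lambda>M. mat_of M $ i $ j"]
  have "?A $ i $ j * fls_const (idem U n) = ?B $ i $ j * fls_const (idem U n)"
    by (simp add: cst_def times_endo.rep_eq Endo_inverse mat_mult_nth)
  then have "(fls_scalar h * ?A $ i $ j) * fls_const (idem U n) = (fls_scalar h * ?B $ i $ j) * fls_const (idem U n)"
    by (simp only: mult.assoc)
  from arg_cong[OF this, of "\<lambda>F. fls_nth F r"] show ?thesis
    by (simp add: scalar_mat_def)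
qed

text \<open>The factors \<open>R\<^sub>0\<^sub>k(-u - \<sigma>\<^sub>k - w)\<close> are obtained from \<open>R\<^sub>0\<^sub>k(u - \<sigma>\<^sub>k - w)\<close> by \<open>u \<mapsto> -u\<close>, so the reversed product of
  their inverses is \<open>T(-u)\<inverse>\<close>.\<close>
lemma R_product_flatten:
  fixes U \<omega>
  defines "g \<equiv> \<lambda>m. resolvent (of_int (box_content (U m)) + \<omega> / 4)"
  shows "\<exists>V. V ** map_matrix fls_flip (R_chain g n) = mat 1 \<and> flatten (V ** R_chain g n) = R_product pos U \<omega>"
proof -
  define z where "z = (\<lambda>m. fls_X_inv - of_int (box_content (U m)) - fls_const (\<omega> / 4) :: complex fls)"
  define z' where "z' = (\<lambda>m. - fls_X_inv - of_int (box_content (U m)) - fls_const (\<omega> / 4) :: complex fls)"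
  have g: "g = (\<lambda>m. 1 / z m)"
    by (simp add: g_def z_def resolvent_def fls_of_int fls_plus_const[symmetric] diff_diff_eq)
  have fg: "(\<lambda>m. fls_flip (g m)) = (\<lambda>m. 1 / z' m)"
  proof
    fix m
    have "z' m = - (fls_X_inv + fls_const (of_int (box_content (U m)) + \<omega> / 4))"
      by (simp add: z'_def fls_of_int fls_plus_const[symmetric])
    then show "fls_flip (g m) = 1 / z' m"
      unfolding g_def resolvent_neg by (simp only: minus_divide_right)
  qed
  have "\<exists>V. V ** R_chain (\<lambda>m. 1 / z' m) n = mat 1 \<and>
     flatten V = mat_prod (map (\<lambda>k. matrix_inv (R0 k (z' k))) (rev [1..<Suc n]))"
  proof (rule R_chain_inverse)
    fix m
    have "(lax (1 / z' m) (unit_at (pos m)) :: ((complex, 'N^'n) endo fls)^'N^'N)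
        = map_matrix fls_flip (lax (resolvent (of_int (box_content (U m)) + \<omega> / 4)) (unit_at (pos m)))"
      using fun_cong[OF fg, of m] by (simp add: flip_lax g_def)
    then show "\<exists>V. (lax (1 / z' m) (unit_at (pos m)) :: ((complex, 'N^'n) endo fls)^'N^'N) ** V = mat 1 \<and>
        V ** lax (1 / z' m) (unit_at (pos m)) = mat 1"
      using unipotent_series_invertible[OF unipotent_series_flip[OF lax_unipotent]] by metis
  qed
  then obtain V where V: "V ** R_chain (\<lambda>m. 1 / z' m) n = mat 1"
    "flatten V = mat_prod (map (\<lambda>k. matrix_inv (R0 k (z' k))) (rev [1..<Suc n]))" by blast
  have "V ** map_matrix fls_flip (R_chain g n) = mat 1"
    by (simp only: flip_R_chain fg V)
  moreover have "flatten (V ** R_chain g n) = R_product pos U \<omega>"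
    unfolding flatten_mult V(2) g flatten_R_chain
    by (simp only: R_product_def Let_def z_def z'_def n)
  ultimately show ?thesis by blast
qed

lemma L_space_eq: "L_space pos U = range ((*v) (mat_of (idem U n)))"
  by (simp add: L_space_def idem_def mat_of_alg n)

lemma gl_hom_commutes:
  assumes \<pi>: "algebra_hom_on UNIV \<pi>" "\<And>i j. \<pi> (gl_E i j) = (\<Sum>m\<in>UNIV. unit_at m i j :: (complex, 'N^'n) endo)"
  shows "\<pi> x * idem U n = idem U n * \<pi> x"
proof -
  interpret unital_hom \<pi> by (rule algebra_homD(1)[OF \<pi>(1)])
  from gl_envelope_generated[of x] show ?thesis
  proof induction
    case (gen g)
    then show ?case using idem_total[of U] \<pi>(2) by auto
  next
    case (mult x y)
    have "\<pi> (x * y) * idem U n = (\<pi> x * idem U n) * \<pi> y" by (simp only: hom_mult mult.assoc mult.IH(2))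
    then show ?case by (simp only: mult.IH(1) hom_mult mult.assoc)
  qed (simp_all add: hom_one hom_add distrib_right distrib_left algebra_homD(2)[OF \<pi>(1)]
      cscale_mult_left cscale_mult_right)
qed

text \<open>The two homomorphisms exist for each scalar factor \<open>h\<close>, with the same representation \<open>\<pi>\<close> of \<open>gl\<^sub>N\<close>;
  the identity intertwines them because they agree on the range of \<open>idem U n\<close>.\<close>
theorem reflection_representations:
  assumes U: "\<And>m. m \<le> n \<Longrightarrow> standard_filling U m"
    and \<pi>: "algebra_hom_on UNIV \<pi>" "\<And>i j. \<pi> (gl_E i j) = (\<Sum>m\<in>UNIV. unit_at m i j :: (complex, 'N^'n) endo)"
    and h: "unipotent_scalar h"
  shows "\<exists>\<rho> \<eta>. reflection_rep \<rho> ((h / fls_flip h) *\<^sub>M R_product pos U \<omega>) \<and>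
     invariant_under reflection_algebra \<rho> (L_space pos U) \<and>
     reflection_hom \<eta> (fls_scalar (h / fls_flip h) *\<^sub>M evaluation_Smat \<omega>) \<and>
     isomorphic_reps reflection_algebra \<rho> (L_space pos U) ((\<lambda>x. mat_of (\<pi> x)) \<circ> \<eta>) (L_space pos U)"
proof -
  define g where "g = (\<lambda>m. resolvent (of_int (box_content (U m)) + \<omega> / 4))"
  let ?F = "idem U n"
  obtain ev :: "'N yangian \<Rightarrow> 'N gl_envelope" where ev: "algebra_hom_on UNIV ev"
    "map_matrix (map_fls ev) Tmat = fls_scalar h *\<^sub>M lax (resolvent (\<omega> / 4)) gl_E"
    "map_matrix (map_fls ev) Smat = fls_scalar (h / fls_flip h) *\<^sub>M evaluation_Smat \<omega>"
    using evaluation_hom[OF h] by metis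
  have chain: "unipotent_series (R_chain g n)" "rtt_series (R_chain g n)"
    using R_chain_lax[OF order_refl, of "\<lambda>m. of_int (box_content (U m)) + \<omega> / 4"] by (simp_all add: g_def)
  obtain \<Phi> :: "'N yangian \<Rightarrow> (complex, 'N^'n) endo" where \<Phi>: "algebra_hom_on UNIV \<Phi>"
    "map_matrix (map_fls \<Phi>) Tmat = fls_scalar h *\<^sub>M R_chain g n"
    "\<And>i j r. \<Phi> (yangian_t i j r) = fls_nth ((fls_scalar h *\<^sub>M R_chain g n) $ i $ j) (int r)"
    using yangian_hom_exists[OF unipotent_series_scalar[OF h chain(1)] rtt_series_scalar[OF chain(2), of h]] by metis
  interpret P: unital_hom \<Phi> by (rule algebra_homD(1)[OF \<Phi>(1)])
  interpret pi: unital_hom \<pi> by (rule algebra_homD(1)[OF \<pi>(1)])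
  interpret e: unital_hom ev by (rule algebra_homD(1)[OF ev(1)])
  have \<Psi>: "algebra_hom_on UNIV (\<lambda>x. \<pi> (ev x))"
    using \<pi>(1) ev(1) by (simp add: algebra_hom_on_def)
  have \<pi>_ev: "\<pi> (ev (yangian_t i j r)) =
      fls_nth ((fls_scalar h *\<^sub>M lax (resolvent (\<omega> / 4)) (\<lambda>i j. \<Sum>m\<in>UNIV. unit_at m i j)) $ i $ j) (int r)" for i j r
  proof -
    have "map_matrix (map_fls \<pi>) (map_matrix (map_fls ev) Tmat) =
        fls_scalar h *\<^sub>M lax (resolvent (\<omega> / 4)) (\<lambda>i j. \<Sum>m\<in>UNIV. unit_at m i j)"
      unfolding ev(2) map_lax[OF \<pi>(1)] \<pi>(2) ..
    from arg_cong[OF this, of "\<lambda>M. fls_nth (M $ i $ j) (int r)"] show ?thesis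
      by (simp add: pi.fls_nth_map_fls e.fls_nth_map_fls Tmat_def)
  qed
  have agree: "\<Phi> x * ?F = \<pi> (ev x) * ?F" for x
  proof (rule representations_agree[OF \<Phi>(1) \<Psi>])
    show "\<Phi> (yangian_t i j r) * ?F = \<pi> (ev (yangian_t i j r)) * ?F" for i j r
      unfolding \<Phi>(3) \<pi>_ev g_def by (rule fusion_entries[OF U])
    show "\<pi> (ev x) * ?F = ?F * \<pi> (ev x)" for x by (rule gl_hom_commutes[OF \<pi>])
  qed
  have L: "mat_of (\<Phi> x) *v v = mat_of (\<pi> (ev x)) *v v" "mat_of (\<pi> (ev x)) *v v \<in> L_space pos U"
    if v: "v \<in> L_space pos U" for x v
  proof -
    obtain y where y: "v = mat_of ?F *v y" using v unfolding L_space_eq by blast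
    show "mat_of (\<Phi> x) *v v = mat_of (\<pi> (ev x)) *v v"
      using agree[of x] by (simp add: y matrix_vector_mul_assoc flip: times_endo.rep_eq)
    have "mat_of (\<pi> (ev x)) *v v = mat_of ?F *v (mat_of (\<pi> (ev x)) *v y)"
      using gl_hom_commutes[OF \<pi>] by (simp add: y matrix_vector_mul_assoc flip: times_endo.rep_eq)
    then show "mat_of (\<pi> (ev x)) *v v \<in> L_space pos U" unfolding L_space_eq by blast
  qed
  obtain V where V: "V ** map_matrix fls_flip (R_chain g n) = mat 1"
    "flatten (V ** R_chain g n) = R_product pos U \<omega>"
    using R_product_flatten[of U \<omega>] unfolding g_def by blast
  have S: "flatten (map_matrix (map_fls \<Phi>) Smat) = (h / fls_flip h) *\<^sub>M R_product pos U \<omega>"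
    unfolding map_Smat_scaled[OF \<Phi>(1,2) h V(1)] flatten_scalar V(2) ..
  have "reflection_rep (\<lambda>x. mat_of (\<Phi> x)) ((h / fls_flip h) *\<^sub>M R_product pos U \<omega>)"
    unfolding reflection_rep_def S[symmetric]
  proof (intro conjI allI matrix_rep_mat_of \<Phi>(1))
    fix i j w v
    show "map_fls (\<lambda>b. mat_of (\<Phi> b) $ w $ v) (Smat $ i $ j) = flatten (map_matrix (map_fls \<Phi>) Smat) $ (i, w) $ (j, v)"
      by (rule fls_eqI) (simp add: fls_nth_flatten fls_nth_map P.fls_nth_map_fls P.hom_zero zero_endo.rep_eq)
  qed
  moreover have "reflection_hom ev (fls_scalar (h / fls_flip h) *\<^sub>M evaluation_Smat \<omega>)"
    unfolding reflection_hom_def using ev(1,3) by (auto simp: algebra_hom_on_def)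
  moreover have "invariant_under reflection_algebra (\<lambda>x. mat_of (\<Phi> x)) (L_space pos U)"
    using L by (simp add: invariant_under_def)
  moreover have "isomorphic_reps reflection_algebra (\<lambda>x. mat_of (\<Phi> x)) (L_space pos U) ((\<lambda>x. mat_of (\<pi> x)) \<circ> ev) (L_space pos U)"
    unfolding isomorphic_reps_def
  proof (intro conjI exI[of _ id])
    show "invariant_under reflection_algebra (\<lambda>x. mat_of (\<Phi> x)) (L_space pos U)"
      "invariant_under reflection_algebra ((\<lambda>x. mat_of (\<pi> x)) \<circ> ev) (L_space pos U)"
      using L by (simp_all add: invariant_under_def)
    show "\<forall>a\<in>reflection_algebra. \<forall>v\<in>L_space pos U.
        id (mat_of (\<Phi> a) *v v) = ((\<lambda>x. mat_of (\<pi> x)) \<circ> ev) a *v id v"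
      using L(1) by simp
  qed simp_all
  ultimately show ?thesis by blast
qed

end

theorem proposition4p2:
  fixes \<omega> :: complex
    and lam :: "nat list"
    and U :: "nat \<Rightarrow> nat \<times> nat"
    and pos :: "nat \<Rightarrow> 'n::finite"
    and L :: "(complex^('N::finite^'n)) set"
    and u w :: "complex fls"
  assumes "partition_of CARD('n) lam"
    and "standard_tableau lam U"
    and "bij_betw pos {1..CARD('n)} UNIV"
  defines "L \<equiv> L_space pos U"
    and "u \<equiv> fls_X_inv"
    and "w \<equiv> fls_const (\<omega> / 4)"
  shows "\<exists>\<pi> :: 'N gl_envelope \<Rightarrow> complex^('N^'n)^('N^'n).
      gl_tensor_rep \<pi> \<and> invariant_under UNIV \<pi> L \<and>
      (\<exists>\<rho> \<eta>. reflection_rep \<rho> (((u - w) / (u + w)) *\<^sub>M R_product pos U \<omega>) \<and>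
             invariant_under reflection_algebra \<rho> L \<and>
             reflection_hom \<eta> (fls_scalar ((u - w) / (u + w)) *\<^sub>M evaluation_Smat \<omega>) \<and>
             isomorphic_reps reflection_algebra \<rho> L (\<pi> \<circ> \<eta>) L) \<and>
      (\<exists>\<rho> \<eta>. reflection_rep \<rho> (R_product pos U \<omega>) \<and>
             invariant_under reflection_algebra \<rho> L \<and>
             reflection_hom \<eta> (evaluation_Smat \<omega>) \<and>
             isomorphic_reps reflection_algebra \<rho> L (\<pi> \<circ> \<eta>) L)"
proof -
  interpret tensor_positions "CARD('n)" pos "TYPE('N)"
    using assms(3) by unfold_locales simp_all
  have U: "standard_filling U m" if "m \<le> CARD('n)" for m
    by (rule standard_filling_of_tableau[OF assms(1,2) that])
  obtain \<pi> :: "'N gl_envelope \<Rightarrow> (complex, 'N^'n) endo" where \<pi>: "algebra_hom_on UNIV \<pi>"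
    "\<And>i j. \<pi> (gl_E i j) = (\<Sum>m\<in>UNIV. unit_at m i j)"
    using gl_envelope_lift[OF gl_family_total[of UNIV]] by metis
  let ?\<pi> = "\<lambda>x. mat_of (\<pi> x)"
  have rep: "gl_tensor_rep ?\<pi>"
    unfolding gl_tensor_rep_def using matrix_rep_mat_of[OF \<pi>(1)]
    by (simp add: \<pi>(2) mat_of_sum unit_at_def Endo_inverse)
  have inv: "invariant_under UNIV ?\<pi> L"
    unfolding invariant_under_def L_def L_space_eq
  proof (intro ballI)
    fix x v assume "v \<in> range ((*v) (mat_of (idem U CARD('n))))"
    then obtain y where y: "v = mat_of (idem U CARD('n)) *v y" by blast
    have "mat_of (\<pi> x) *v v = mat_of (idem U CARD('n)) *v (mat_of (\<pi> x) *v y)"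
      using gl_hom_commutes[OF \<pi>, of x U] by (simp add: y matrix_vector_mul_assoc flip: times_endo.rep_eq)
    then show "mat_of (\<pi> x) *v v \<in> range ((*v) (mat_of (idem U CARD('n))))" by blast
  qed
  \<comment> \<open>the factor \<open>1 - w/u\<close>, for which \<open>h(u)/h(-u) = (u - w)/(u + w)\<close>\<close>
  define h where "h = 1 - w * fls_X"
  have h: "unipotent_scalar h"
    by (auto simp: unipotent_scalar_def h_def w_def fls_X_times_conv_shift)
  have "u * fls_X = 1"
    unfolding u_def by (rule fls_eqI) (simp add: fls_X_times_conv_shift)
  then have uh: "u * h = u - w" "u * (1 + w * fls_X) = u + w"
    by (simp_all add: h_def algebra_simps)
  have flip: "fls_flip h = 1 + w * fls_X"
  proof (rule fls_eqI)
    fix k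
    show "fls_nth (fls_flip h) k = fls_nth (1 + w * fls_X) k"
      by (simp add: fls_nth_flip h_def w_def fls_X_times_conv_shift)
  qed
  have "u \<noteq> 0" by (simp add: u_def)
  then have ratio: "h / fls_flip h = (u - w) / (u + w)"
    unfolding flip uh[symmetric] by simp
  have one: "unipotent_scalar 1" "1 / fls_flip 1 = (1 :: complex fls)" "fls_scalar 1 = (1 :: 'N gl_envelope fls)"
    by (simp_all add: unipotent_scalar_def unital_hom.hom_one[OF unital_hom_fls_flip]
        unital_hom.hom_one[OF unital_hom_fls_scalar])
  show ?thesis
    using rep inv reflection_representations[OF U \<pi> h, of \<omega>] reflection_representations[OF U \<pi> one(1), of \<omega>]
    unfolding ratio one L_def[symmetric] scalar_mat_one by blast
qed

end
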